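(* Let $G$ be a graph with at most $7$ vertices. Then $\xi(G)=\lfloor Z\rfloor(G)$.
   Context: Graphs are finite, simple and undirected. $\mathcal{S}(G)$ is the set of real symmetric matrices indexed by $V(G)$ whose $i,j$-entry, $i\neq j$, is nonzero if $i$ and $j$ are adjacent in $G$ and zero otherwise (diagonal entries are arbitrary real numbers). A symmetric matrix $A$ has the Strong Arnold Property (SAP) if $X=O$ is the only real symmetric matrix with $A\circ X=O$, $I\circ X=O$ and $AX=O$, where $\circ$ is the entrywise product. $\xi(G)=\max\{\mathrm{null}(A):A\in\mathcal{S}(G),\ A\text{ has the SAP}\}$, where $\mathrm{null}(A)$ is the nullity of $A$. $\lfloor Z\rfloor(G)$ is the minimum cardinality of a set of vertices of $G$ such that, if initially exactly these vertices are colored blue and the others white, then every vertex can be turned blue by repeated applications of the following color change rule: (a) if $i$ is a blue vertex and $j$ is the only white neighbor of $i$, then $i$ may force $j$ to become blue; (b) if $i$ is blue, $i$ has no white neighbors, and $i$ has not yet been used to make a force, then $i$ may pick any one white vertex $j$ and force it to become blue. *)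

theory Defs
  imports "HOL-Analysis.Analysis" "HOL-Analysis.Finite_Function_Topology" "Graph_Theory.Pair_Digraph"
begin

text \<open>
  A finite simple undirected graph is a \<^locale>\<open>pair_graph\<close>: a finite vertex set with a symmetric,
  irreflexive set of arcs between its vertices, an edge between \<open>i\<close> and \<open>j\<close> being the pair of arcs
  \<open>(i, j)\<close> and \<open>(j, i)\<close>. The vertex set may be empty.

  A real matrix indexed by a finite set \<open>V\<close> is a function \<open>A :: 'a \<Rightarrow> 'a \<Rightarrow> real\<close>, of which only the
  entries \<open>A i j\<close> with \<open>i, j \<in> V\<close> are ever inspected.
\<close>

definition symmetric_on :: "'a set \<Rightarrow> ('a \<Rightarrow> 'a \<Rightarrow> real) \<Rightarrow> bool" where
  "symmetric_on V A \<longleftrightarrow> (\<forall>i\<in>V. \<forall>j\<in>V. A i j = A j i)"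

definition graph_matrices :: "'a pair_pre_digraph \<Rightarrow> ('a \<Rightarrow> 'a \<Rightarrow> real) set" where
  "graph_matrices G = {A. symmetric_on (pverts G) A \<and>
     (\<forall>i\<in>pverts G. \<forall>j\<in>pverts G. i \<noteq> j \<longrightarrow> (A i j \<noteq> 0 \<longleftrightarrow> (i, j) \<in> parcs G))}"

text \<open>The three vanishing conditions are \<open>A \<circ> X = O\<close>, \<open>I \<circ> X = O\<close> and \<open>A X = O\<close>.\<close>

definition strong_arnold :: "'a set \<Rightarrow> ('a \<Rightarrow> 'a \<Rightarrow> real) \<Rightarrow> bool" where
  "strong_arnold V A \<longleftrightarrow>
     (\<forall>X. symmetric_on V X \<longrightarrow>
          (\<forall>i\<in>V. \<forall>j\<in>V. A i j * X i j = 0) \<longrightarrow>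
          (\<forall>i\<in>V. X i i = 0) \<longrightarrow>
          (\<forall>i\<in>V. \<forall>j\<in>V. (\<Sum>k\<in>V. A i k * X k j) = 0) \<longrightarrow>
          (\<forall>i\<in>V. \<forall>j\<in>V. X i j = 0))"

text \<open>
  Vectors indexed by \<open>V\<close> are the finitely supported functions whose support lies in \<open>V\<close>, so that
  \<^const>\<open>dim\<close> is the dimension of the kernel of \<open>A\<close> as a subspace of a real vector space.
\<close>

definition kernel_on :: "'a set \<Rightarrow> ('a \<Rightarrow> 'a \<Rightarrow> real) \<Rightarrow> ('a \<Rightarrow>\<^sub>0 real) set" where
  "kernel_on V A = {x. Poly_Mapping.keys x \<subseteq> V \<and>
     (\<forall>i\<in>V. (\<Sum>j\<in>V. A i j * Poly_Mapping.lookup x j) = 0)}"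

definition nullity_on :: "'a set \<Rightarrow> ('a \<Rightarrow> 'a \<Rightarrow> real) \<Rightarrow> nat" where
  "nullity_on V A = dim (kernel_on V A)"

definition xi_nullities :: "'a pair_pre_digraph \<Rightarrow> nat set" where
  "xi_nullities G =
     {nullity_on (pverts G) A |A. A \<in> graph_matrices G \<and> strong_arnold (pverts G) A}"

definition xi :: "'a pair_pre_digraph \<Rightarrow> nat" where
  "xi G = Max (xi_nullities G)"

definition white_neighbors :: "'a pair_pre_digraph \<Rightarrow> 'a set \<Rightarrow> 'a \<Rightarrow> 'a set" where
  "white_neighbors G B i = {j \<in> pverts G - B. (i, j) \<in> parcs G}"

text \<open>
  A state \<open>(B, U)\<close> consists of the set \<open>B\<close> of blue vertices and the set \<open>U\<close> of vertices that have
  already been used to make a force, by either of the two rules.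
\<close>

inductive floor_force ::
  "'a pair_pre_digraph \<Rightarrow> 'a set \<times> 'a set \<Rightarrow> 'a set \<times> 'a set \<Rightarrow> bool"
  for G :: "'a pair_pre_digraph" where
  only_white_neighbor:
    "\<lbrakk>i \<in> B; white_neighbors G B i = {j}\<rbrakk>
       \<Longrightarrow> floor_force G (B, U) (insert j B, insert i U)"
| hop:
    "\<lbrakk>i \<in> B; white_neighbors G B i = {}; i \<notin> U; j \<in> pverts G - B\<rbrakk>
       \<Longrightarrow> floor_force G (B, U) (insert j B, insert i U)"

definition floor_forcing_set :: "'a pair_pre_digraph \<Rightarrow> 'a set \<Rightarrow> bool" where
  "floor_forcing_set G S \<longleftrightarrow>
     S \<subseteq> pverts G \<and> (\<exists>U. (floor_force G)\<^sup>*\<^sup>* (S, {}) (pverts G, U))"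

definition floor_Z :: "'a pair_pre_digraph \<Rightarrow> nat" where
  "floor_Z G = Min {card S |S. floor_forcing_set G S}"


text \<open>The maximum and the minimum above range over finite nonempty sets.\<close>

lemma nullity_on_le_card:
  assumes "finite V"
  shows "nullity_on V A \<le> card V"
proof -
  let ?e = "\<lambda>i. Poly_Mapping.single i (1::real)"
  have "x \<in> span (?e ` V)" if "Poly_Mapping.keys x \<subseteq> V" for x :: "'a \<Rightarrow>\<^sub>0 real"
  proof -
    have lookup_scaleR: "Poly_Mapping.lookup (c *\<^sub>R y) k = c * Poly_Mapping.lookup y k"
      for c k and y :: "'a \<Rightarrow>\<^sub>0 real"
    proof -
      have "finite {k. c * Poly_Mapping.lookup y k \<noteq> 0}"
        by (rule finite_subset[OF _ finite_lookup[of y]]) auto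
      then show ?thesis
        by (simp add: scaleR_poly_mapping_def)
    qed
    have "x = (\<Sum>i\<in>Poly_Mapping.keys x. Poly_Mapping.lookup x i *\<^sub>R ?e i)"
      by (rule poly_mapping_eqI)
        (simp add: lookup_sum lookup_scaleR lookup_single when_def in_keys_iff if_distrib cong: if_cong)
    also have "\<dots> \<in> span (?e ` V)"
      using that by (intro span_sum span_scale span_base) auto
    finally show ?thesis .
  qed
  then have "kernel_on V A \<subseteq> span (?e ` V)"
    by (auto simp: kernel_on_def)
  then have "dim (kernel_on V A) \<le> card (?e ` V)"
    using assms by (intro dim_le_card) auto
  also have "\<dots> \<le> card V"
    using assms by (rule card_image_le)
  finally show ?thesis
    by (simp add: nullity_on_def)
qed

lemma finite_xi_nullities:
  assumes "pair_graph G"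
  shows "finite (xi_nullities G)"
proof -
  interpret pair_graph G by fact
  have "xi_nullities G \<subseteq> {..card (pverts G)}"
    using nullity_on_le_card[OF pair_finite_verts] by (auto simp: xi_nullities_def)
  then show ?thesis
    by (rule finite_subset) simp
qed

lemma xi_nullities_nonempty:
  assumes "pair_graph G"
  shows "xi_nullities G \<noteq> {}"
proof -
  interpret pair_graph G by fact
  let ?V = "pverts G"
  define A where "A = (\<lambda>i j. if i = j then real (card ?V) else if (i, j) \<in> parcs G then 1 else 0)"
  have "(i, j) \<in> parcs G \<longleftrightarrow> (j, i) \<in> parcs G" for i j
    using pair_sym_arcs by (auto simp: symmetric_def sym_def)
  then have A: "A \<in> graph_matrices G"
    by (auto simp: graph_matrices_def symmetric_on_def A_def)
  have "X i j = 0"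
    if AX: "\<forall>i\<in>?V. \<forall>j\<in>?V. (\<Sum>k\<in>?V. A i k * X k j) = 0" and "i \<in> ?V" "j \<in> ?V"
    for X and i j
  proof -
    define m where "m = Max ((\<lambda>k. \<bar>X k j\<bar>) ` ?V)"
    have "m \<in> (\<lambda>k. \<bar>X k j\<bar>) ` ?V"
      unfolding m_def using that pair_finite_verts by (intro Max_in) auto
    then obtain p where p: "p \<in> ?V" "\<bar>X p j\<bar> = m"
      by auto
    have le: "\<bar>X k j\<bar> \<le> m" if "k \<in> ?V" for k
      unfolding m_def using that pair_finite_verts by auto
    have "0 = (\<Sum>k\<in>?V. A p k * X k j)"
      using AX p \<open>j \<in> ?V\<close> by simp
    also have "\<dots> = A p p * X p j + (\<Sum>k\<in>?V - {p}. A p k * X k j)"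
      using p pair_finite_verts by (simp add: sum.remove)
    finally have "\<bar>A p p * X p j\<bar> = \<bar>\<Sum>k\<in>?V - {p}. A p k * X k j\<bar>"
      by linarith
    then have "real (card ?V) * m = \<bar>\<Sum>k\<in>?V - {p}. A p k * X k j\<bar>"
      by (simp add: abs_mult p(2)) (simp add: A_def)
    also have "\<dots> \<le> (\<Sum>k\<in>?V - {p}. \<bar>A p k * X k j\<bar>)"
      by (rule sum_abs)
    also have "\<dots> \<le> (\<Sum>k\<in>?V - {p}. m)"
      using le by (intro sum_mono) (auto simp: A_def intro: order_trans[OF abs_ge_zero])
    also have "\<dots> = (real (card ?V) - 1) * m"
    proof -
      have "card ?V > 0"
        using p pair_finite_verts card_gt_0_iff by blast
      then show ?thesis
        using p pair_finite_verts by (simp add: of_nat_diff)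
    qed
    finally have "m \<le> 0"
      by (simp add: algebra_simps)
    then show ?thesis
      using le[OF \<open>i \<in> ?V\<close>] by simp
  qed
  then have "strong_arnold ?V A"
    by (auto simp: strong_arnold_def)
  with A show ?thesis
    by (auto simp: xi_nullities_def)
qed

lemma finite_floor_forcing_cards:
  assumes "pair_graph G"
  shows "finite {card S |S. floor_forcing_set G S}"
proof -
  interpret pair_graph G by fact
  have "{card S |S. floor_forcing_set G S} \<subseteq> card ` Pow (pverts G)"
    by (auto simp: floor_forcing_set_def)
  then show ?thesis
    by (rule finite_subset) (simp add: pair_finite_verts)
qed

lemma floor_forcing_cards_nonempty: "{card S |S. floor_forcing_set G S} \<noteq> {}"
  by (auto simp: floor_forcing_set_def)

end

theory Submission
  imports Defs
begin

text \<open>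
  Upper bound: let \<open>A\<close> have the Strong Arnold Property. This property says that the tangent space of the
  congruence orbit of \<open>A\<close> and the space of matrices with the pattern of \<open>A\<close> together span everything, so
  by the open mapping form of the inverse function theorem arbitrary new edges can be switched on
  by a small perturbation that keeps the nullity and the Strong Arnold Property. Adding an edge for
  each hop of a forcing run turns the run into ordinary zero forcing, which bounds the nullity.

  Lower bound: by the same perturbation it suffices to find, for each \<open>k\<close>, matrices with nullity \<open>k\<close>
  for the subgraph-minimal graphs on at most 7 vertices that cannot be forced by \<open>k - 1\<close> vertices;
  up to isolated vertices there are 32 of them. That every graph contains one of these
  or can be forced by \<open>k - 1\<close> vertices is a finite statement about sets of edges and non-edges; it is
  verified by resolution proofs in which previously derived clauses are reused up to renaming of the vertices.
\<close>

section \<open>Perturbation of matrices with the Strong Arnold Property\<close>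

text \<open>Zero forcing bounds the nullity because a kernel vector that vanishes on the blue
  vertices also vanishes at the forced vertex, by the equation in the row of the forcing vertex. At
  a hop along a non-edge this row has a zero entry at the forced vertex and yields nothing. An
  arbitrary change of that entry would destroy the kernel, whereas moving along the congruence orbit
  keeps the nullity. The Strong Arnold Property is the transversality that allows the off-diagonal
  zeros to be replaced by prescribed small values along the orbit, while the diagonal and the
  nonzero entries adjust. For the lower bound, a matrix of nullity at least \<open>k\<close> on
  \<open>q\<close> vertices is given as a weighted Gram matrix of \<open>q\<close> vectors of length
  \<open>q - k\<close>. Its rank is then bounded by its form, and its Strong Arnold Property is a
  question of full column rank over the integers. The two bounds meet in the dichotomy that
  \<open>floor_Z G\<close> is at most \<open>m\<close> or \<open>xi G\<close> exceeds
  \<open>m\<close>, read at \<open>m = xi G\<close>.\<close>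

lemma bounded_bilinear_matrix_matrix_mult:
  "bounded_bilinear ((**) :: real^'n^'m \<Rightarrow> real^'p^'n \<Rightarrow> real^'p^'m)"
proof -
  have "bilinear ((**) :: real^'n^'m \<Rightarrow> real^'p^'n \<Rightarrow> real^'p^'m)"
    unfolding bilinear_def
    by (auto intro!: linearI simp: matrix_add_ldistrib scalar_matrix_assoc
        matrix_scalar_ac vec_eq_iff matrix_matrix_mult_def sum.distrib algebra_simps sum_distrib_left)
  then show ?thesis
    by (simp add: bilinear_conv_bounded_bilinear)
qed

lemma linear_transpose: "linear (transpose :: real^'n^'m \<Rightarrow> real^'m^'n)"
  by (intro linearI) (simp_all add: transpose_def vec_eq_iff)

lemma inner_matrix: "(X :: real^'n^'m) \<bullet> Y = (\<Sum>i\<in>UNIV. \<Sum>j\<in>UNIV. X $ i $ j * Y $ i $ j)"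
  by (simp add: inner_vec_def)

lemma inner_matrix_mult_left:
  "(X :: real^'n^'m) \<bullet> (A ** Y) = (transpose A ** X) \<bullet> Y"
proof -
  have "X \<bullet> (A ** Y) = (\<Sum>i\<in>UNIV. \<Sum>j\<in>UNIV. \<Sum>k\<in>UNIV. X $ i $ j * (A $ i $ k * Y $ k $ j))"
    by (simp add: inner_matrix matrix_matrix_mult_def sum_distrib_left)
  also have "\<dots> = (\<Sum>i\<in>UNIV. \<Sum>k\<in>UNIV. \<Sum>j\<in>UNIV. X $ i $ j * (A $ i $ k * Y $ k $ j))"
    by (rule sum.cong[OF refl], rule sum.swap)
  also have "\<dots> = (\<Sum>k\<in>UNIV. \<Sum>i\<in>UNIV. \<Sum>j\<in>UNIV. X $ i $ j * (A $ i $ k * Y $ k $ j))"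
    by (rule sum.swap)
  also have "\<dots> = (\<Sum>k\<in>UNIV. \<Sum>j\<in>UNIV. \<Sum>i\<in>UNIV. X $ i $ j * (A $ i $ k * Y $ k $ j))"
    by (rule sum.cong[OF refl], rule sum.swap)
  also have "\<dots> = (transpose A ** X) \<bullet> Y"
    by (simp add: inner_matrix matrix_matrix_mult_def transpose_def sum_distrib_left mult_ac)
  finally show ?thesis .
qed

lemma inner_transpose: "transpose X \<bullet> transpose Y = (X :: real^'n^'m) \<bullet> Y"
  unfolding inner_matrix transpose_def by simp (rule sum.swap)

text \<open>
  A linear functional description of the constraints in the Strong Arnold Property: off the
  support of \<open>A\<close> only the skew-symmetric part survives, so that the kernel of this map consists of
  the symmetric matrices that vanish on the diagonal and on the support of \<open>A\<close>, and its image is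
  orthogonal to exactly these matrices.
\<close>

definition pattern_part :: "real^'n^'n \<Rightarrow> real^'n^'n \<Rightarrow> real^'n^'n" where
  "pattern_part A B = (\<chi> i j. if i = j \<or> A $ i $ j \<noteq> 0 then B $ i $ j else B $ i $ j - B $ j $ i)"

definition strong_arnold_matrix :: "real^'n^'n \<Rightarrow> bool" where
  "strong_arnold_matrix A \<longleftrightarrow>
     (\<forall>X. transpose X = X \<longrightarrow> (\<forall>i j. i = j \<or> A $ i $ j \<noteq> 0 \<longrightarrow> X $ i $ j = 0) \<longrightarrow> A ** X = 0 \<longrightarrow> X = 0)"

lemma linear_pattern_part: "linear (pattern_part A)"
  by (intro linearI) (auto simp: pattern_part_def vec_eq_iff algebra_simps)

lemma pattern_part_eq_0_iff:
  assumes "transpose A = A"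
  shows "pattern_part A X = 0 \<longleftrightarrow> transpose X = X \<and> (\<forall>i j. i = j \<or> A $ i $ j \<noteq> 0 \<longrightarrow> X $ i $ j = 0)"
proof -
  have "A $ j $ i = A $ i $ j" for i j
    using arg_cong[OF assms, of "\<lambda>M. M $ i $ j"] by (simp add: transpose_def)
  then show ?thesis
    by (auto simp: pattern_part_def vec_eq_iff transpose_def) metis+
qed

text \<open>For symmetric \<open>A\<close> the map \<open>pattern_part A\<close> is self-adjoint: it
  is the identity on the diagonal and the support, and on the two entries of any other pair it acts
  as the symmetric 2 by 2 matrix with rows (1, -1) and (-1, 1). So the orthogonal complement of its
  range is its kernel. The proof tests with the matrix units \<open>B\<close>.\<close>

lemma orthogonal_range_pattern_part:
  assumes A: "transpose A = A" and orth: "\<And>B. X \<bullet> pattern_part A B = 0"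
  shows "pattern_part A X = 0"
proof -
  have sym: "A $ j $ i = A $ i $ j" for i j
    using arg_cong[OF A, of "\<lambda>M. M $ i $ j"] by (simp add: transpose_def)
  have "pattern_part A X $ i $ j = 0" for i j
  proof -
    define B :: "real^'a^'a" where "B = (\<chi> p q. if p = i \<and> q = j then 1 else 0)"
    have *: "(\<Sum>p\<in>UNIV. \<Sum>q\<in>UNIV. X $ p $ q * (if p = a \<and> q = b then 1 else 0)) = X $ a $ b" for a b
    proof -
      have "(\<Sum>q\<in>UNIV. X $ p $ q * (if p = a \<and> q = b then 1 else 0)) = (if p = a then X $ p $ b else 0)" for p
        by (cases "p = a") (simp_all add: if_distrib cong: if_cong)
      then show ?thesis by simp
    qed
    have "0 = X \<bullet> pattern_part A B" using orth by simp
    also have "\<dots> = pattern_part A X $ i $ j"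
    proof (cases "i = j \<or> A $ i $ j \<noteq> 0")
      case True
      have "pattern_part A B = B"
        using True sym by (auto simp: pattern_part_def B_def vec_eq_iff)
      then show ?thesis using True by (simp add: inner_matrix B_def * pattern_part_def)
    next
      case False
      then have "pattern_part A B = B - transpose B"
        using sym by (auto simp: pattern_part_def B_def vec_eq_iff transpose_def)
      moreover have "X \<bullet> B = X $ i $ j" by (simp add: inner_matrix B_def *)
      moreover have "X \<bullet> transpose B = X $ j $ i"
        using *[of j i] by (simp add: inner_matrix B_def transpose_def conj_commute)
      ultimately show ?thesis using False by (simp add: inner_diff_right pattern_part_def)
    qed
    finally show ?thesis by simp
  qed
  then show ?thesis by (simp add: vec_eq_iff)
qed

text \<open>A proper subspace has a nonzero vector orthogonal to it. This is the duality that turns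
  the Strong Arnold Property, a statement about the absence of certain \<open>X\<close>, into
  surjectivity of a derivative.\<close>

lemma linear_surjI:
  fixes f :: "'a::euclidean_space \<Rightarrow> 'b::euclidean_space"
  assumes "linear f" and "\<And>x. (\<And>y. x \<bullet> f y = 0) \<Longrightarrow> x = 0"
  shows "surj f"
proof (rule ccontr)
  assume "\<not> surj f"
  have sub: "subspace (range f)"
    using assms(1) by (simp add: linear_subspace_image)
  have "dim (range f) < DIM('b)"
    using \<open>\<not> surj f\<close> sub by (metis dim_eq_full dim_subset_UNIV le_neq_implies_less span_eq_iff)
  then obtain x where "x \<noteq> 0" "\<And>y. y \<in> span (range f) \<Longrightarrow> orthogonal x y"
    using orthogonal_to_subspace_exists by blast
  then show False
    using assms(2)[of x] by (auto simp: orthogonal_def span_base)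
qed

text \<open>The map \<open>?F\<close> adds a point of the congruence orbit to a correction from the
  range of \<open>pattern_part A\<close>, and \<open>?L\<close> is its derivative at 0. A matrix
  orthogonal to the range of \<open>?L\<close> is one of the matrices \<open>X\<close> excluded by
  the property, so \<open>?L\<close> is onto and \<open>?F\<close> is open at 0. Hence
  \<open>A + d *\<^sub>R C\<close> is reached for small \<open>d\<close>, and its orbit part is the
  desired \<open>A'\<close>. Allowing skew corrections makes \<open>?L\<close> onto all square
  matrices, so that the symmetric ones need no space of their own.\<close>

lemma strong_arnold_perturbation:
  fixes A :: "real^'n^'n" and H :: "('n \<times> 'n) set"
  assumes A: "transpose A = A" and sap: "strong_arnold_matrix A" and H: "sym H"
    "\<And>i j. (i, j) \<in> H \<Longrightarrow> A $ i $ j = 0"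
  obtains A' Q where "transpose A' = A'" "strong_arnold_matrix A'"
    "\<And>i j. A $ i $ j \<noteq> 0 \<Longrightarrow> A' $ i $ j \<noteq> 0"
    "\<And>i j. \<lbrakk>i \<noteq> j; A $ i $ j = 0\<rbrakk> \<Longrightarrow> A' $ i $ j \<noteq> 0 \<longleftrightarrow> (i, j) \<in> H"
    "invertible Q" "A' = transpose Q ** A ** Q"
proof -
  interpret mm: bounded_bilinear "(**) :: real^'n^'n \<Rightarrow> real^'n^'n \<Rightarrow> real^'n^'n"
    by (rule bounded_bilinear_matrix_matrix_mult)
  have sym: "A $ j $ i = A $ i $ j" for i j
    using arg_cong[OF A, of "\<lambda>M. M $ i $ j"] by (simp add: transpose_def)
  let ?L = "\<lambda>(Y, B). transpose Y ** A + A ** Y + pattern_part A B"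
  let ?G = "\<lambda>Y. transpose (mat 1 + Y) ** A ** (mat 1 + Y)"
  let ?F = "\<lambda>p. ?G (fst p) + pattern_part A (snd p)"
  have blt: "bounded_linear (transpose :: real^'n^'n \<Rightarrow> real^'n^'n)"
    using linear_transpose linear_conv_bounded_linear by blast
  have blp: "bounded_linear (pattern_part A)"
    using linear_pattern_part linear_conv_bounded_linear by blast
  have 0: "pattern_part A 0 = 0" "transpose (0 :: real^'n^'n) = 0"
    using linear_pattern_part linear_transpose linear_0 by blast+
  have linL: "linear ?L"
    by (intro linearI)
      (auto simp: linear_add[OF linear_transpose] linear_cmul[OF linear_transpose]
        linear_add[OF linear_pattern_part] linear_cmul[OF linear_pattern_part]
        mm.add_left mm.add_right mm.scaleR_left mm.scaleR_right algebra_simps)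
  have surj: "surj ?L"
  proof (rule linear_surjI[OF linL])
    fix X assume orth: "\<And>y. X \<bullet> ?L y = 0"
    have "X \<bullet> pattern_part A B = 0" for B
      using orth[of "(0, B)"] by (simp add: 0)
    then have pX: "pattern_part A X = 0"
      by (rule orthogonal_range_pattern_part[OF A])
    then have X: "transpose X = X" and X0: "\<forall>i j. i = j \<or> A $ i $ j \<noteq> 0 \<longrightarrow> X $ i $ j = 0"
      using pattern_part_eq_0_iff[OF A] by auto
    have "X \<bullet> (transpose Y ** A) = X \<bullet> (A ** Y)" for Y
    proof -
      have "X \<bullet> (transpose Y ** A) = transpose X \<bullet> transpose (transpose Y ** A)"
        by (simp only: inner_transpose)
      then show ?thesis by (simp add: X matrix_transpose_mul A)
    qed
    then have "X \<bullet> (A ** Y) = 0" for Y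
      using orth[of "(Y, 0)"] by (simp add: 0 inner_add_right)
    then have "(A ** X) \<bullet> Y = 0" for Y
      by (simp add: inner_matrix_mult_left A)
    then have "A ** X = 0" by (metis inner_eq_zero_iff)
    then show "X = 0" using sap X X0 unfolding strong_arnold_matrix_def by blast
  qed
  obtain g where g: "linear g" "?L \<circ> g = id"
    using linear_surjective_right_inverse[OF linL surj] by blast
  \<comment> \<open>Apart from the affine part \<open>A + ?L p\<close>, only a quadratic remainder
    is left, whose derivative at 0 vanishes.\<close>
  have F_eq: "?F = (\<lambda>p. A + ?L p + transpose (fst p) ** (A ** fst p))"
  proof
    fix p :: "(real^'n^'n) \<times> (real^'n^'n)"
    show "?F p = A + ?L p + transpose (fst p) ** (A ** fst p)"
      by (cases p) (simp add: linear_add[OF linear_transpose] transpose_mat mm.add_left mm.add_right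
          matrix_mul_assoc)
  qed
  have derF: "(?F has_derivative ?L) (at 0)"
  proof -
    have 1: "((\<lambda>p :: (real^'n^'n) \<times> (real^'n^'n). transpose (fst p) ** (A ** fst p)) has_derivative
           (\<lambda>h. transpose (fst (0 :: (real^'n^'n) \<times> (real^'n^'n))) ** (A ** fst h) +
             transpose (fst h) ** (A ** fst (0 :: (real^'n^'n) \<times> (real^'n^'n))))) (at 0)"
      by (intro mm.FDERIV bounded_linear.has_derivative[OF blt] bounded_linear.has_derivative[OF mm.bounded_linear_right]
          has_derivative_fst has_derivative_ident)
    have 2: "((\<lambda>p. A + ?L p) has_derivative ?L) (at 0)"
      using has_derivative_add[OF has_derivative_const[of A]
          bounded_linear_imp_has_derivative[OF linL[unfolded linear_conv_bounded_linear]]]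
      by simp
    show ?thesis
      unfolding F_eq using has_derivative_add[OF 2 1] by (simp add: 0)
  qed
  have contG: "continuous_on UNIV ?G"
    by (intro mm.continuous_on bounded_linear.continuous_on[OF blt] continuous_intros)
  have contF: "continuous_on UNIV ?F"
    using continuous_on_compose2[OF contG continuous_on_fst[OF continuous_on_id]]
    by (intro continuous_on_add bounded_linear.continuous_on[OF blp] continuous_on_snd continuous_on_id) auto
  have contdet: "continuous_on UNIV (\<lambda>Y :: real^'n^'n. det (mat 1 + Y))"
    unfolding det_def by (intro continuous_intros)
  \<comment> \<open>The property says that this linear map is injective. Being bounded below is the
    quantitative form of injectivity that survives replacing \<open>A\<close> by a matrix at
    distance less than \<open>c / K\<close>, where \<open>K\<close> bounds the matrix
    product.\<close>
  obtain c where c: "c > 0" "\<And>X. c * norm X \<le> norm (A ** X, pattern_part A X)"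
  proof -
    have lin: "linear (\<lambda>X. (A ** X, pattern_part A X))"
      by (intro linearI) (auto simp: linear_add[OF linear_pattern_part] linear_cmul[OF linear_pattern_part]
         mm.add_right mm.scaleR_right)
    have "inj (\<lambda>X. (A ** X, pattern_part A X))"
      using sap pattern_part_eq_0_iff[OF A] unfolding linear_injective_0[OF lin] strong_arnold_matrix_def
      by (auto simp: zero_prod_def)
    then show thesis
      using linear_inj_bounded_below_pos[OF lin] that by blast
  qed
  from mm.pos_bounded obtain K where K: "K > 0" "\<forall>(M :: real^'n^'n) (N :: real^'n^'n). norm (M ** N) \<le> norm M * norm N * K"
    by blast 
  \<comment> \<open>These are the open conditions on the parameters: the congruence is invertible,
    the orbit point is close enough to keep the Strong Arnold Property, and no nonzero entry of
    \<open>A\<close> is cancelled. On the support the correction is \<open>B\<close> itself, whence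
    the difference in the last condition.\<close>
  define good where "good p \<longleftrightarrow> det (mat 1 + fst p) \<noteq> 0 \<and> norm (?G (fst p) - A) < c / K \<and>
     (\<forall>i j. A $ i $ j \<noteq> 0 \<longrightarrow> A $ i $ j - snd p $ i $ j \<noteq> 0)" for p :: "(real^'n^'n) \<times> (real^'n^'n)"
  have "open {p. good p}"
  proof -
    have "open {p :: (real^'n^'n) \<times> (real^'n^'n). det (mat 1 + fst p) \<noteq> 0}"
      using continuous_on_compose2[OF contdet continuous_on_fst[OF continuous_on_id]]
      by (intro open_Collect_neq continuous_on_const) auto
    moreover have "open {p :: (real^'n^'n) \<times> (real^'n^'n). norm (?G (fst p) - A) < c / K}"
      using continuous_on_compose2[OF contG continuous_on_fst[OF continuous_on_id]]
      by (intro open_Collect_less continuous_on_const continuous_on_norm continuous_on_diff) auto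
    moreover have "open {p :: (real^'n^'n) \<times> (real^'n^'n). A $ i $ j \<noteq> 0 \<longrightarrow> A $ i $ j - snd p $ i $ j \<noteq> 0}" for i j
      by (cases "A $ i $ j = 0") (auto intro!: open_Collect_neq continuous_intros)
    ultimately show ?thesis
      unfolding good_def by (intro open_Collect_conj) (auto simp: Collect_all_eq intro!: open_INT)
  qed
  moreover have "good 0"
    using c K by (auto simp: good_def transpose_mat)
  ultimately have "?F 0 \<in> interior (?F ` {p. good p})"
    using g linear_conv_bounded_linear
    by (intro sussmann_open_mapping[OF open_UNIV contF _ derF, where g' = g]) (auto simp: interior_open)
  moreover have "?F 0 = A"
    using linear_0[OF linear_pattern_part, of A] by (simp add: transpose_mat)
  ultimately obtain e where e: "e > 0" "ball A e \<subseteq> ?F ` {p. good p}"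
    by (auto simp: mem_interior)
  define C :: "real^'n^'n" where "C = (\<chi> i j. if (i, j) \<in> H then 1 else 0)"
  \<comment> \<open>The summand 1 covers \<open>C = 0\<close>, that is, an empty
    \<open>H\<close>.\<close>
  define d where "d = e / (2 * (norm C + 1))"
  have d: "d > 0" using e by (auto simp: d_def intro!: divide_pos_pos add_nonneg_pos)
  have "norm (d *\<^sub>R C) < e"
  proof -
    have "norm (d *\<^sub>R C) = e * (norm C / (2 * (norm C + 1)))"
      using e by (simp add: d_def)
    also have "\<dots> < e * 1"
      using e by (intro mult_strict_left_mono) (auto simp: divide_simps add_nonneg_pos intro: add_nonneg_pos)
    finally show ?thesis by simp
  qed
  then have "A + d *\<^sub>R C \<in> ball A e"
    by (simp add: dist_norm)
  then obtain Y B where good: "good (Y, B)" and YB: "A + d *\<^sub>R C = ?G Y + pattern_part A B"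
    using e(2) by fastforce
  define A' where "A' = ?G Y"
  have sA': "transpose A' = A'"
    by (simp add: A'_def matrix_transpose_mul A matrix_mul_assoc)
  have A'sym: "A' $ j $ i = A' $ i $ j" for i j
    using arg_cong[OF sA', of "\<lambda>M. M $ i $ j"] by (simp add: transpose_def)
  have A'_eq: "A' $ i $ j = A $ i $ j + d * C $ i $ j - pattern_part A B $ i $ j" for i j
  proof -
    have "A' = A + d *\<^sub>R C - pattern_part A B"
      using YB by (simp add: A'_def algebra_simps)
    then show ?thesis by simp
  qed
  have supp: "A' $ i $ j \<noteq> 0" if "A $ i $ j \<noteq> 0" for i j
    using good that H(2)[of i j] by (auto simp: A'_eq good_def pattern_part_def C_def)
  \<comment> \<open>Off the diagonal and the support the correction is skew-symmetric, while
    \<open>A'\<close>, \<open>A\<close> and \<open>C\<close> are symmetric. Comparing the entries at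
    (i, j) and (j, i) shows that the correction is zero there.\<close>
  have nonsupp: "A' $ i $ j = d * C $ i $ j" if "i \<noteq> j" "A $ i $ j = 0" for i j
  proof -
    have "C $ j $ i = C $ i $ j" using H(1) by (auto simp: C_def sym_def)
    then show ?thesis
      using A'_eq[of i j] A'_eq[of j i] A'sym[of i j] that sym[of i j] by (simp add: pattern_part_def)
  qed
  have sapA': "strong_arnold_matrix A'"
    unfolding strong_arnold_matrix_def
  proof (intro allI impI)
    fix X assume X: "transpose X = X" "\<forall>i j. i = j \<or> A' $ i $ j \<noteq> 0 \<longrightarrow> X $ i $ j = 0" "A' ** X = 0"
    have pX: "pattern_part A X = 0"
      using X supp pattern_part_eq_0_iff[OF A] by auto
    show "X = 0"
    proof (rule ccontr)
      assume "X \<noteq> 0"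
      have "A ** X = (A - A') ** X"
        using X(3) by (simp add: mm.diff_left)
      then have "c * norm X \<le> norm ((A - A') ** X)"
        using c(2)[of X] pX by (simp add: norm_Pair)
      also have "\<dots> \<le> norm (A' - A) * norm X * K"
        using K(2)[rule_format, of "A - A'" X] by (simp add: norm_minus_commute)
      also have "\<dots> < c / K * norm X * K"
        using good \<open>X \<noteq> 0\<close> K by (intro mult_strict_right_mono) (auto simp: good_def A'_def)
      also have "\<dots> = c * norm X" using K by simp
      finally show False by simp
    qed
  qed
  show thesis
  proof (rule that[OF sA' sapA' supp])
    show "A' $ i $ j \<noteq> 0 \<longleftrightarrow> (i, j) \<in> H" if "i \<noteq> j" "A $ i $ j = 0" for i j
      using nonsupp[OF that] d by (simp add: C_def)
    show "invertible (mat 1 + Y)"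
      using good by (simp add: good_def invertible_det_nz)
  qed (simp_all add: A'_def)
qed

section \<open>Dimensions and nullities for finitely supported functions\<close>

lemma lookup_scaleR [simp]:
  "Poly_Mapping.lookup (c *\<^sub>R x) k = c * Poly_Mapping.lookup x k" for x :: "'a \<Rightarrow>\<^sub>0 real"
proof -
  have "finite {k. c * Poly_Mapping.lookup x k \<noteq> 0}"
    by (rule finite_subset[OF _ finite_lookup[of x]]) auto
  then show ?thesis
    by (simp add: scaleR_poly_mapping_def)
qed

lemma lookup_sum_single:
  assumes "finite V"
  shows "Poly_Mapping.lookup (\<Sum>i\<in>V. c i *\<^sub>R Poly_Mapping.single i (1::real)) k = (if k \<in> V then c k else 0)"
  using assms by (simp add: lookup_sum lookup_single when_def if_distrib cong: if_cong)

lemma supported_in_span: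
  assumes "finite V" "Poly_Mapping.keys x \<subseteq> V"
  shows "x \<in> span ((\<lambda>i. Poly_Mapping.single i (1::real)) ` V)"
proof -
  have "x = (\<Sum>i\<in>V. Poly_Mapping.lookup x i *\<^sub>R Poly_Mapping.single i 1)"
    using assms by (intro poly_mapping_eqI) (auto simp: lookup_sum_single in_keys_iff)
  also have "\<dots> \<in> span ((\<lambda>i. Poly_Mapping.single i (1::real)) ` V)"
    by (intro span_sum span_scale span_base) auto
  finally show ?thesis .
qed

text \<open>The ambient space may have infinite dimension; the finite set \<open>T\<close> supplies
  the finiteness that makes \<open>dim W\<close> the size of a finite basis.\<close>

lemma independent_card_le_dim_span:
  assumes "finite T" "W \<subseteq> span T" "independent B" "B \<subseteq> W"
  shows "card B \<le> dim W"
proof -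
  obtain C where C: "C \<subseteq> W" "independent C" "W \<subseteq> span C" "card C = dim W"
    using basis_exists by blast
  have "finite C"
    using independent_span_bound[OF assms(1) C(2)] C(1) assms(2) by auto
  then show ?thesis
    using independent_span_bound[OF _ assms(3), of C] assms(4) C(3,4) by auto
qed

lemma dim_le_linear_injective:
  assumes "linear L" "subspace W" "\<And>x. \<lbrakk>x \<in> W; L x = 0\<rbrakk> \<Longrightarrow> x = 0" "L ` W \<subseteq> W'" "finite T" "W' \<subseteq> span T"
  shows "dim W \<le> dim W'"
proof -
  obtain B where B: "B \<subseteq> W" "independent B" "W \<subseteq> span B" "card B = dim W"
    using basis_exists by blast
  have sp: "span B = W"
    using B assms(2) by (simp add: span_minimal subset_antisym)
  have inj: "inj_on L (span B)"
  proof (rule inj_onI)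
    fix x y assume "x \<in> span B" "y \<in> span B" "L x = L y"
    then have "x - y \<in> W" "L (x - y) = 0"
      using assms(1,2) by (auto simp: sp linear_diff subspace_diff)
    then show "x = y" using assms(3)[of "x - y"] by simp
  qed
  then have "independent (L ` B)"
    using linear_independent_injective_image[OF assms(1) B(2)] by blast
  then have "card (L ` B) \<le> dim W'"
    using B(1) assms(4) by (intro independent_card_le_dim_span[OF assms(5,6)]) auto
  moreover have "card (L ` B) = card B"
    using inj by (intro card_image) (meson inj_on_subset span_superset)
  ultimately show ?thesis using B by simp
qed

lemma subspace_kernel_on: "subspace (kernel_on V A)"
proof (rule subspaceI)
  show "0 \<in> kernel_on V A" by (simp add: kernel_on_def)
next
  fix x y assume "x \<in> kernel_on V A" "y \<in> kernel_on V A"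
  then show "x + y \<in> kernel_on V A"
    using keys_add[of x y] by (auto simp: kernel_on_def lookup_add distrib_left sum.distrib)
next
  fix c :: real and x assume x: "x \<in> kernel_on V A"
  have "Poly_Mapping.keys (c *\<^sub>R x) \<subseteq> Poly_Mapping.keys x"
    by (auto simp: in_keys_iff)
  moreover have "(\<Sum>j\<in>V. A i j * (c * Poly_Mapping.lookup x j)) = c * (\<Sum>j\<in>V. A i j * Poly_Mapping.lookup x j)" for i
    by (simp add: sum_distrib_left mult_ac)
  ultimately show "c *\<^sub>R x \<in> kernel_on V A"
    using x by (auto simp: kernel_on_def)
qed

lemma kernel_on_subset_span:
  "finite V \<Longrightarrow> kernel_on V A \<subseteq> span ((\<lambda>i. Poly_Mapping.single i (1::real)) ` V)"
  by (auto simp: kernel_on_def intro: supported_in_span)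

lemma nullity_on_le_linear_injective:
  assumes "linear L" "finite V'" "\<And>x. \<lbrakk>x \<in> kernel_on V A; L x = 0\<rbrakk> \<Longrightarrow> x = 0"
    "L ` kernel_on V A \<subseteq> kernel_on V' A'"
  shows "nullity_on V A \<le> nullity_on V' A'"
  unfolding nullity_on_def
  by (rule dim_le_linear_injective[OF assms(1) subspace_kernel_on assms(3,4) _ kernel_on_subset_span[OF assms(2)]])
    (use assms(2) in auto)

text \<open>Restriction of kernel vectors to the coordinates in \<open>S\<close> is injective, so
  the kernel embeds into the span of \<open>card S\<close> unit vectors. Through this lemma a
  forcing set bounds a nullity.\<close>

lemma nullity_on_le_zero_set:
  assumes "finite S" "S \<subseteq> V"
    and "\<And>x. \<lbrakk>x \<in> kernel_on V A; \<forall>i\<in>S. Poly_Mapping.lookup x i = 0\<rbrakk> \<Longrightarrow> x = 0"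
  shows "nullity_on V A \<le> card S"
proof -
  let ?e = "\<lambda>i. Poly_Mapping.single i (1::real)"
  define L where "L x = (\<Sum>i\<in>S. Poly_Mapping.lookup x i *\<^sub>R ?e i)" for x :: "'a \<Rightarrow>\<^sub>0 real"
  have L: "Poly_Mapping.lookup (L x) k = (if k \<in> S then Poly_Mapping.lookup x k else 0)" for x k
    using assms(1) by (simp add: L_def lookup_sum_single)
  have "dim (kernel_on V A) \<le> dim (span (?e ` S))"
  proof (rule dim_le_linear_injective[of L])
    show "linear L"
      by (intro linearI poly_mapping_eqI) (auto simp: L lookup_add)
    show "x = 0" if "x \<in> kernel_on V A" "L x = 0" for x
    proof -
      have "Poly_Mapping.lookup (L x) i = 0" for i using that by simp
      then show ?thesis using that assms(3)[of x] L[of x] by metis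
    qed
    show "L ` kernel_on V A \<subseteq> span (?e ` S)"
      by (auto simp: L_def intro!: span_sum span_scale intro: span_base)
    show "span (?e ` S) \<subseteq> span (?e ` S)" ..
  qed (use assms in \<open>auto simp: subspace_kernel_on\<close>)
  also have "\<dots> \<le> card (?e ` S)"
    using assms(1) by (intro dim_le_card) auto
  also have "\<dots> \<le> card S"
    using assms(1) by (rule card_image_le)
  finally show ?thesis by (simp add: nullity_on_def)
qed

text \<open>The perturbation of matrices over a finite index type is transferred to an arbitrary
  finite index set \<open>V\<close>: the matrix is copied along an injection \<open>f\<close> into
  \<open>'n\<close>, padded by an identity block, perturbed and cut back. For the nullity, if
  \<open>x\<close> is in the kernel of \<open>A\<close>, then the inverse of the congruence matrix
  sends it to a kernel vector of the new matrix.\<close>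

lemma nullity_on_perturbation:
  fixes A :: "'a \<Rightarrow> 'a \<Rightarrow> real"
  assumes V: "finite V" "card V \<le> CARD('n::finite)"
    and A: "symmetric_on V A" "strong_arnold V A"
    and H: "\<And>i j. (i, j) \<in> H \<Longrightarrow> (j, i) \<in> H"
  obtains A' where "symmetric_on V A'" "strong_arnold V A'" "nullity_on V A \<le> nullity_on V A'"
    "\<And>i j. \<lbrakk>i \<in> V; j \<in> V; i \<noteq> j\<rbrakk> \<Longrightarrow> A' i j \<noteq> 0 \<longleftrightarrow> A i j \<noteq> 0 \<or> (i, j) \<in> H"
proof -
  obtain f :: "'a \<Rightarrow> 'n" where f: "inj_on f V"
    using V card_le_inj[of V "UNIV :: 'n set"] by auto
  define g where "g = inv_into V f"
  define P where "P = f ` V"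
  have gf: "g (f i) = i" if "i \<in> V" for i using f that by (simp add: g_def)
  have fg: "f (g p) = p" "g p \<in> V" if "p \<in> P" for p
    using that by (auto simp: P_def g_def f_inv_into_f inv_into_into)
  have fP: "f i \<in> P" if "i \<in> V" for i using that by (simp add: P_def)
  have f_eq: "f i = f j \<longleftrightarrow> i = j" if "i \<in> V" "j \<in> V" for i j using f that by (auto dest: inj_onD)
  have sum_V: "(\<Sum>p\<in>UNIV. h p) = (\<Sum>i\<in>V. h (f i))" if "\<And>p. p \<notin> P \<Longrightarrow> h p = 0" for h :: "'n \<Rightarrow> real"
  proof -
    have "(\<Sum>p\<in>UNIV. h p) = (\<Sum>p\<in>P. h p)"
      using that by (intro sum.mono_neutral_right) auto
    then show ?thesis using f by (simp add: P_def sum.reindex)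
  qed
  have Asym: "A i j = A j i" if "i \<in> V" "j \<in> V" for i j
    using A(1) that by (simp add: symmetric_on_def)
  \<comment> \<open>An identity block adds no kernel, and since its rows are unit vectors,
    \<open>M ** X = 0\<close> makes the corresponding rows of \<open>X\<close> vanish. So
    \<open>M\<close> inherits the Strong Arnold Property.\<close>
  define M :: "real^'n^'n" where
    "M = (\<chi> p q. if p \<in> P \<and> q \<in> P then A (g p) (g q) else if p = q then 1 else 0)"
  have M: "M $ f i $ f j = A i j" if "i \<in> V" "j \<in> V" for i j
    using that by (simp add: M_def fP gf)
  \<comment> \<open>Pairs that meet the padding are excluded, so that the perturbed matrix stays
    diagonal there and can be cut back to \<open>V\<close>. Pairs where \<open>M\<close> is already
    nonzero are excluded because only zero entries can be prescribed.\<close>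
  define HH where "HH = {(p, q). p \<in> P \<and> q \<in> P \<and> p \<noteq> q \<and> (g p, g q) \<in> H \<and> M $ p $ q = 0}"
  have trM: "transpose M = M"
    using Asym fg by (auto simp: M_def transpose_def vec_eq_iff)
  then have Msym: "M $ p $ q = M $ q $ p" for p q
    by (metis transpose_def vec_lambda_beta)
  have sapM: "strong_arnold_matrix M"
    unfolding strong_arnold_matrix_def
  proof (intro allI impI)
    fix X assume X: "transpose X = X" "\<forall>i j. i = j \<or> M $ i $ j \<noteq> 0 \<longrightarrow> X $ i $ j = 0" "M ** X = 0"
    have MX: "(\<Sum>r\<in>UNIV. M $ p $ r * X $ r $ q) = 0" for p q
      using arg_cong[OF X(3), of "\<lambda>N. N $ p $ q"] by (simp add: matrix_matrix_mult_def)
    have Xsym: "X $ p $ q = X $ q $ p" for p q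
      using X(1) by (metis transpose_def vec_lambda_beta)
    have out: "X $ p $ q = 0" if "p \<notin> P" for p q
    proof -
      have "(\<Sum>r\<in>UNIV. M $ p $ r * X $ r $ q) = (\<Sum>r\<in>UNIV. if r = p then X $ r $ q else 0)"
        using that by (intro sum.cong) (auto simp: M_def)
      then show ?thesis using MX[of p q] by simp
    qed
    have "\<forall>i\<in>V. \<forall>j\<in>V. X $ f i $ f j = 0"
    proof (rule A(2)[unfolded strong_arnold_def, rule_format, of "\<lambda>i j. X $ f i $ f j", THEN ballI, THEN ballI])
      show "symmetric_on V (\<lambda>i j. X $ f i $ f j)"
        using Xsym by (simp add: symmetric_on_def)
      show "A i j * X $ f i $ f j = 0" if "i \<in> V" "j \<in> V" for i j
        using X(2)[rule_format, of "f i" "f j"] M[OF that] by auto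
      show "X $ f i $ f i = 0" if "i \<in> V" for i using X(2) by simp
      show "(\<Sum>k\<in>V. A i k * X $ f k $ f j) = 0" if "i \<in> V" "j \<in> V" for i j
      proof -
        have "(\<Sum>k\<in>V. A i k * X $ f k $ f j) = (\<Sum>k\<in>V. M $ f i $ f k * X $ f k $ f j)"
          using that M by (intro sum.cong) auto
        also have "\<dots> = (\<Sum>r\<in>UNIV. M $ f i $ r * X $ r $ f j)"
          using out by (subst sum_V) auto
        finally show ?thesis using MX by simp
      qed
    qed
    then have "X $ p $ q = 0" if "p \<in> P" "q \<in> P" for p q
      using that by (auto simp: P_def)
    then show "X = 0"
      unfolding vec_eq_iff using out Xsym by (metis zero_index)
  qed
  have HH: "sym HH" "\<And>p q. (p, q) \<in> HH \<Longrightarrow> M $ p $ q = 0"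
    using H Msym by (auto simp: HH_def intro!: symI)
  obtain M' Q where trM': "transpose M' = M'" and sapM': "strong_arnold_matrix M'"
    and M'1: "\<And>i j. M $ i $ j \<noteq> 0 \<Longrightarrow> M' $ i $ j \<noteq> 0"
    and M'2: "\<And>i j. \<lbrakk>i \<noteq> j; M $ i $ j = 0\<rbrakk> \<Longrightarrow> M' $ i $ j \<noteq> 0 \<longleftrightarrow> (i, j) \<in> HH"
    and Q: "invertible Q" "M' = transpose Q ** M ** Q"
    by (rule strong_arnold_perturbation[OF trM sapM HH]) auto
  have M'sym: "M' $ p $ q = M' $ q $ p" for p q
    using trM' by (metis transpose_def vec_lambda_beta)
  have M'0: "M' $ p $ q = 0" if "p \<noteq> q" "p \<notin> P \<or> q \<notin> P" for p q
    using that M'2[of p q] by (auto simp: M_def HH_def)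
  have M'diag: "M' $ p $ p \<noteq> 0" if "p \<notin> P" for p
    using that by (intro M'1) (simp add: M_def)
  have M'out: "(\<Sum>r\<in>UNIV. M' $ p $ r * h r) = M' $ p $ p * h p" if "p \<notin> P" for p and h :: "'n \<Rightarrow> real"
  proof -
    have "(\<Sum>r\<in>UNIV. M' $ p $ r * h r) = (\<Sum>r\<in>UNIV. if r = p then M' $ p $ r * h r else 0)"
      using that M'0 by (intro sum.cong) auto
    then show ?thesis by simp
  qed
  define A' where "A' i j = M' $ f i $ f j" for i j
  have 1: "symmetric_on V A'"
    using M'sym by (simp add: symmetric_on_def A'_def)
  have 2: "strong_arnold V A'"
    unfolding strong_arnold_def
  proof (intro allI impI)
    fix X assume X: "symmetric_on V X" "\<forall>i\<in>V. \<forall>j\<in>V. A' i j * X i j = 0" "\<forall>i\<in>V. X i i = 0"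
      "\<forall>i\<in>V. \<forall>j\<in>V. (\<Sum>k\<in>V. A' i k * X k j) = 0"
    define Y :: "real^'n^'n" where "Y = (\<chi> p q. if p \<in> P \<and> q \<in> P then X (g p) (g q) else 0)"
    have Y: "Y $ f i $ f j = X i j" if "i \<in> V" "j \<in> V" for i j
      using that by (simp add: Y_def fP gf)
    have "Y = 0"
    proof (rule sapM'[unfolded strong_arnold_matrix_def, rule_format])
      show "transpose Y = Y"
        using X(1) fg by (auto simp: Y_def transpose_def vec_eq_iff symmetric_on_def)
      show "Y $ p $ q = 0" if "p = q \<or> M' $ p $ q \<noteq> 0" for p q
        using X(2)[rule_format, of "g p" "g q"] X(3) fg that by (auto simp: Y_def A'_def)
      have "(\<Sum>r\<in>UNIV. M' $ p $ r * Y $ r $ q) = 0" for p q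
      proof (cases "p \<in> P \<and> q \<in> P")
        case True
        then obtain i j where ij: "i \<in> V" "j \<in> V" "p = f i" "q = f j" by (auto simp: P_def)
        have "(\<Sum>r\<in>UNIV. M' $ p $ r * Y $ r $ q) = (\<Sum>k\<in>V. M' $ p $ f k * Y $ f k $ q)"
          by (rule sum_V) (simp add: Y_def)
        also have "\<dots> = (\<Sum>k\<in>V. A' i k * X k j)"
          using ij Y by (intro sum.cong) (auto simp: A'_def)
        finally show ?thesis using X(4) ij by simp
      next
        case False
        then show ?thesis
          using M'out[of p "\<lambda>r. Y $ r $ q"] by (cases "p \<in> P") (auto simp: Y_def)
      qed
      then show "M' ** Y = 0" by (simp add: vec_eq_iff matrix_matrix_mult_def)
    qed
    then show "\<forall>i\<in>V. \<forall>j\<in>V. X i j = 0"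
      using Y by (metis zero_index)
  qed
  have 4: "A' i j \<noteq> 0 \<longleftrightarrow> A i j \<noteq> 0 \<or> (i, j) \<in> H" if "i \<in> V" "j \<in> V" "i \<noteq> j" for i j
    using M'1[of "f i" "f j"] M'2[of "f i" "f j"] that M[of i j]
    by (auto simp: A'_def f_eq HH_def fP gf)
  \<comment> \<open>With \<open>Q ** R = mat 1\<close>, applying
    \<open>M' = transpose Q ** M ** Q\<close> to \<open>R *v hat x\<close> gives
    \<open>transpose Q *v (M *v hat x)\<close>, which is 0 for \<open>x\<close> in the
    kernel.\<close>
  obtain R where R: "Q ** R = mat 1" using Q(1) by (auto simp: invertible_def)
  define hat :: "('a \<Rightarrow>\<^sub>0 real) \<Rightarrow> real^'n" where
    "hat x = (\<chi> p. if p \<in> P then Poly_Mapping.lookup x (g p) else 0)" for x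
  define L where "L x = (\<Sum>i\<in>V. (R *v hat x) $ f i *\<^sub>R Poly_Mapping.single i (1::real))" for x
  have L: "Poly_Mapping.lookup (L x) k = (if k \<in> V then (R *v hat x) $ f k else 0)" for x k
    using V(1) by (simp add: L_def lookup_sum_single)
  have hat_add: "hat (x + y) = hat x + hat y" and hat_scaleR: "hat (c *\<^sub>R x) = c *\<^sub>R hat x" for x y c
    by (auto simp: hat_def vec_eq_iff lookup_add)
  have Mhat: "M *v hat x = 0" if x: "x \<in> kernel_on V A" for x
  proof -
    have "(\<Sum>r\<in>UNIV. M $ p $ r * hat x $ r) = 0" for p
    proof (cases "p \<in> P")
      case True
      then obtain i where i: "i \<in> V" "p = f i" by (auto simp: P_def)
      have "(\<Sum>r\<in>UNIV. M $ p $ r * hat x $ r) = (\<Sum>k\<in>V. M $ p $ f k * hat x $ f k)"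
        by (rule sum_V) (simp add: hat_def)
      also have "\<dots> = (\<Sum>k\<in>V. A i k * Poly_Mapping.lookup x k)"
        using i M by (intro sum.cong) (auto simp: hat_def fP gf)
      finally show ?thesis using x i by (simp add: kernel_on_def)
    next
      case False
      then show ?thesis by (intro sum.neutral) (auto simp: M_def hat_def)
    qed
    then show ?thesis by (simp add: vec_eq_iff matrix_vector_mult_def)
  qed
  have M'R: "M' *v (R *v hat x) = 0" if "x \<in> kernel_on V A" for x
  proof -
    have "M' *v (R *v hat x) = transpose Q *v (M *v ((Q ** R) *v hat x))"
      by (simp add: Q(2) matrix_vector_mul_assoc matrix_mul_assoc)
    then show ?thesis using Mhat[OF that] R by simp
  qed
  \<comment> \<open>On the padding \<open>M'\<close> is diagonal with nonzero entries, so its kernel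
    vectors vanish there. Thus \<open>L\<close>, which keeps only the coordinates in
    \<open>V\<close>, loses nothing.\<close>
  have Rout: "(R *v hat x) $ p = 0" if "x \<in> kernel_on V A" "p \<notin> P" for x p
  proof -
    have "(\<Sum>r\<in>UNIV. M' $ p $ r * (R *v hat x) $ r) = 0"
      using arg_cong[OF M'R[OF that(1)], of "\<lambda>v. v $ p"] by (simp add: matrix_vector_mult_def[of M'])
    then show ?thesis using M'out[OF that(2)] M'diag[OF that(2)] by simp
  qed
  have 3: "nullity_on V A \<le> nullity_on V A'"
  proof (rule nullity_on_le_linear_injective[of L])
    show "linear L"
      by (intro linearI poly_mapping_eqI)
        (auto simp: L lookup_add hat_add hat_scaleR matrix_vector_right_distrib matrix_vector_mult_scaleR)
    show "finite V" by fact
    show "x = 0" if x: "x \<in> kernel_on V A" and "L x = 0" for x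
    proof -
      have "(R *v hat x) $ p = 0" for p
      proof (cases "p \<in> P")
        case True
        then obtain i where "i \<in> V" "p = f i" by (auto simp: P_def)
        then show ?thesis using L[of x i] \<open>L x = 0\<close> by simp
      qed (use Rout x in auto)
      then have "R *v hat x = 0" by (simp add: vec_eq_iff)
      then have "(Q ** R) *v hat x = 0" by (simp add: matrix_vector_mul_assoc[symmetric])
      then have h0: "hat x = 0" using R by simp
      have "Poly_Mapping.lookup x i = 0" if "i \<in> V" for i
        using arg_cong[OF h0, of "\<lambda>v. v $ f i"] that by (simp add: hat_def fP gf)
      moreover have "Poly_Mapping.lookup x i = 0" if "i \<notin> V" for i
        using x that by (auto simp: kernel_on_def in_keys_iff)
      ultimately show ?thesis by (intro poly_mapping_eqI) (metis lookup_zero)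
    qed
    show "L ` kernel_on V A \<subseteq> kernel_on V A'"
    proof (rule image_subsetI)
      fix x assume x: "x \<in> kernel_on V A"
      have "(\<Sum>j\<in>V. A' i j * Poly_Mapping.lookup (L x) j) = 0" if "i \<in> V" for i
      proof -
        have "(\<Sum>j\<in>V. A' i j * Poly_Mapping.lookup (L x) j) = (\<Sum>j\<in>V. M' $ f i $ f j * (R *v hat x) $ f j)"
          by (intro sum.cong) (auto simp: L A'_def)
        also have "\<dots> = (\<Sum>r\<in>UNIV. M' $ f i $ r * (R *v hat x) $ r)"
          using Rout[OF x] by (subst sum_V) auto
        also have "\<dots> = 0"
          using arg_cong[OF M'R[OF x], of "\<lambda>v. v $ f i"] by (simp add: matrix_vector_mult_def[of M'])
        finally show ?thesis .
      qed
      moreover have "Poly_Mapping.keys (L x) \<subseteq> V"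
        by (auto simp: in_keys_iff L split: if_splits)
      ultimately show "L x \<in> kernel_on V A'" by (simp add: kernel_on_def)
    qed
  qed
  show thesis using that[OF 1 2 3 4] .
qed

section \<open>Forcing runs\<close>

lemma nullity_on_le_xi:
  "\<lbrakk>pair_graph G; A \<in> graph_matrices G; strong_arnold (pverts G) A\<rbrakk> \<Longrightarrow> nullity_on (pverts G) A \<le> xi G"
  unfolding xi_def by (rule Max_ge[OF finite_xi_nullities]) (auto simp: xi_nullities_def)

lemma xi_leI:
  assumes "pair_graph G"
    and "\<And>A. \<lbrakk>A \<in> graph_matrices G; strong_arnold (pverts G) A\<rbrakk> \<Longrightarrow> nullity_on (pverts G) A \<le> m"
  shows "xi G \<le> m"
  unfolding xi_def
proof (rule Max.boundedI)
  show "finite (xi_nullities G)" "xi_nullities G \<noteq> {}"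
    using assms(1) by (rule finite_xi_nullities, rule xi_nullities_nonempty)
qed (use assms(2) in \<open>auto simp: xi_nullities_def\<close>)

lemma floor_Z_le_card: "\<lbrakk>pair_graph G; floor_forcing_set G S\<rbrakk> \<Longrightarrow> floor_Z G \<le> card S"
  unfolding floor_Z_def by (rule Min_le[OF finite_floor_forcing_cards]) auto

lemma floor_Z_attained:
  assumes "pair_graph G"
  obtains S where "floor_forcing_set G S" "card S = floor_Z G"
  using Min_in[OF finite_floor_forcing_cards[OF assms] floor_forcing_cards_nonempty] that
  unfolding floor_Z_def by auto

text \<open>
  Joining every forcing vertex \<open>i\<close> to the vertex \<open>j\<close> that it forces turns the forces of a run into
  ordinary zero forces: when \<open>i\<close> forces, \<open>j\<close> is its only white neighbour in the enlarged graph.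
  Below \<open>F\<close> consists of the pairs joined so far and \<open>F'\<close> of those that are joined by later forces.
\<close>

definition kernel_forced ::
  "'a pair_pre_digraph \<Rightarrow> 'a set \<Rightarrow> 'a set \<Rightarrow> 'a set \<Rightarrow> ('a \<times> 'a) set \<Rightarrow> bool" where
  "kernel_forced G S B U F \<longleftrightarrow> (\<forall>A F' x.
     (\<forall>i\<in>pverts G. \<forall>j\<in>pverts G. i \<noteq> j \<longrightarrow>
        (A i j \<noteq> 0 \<longleftrightarrow> (i, j) \<in> parcs G \<or> (i, j) \<in> F \<union> F\<inverse> \<union> F' \<union> F'\<inverse>)) \<longrightarrow>
     F' \<subseteq> (- U) \<times> (- B) \<longrightarrow>
     (\<forall>i\<in>pverts G. (\<Sum>j\<in>pverts G. A i j * x j) = (0::real)) \<longrightarrow>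
     (\<forall>i\<in>S. x i = 0) \<longrightarrow> (\<forall>i\<in>B. x i = 0))"

text \<open>The invariant that used vertices have no white neighbours carries the induction. It
  shows that each vertex forces at most once, even by the first rule, and it is preserved because
  after a force by \<open>i\<close> its only possible white neighbour has turned blue.\<close>

lemma floor_force_kernel_forced:
  assumes "(floor_force G)\<^sup>*\<^sup>* (S, {}) (B, U)" "finite (pverts G)" "S \<subseteq> pverts G"
  shows "U \<subseteq> B \<and> B \<subseteq> pverts G \<and> (\<forall>u\<in>U. white_neighbors G B u = {}) \<and>
    (\<exists>F \<subseteq> U \<times> B. kernel_forced G S B U F)"
  using assms(1)
proof (induction rule: rtranclp_induct2)
  case refl
  then show ?case using assms(3) by (auto simp: kernel_forced_def)
next
  case (step B U B' U')
  obtain i j where ij: "i \<in> B" "j \<in> pverts G" "j \<notin> B" "B' = insert j B" "U' = insert i U"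
    "white_neighbors G B i \<subseteq> {j}" "i \<notin> U"
    using step.hyps(2)
  proof cases
    case (only_white_neighbor i j)
    then have "i \<notin> U" using step.IH by auto
    then show thesis using only_white_neighbor that[of i j] by (auto simp: white_neighbors_def)
  next
    case (hop i j)
    then show thesis using that[of i j] by auto
  qed
  let ?V = "pverts G"
  have UB: "U \<subseteq> B" "B \<subseteq> ?V" and wU: "\<forall>u\<in>U. white_neighbors G B u = {}" using step.IH by auto
  obtain F where F: "F \<subseteq> U \<times> B" "kernel_forced G S B U F"
    using step.IH by blast
  have 1: "U' \<subseteq> B'" "B' \<subseteq> ?V" "\<forall>u\<in>U'. white_neighbors G B' u = {}"
    using UB wU ij by (auto simp: white_neighbors_def)
  let ?F = "insert (i, j) F"
  have "kernel_forced G S B' U' ?F"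
    unfolding kernel_forced_def
  proof (intro allI impI)
    fix A F' and x :: "'a \<Rightarrow> real"
    assume A: "\<forall>i\<in>?V. \<forall>j\<in>?V. i \<noteq> j \<longrightarrow>
          (A i j \<noteq> 0 \<longleftrightarrow> (i, j) \<in> parcs G \<or> (i, j) \<in> ?F \<union> ?F\<inverse> \<union> F' \<union> F'\<inverse>)"
      and F': "F' \<subseteq> (- U') \<times> (- B')" and x: "\<forall>i\<in>?V. (\<Sum>j\<in>?V. A i j * x j) = 0" "\<forall>i\<in>S. x i = 0"
    \<comment> \<open>The current force leaves the pairs still to be joined and enters those already
      joined. The enlarged graph is unchanged, so the induction hypothesis applies with
      \<open>insert (i, j) F'\<close>.\<close>
    have "?F \<union> ?F\<inverse> \<union> F' \<union> F'\<inverse> = F \<union> F\<inverse> \<union> insert (i, j) F' \<union> (insert (i, j) F')\<inverse>"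
      by auto
    note A' = A[unfolded this]
    have "insert (i, j) F' \<subseteq> (- U) \<times> (- B)"
      using F' ij by auto
    then have xB: "\<forall>k\<in>B. x k = 0"
      using F(2)[unfolded kernel_forced_def, THEN spec, THEN spec, THEN spec, THEN mp, OF A'] x by blast
    have "A i k * x k = (if k = j then A i j * x j else 0)" if "k \<in> ?V" for k
    proof (cases "k \<in> B \<or> k = j")
      case True
      then show ?thesis using xB ij by auto
    next
      case False
      \<comment> \<open>The pairs in \<open>F\<close> lie inside the blue set, and those in
        \<open>F'\<close> have neither \<open>i\<close>, now used, as first entry nor a vertex of
        \<open>B'\<close> as second entry. So no added pair joins \<open>i\<close> to a white vertex
        other than \<open>j\<close>.\<close>
      then have "(i, k) \<notin> parcs G" "(i, k) \<notin> ?F \<union> ?F\<inverse> \<union> F' \<union> F'\<inverse>"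
        using ij that F(1) F' UB by (auto simp: white_neighbors_def)
      moreover have "i \<in> ?V" "i \<noteq> k" using ij UB False by auto
      ultimately have "A i k = 0" using A that by blast
      then show ?thesis using False by simp
    qed
    then have "(\<Sum>k\<in>?V. A i k * x k) = (\<Sum>k\<in>?V. if k = j then A i j * x j else 0)"
      by (rule sum.cong[OF refl])
    also have "\<dots> = A i j * x j" using ij(2) assms(2) by simp
    finally have "A i j * x j = 0" using x(1) ij(1) UB by auto
    moreover have "i \<in> ?V" "i \<noteq> j" using ij UB by auto
    then have "A i j \<noteq> 0" using A ij(2) by blast
    ultimately show "\<forall>k\<in>B'. x k = 0" using ij(4) xB by auto
  qed
  moreover have "?F \<subseteq> U' \<times> B'" using F(1) ij by auto
  ultimately show ?case using 1 by blast
qed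

text \<open>All forces of a run are joined in a single perturbation, after which
  \<open>kernel_forced\<close> is read with no pairs left to come. The type \<open>'n\<close> only
  provides room for the matrices.\<close>

lemma xi_le_card_floor_forcing_set:
  assumes G: "pair_graph G" and n: "card (pverts G) \<le> CARD('n::finite)" and S: "floor_forcing_set G S"
  shows "xi G \<le> card S"
proof (rule xi_leI[OF G])
  interpret pair_graph G by fact
  let ?V = "pverts G"
  fix A assume A: "A \<in> graph_matrices G" and sap: "strong_arnold ?V A"
  obtain U where S': "S \<subseteq> ?V" and U: "(floor_force G)\<^sup>*\<^sup>* (S, {}) (?V, U)"
    using S by (auto simp: floor_forcing_set_def)
  obtain F where F: "kernel_forced G S ?V U F"
    using floor_force_kernel_forced[OF U pair_finite_verts S'] by blast
  have symA: "symmetric_on ?V A" using A by (simp add: graph_matrices_def)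
  obtain A' where A': "nullity_on ?V A \<le> nullity_on ?V A'"
    "\<And>i j. \<lbrakk>i \<in> ?V; j \<in> ?V; i \<noteq> j\<rbrakk> \<Longrightarrow> A' i j \<noteq> 0 \<longleftrightarrow> A i j \<noteq> 0 \<or> (i, j) \<in> F \<union> F\<inverse>"
    by (rule nullity_on_perturbation[OF pair_finite_verts n symA sap, of "F \<union> F\<inverse>"]) auto
  have "nullity_on ?V A' \<le> card S"
  proof (rule nullity_on_le_zero_set[OF finite_subset[OF S' pair_finite_verts] S'])
    fix x assume x: "x \<in> kernel_on ?V A'" "\<forall>i\<in>S. Poly_Mapping.lookup x i = 0"
    have "\<forall>i\<in>?V. Poly_Mapping.lookup x i = 0"
      by (rule F[unfolded kernel_forced_def, rule_format, of A' "{}" "Poly_Mapping.lookup x", THEN ballI])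
        (use A A' x in \<open>auto simp: graph_matrices_def kernel_on_def\<close>)
    moreover have "\<forall>i. i \<notin> ?V \<longrightarrow> Poly_Mapping.lookup x i = 0"
      using x(1) by (auto simp: kernel_on_def in_keys_iff)
    ultimately show "x = 0" by (intro poly_mapping_eqI) auto
  qed
  then show "nullity_on ?V A \<le> card S" using A'(1) by simp
qed

text \<open>
  A stair lists forces \<open>(i, j)\<close> in chronological order. They can be carried out, by either rule, as
  soon as no forcing vertex is adjacent to a vertex that is forced later; these pairs are the gaps.
\<close>

fun stair :: "('a \<times> 'a) list \<Rightarrow> bool" where
  "stair [] \<longleftrightarrow> True"
| "stair ((i, j) # r) \<longleftrightarrow>
     i \<noteq> j \<and> i \<notin> set (map fst r) \<and> i \<notin> set (map snd r) \<and> j \<notin> set (map snd r) \<and> stair r"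

fun stair_gaps :: "('a \<times> 'a) list \<Rightarrow> ('a \<times> 'a) list" where
  "stair_gaps [] = []"
| "stair_gaps ((i, j) # r) = map (\<lambda>p. (i, snd p)) r @ stair_gaps r"

text \<open>When \<open>(i, j)\<close> is due, the white vertices are \<open>j\<close> and the later
  targets, and the gaps exclude edges from \<open>i\<close> to the latter. If \<open>j\<close> is a
  neighbour of \<open>i\<close>, the first rule applies; otherwise \<open>i\<close> has no white
  neighbour and hops, which is allowed since \<open>i\<close> is not in \<open>U\<close>.\<close>

lemma stair_floor_force:
  assumes "stair r" "set (map fst r) \<union> set (map snd r) \<subseteq> pverts G"
    "set (stair_gaps r) \<inter> parcs G = {}" "U \<inter> set (map fst r) = {}"
  shows "\<exists>U'. (floor_force G)\<^sup>*\<^sup>* (pverts G - set (map snd r), U) (pverts G, U')"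
  using assms
proof (induction r arbitrary: U)
  case (Cons p r)
  obtain i j where p: "p = (i, j)" by fastforce
  let ?B = "pverts G - set (map snd (p # r))"
  have sub: "white_neighbors G ?B i \<subseteq> {j}"
    using Cons.prems by (auto simp: white_neighbors_def p)
  have "floor_force G (?B, U) (insert j ?B, insert i U)"
  proof (cases "white_neighbors G ?B i = {}")
    case True
    then show ?thesis using Cons.prems by (intro hop) (auto simp: p)
  next
    case False
    then show ?thesis using sub Cons.prems by (intro only_white_neighbor) (auto simp: p)
  qed
  moreover have "insert j ?B = pverts G - set (map snd r)"
    using Cons.prems by (auto simp: p)
  moreover obtain U' where "(floor_force G)\<^sup>*\<^sup>* (pverts G - set (map snd r), insert i U) (pverts G, U')"
    using Cons.IH[of "insert i U"] Cons.prems by (auto simp: p)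
  ultimately show ?case by (metis converse_rtranclp_into_rtranclp)
qed auto

lemma distinct_stair: "stair r \<Longrightarrow> distinct (map snd r)"
  by (induction r rule: stair.induct) auto

lemma floor_Z_le_stair:
  assumes G: "pair_graph G" and r: "stair r" "set (map fst r) \<union> set (map snd r) \<subseteq> pverts G"
    "set (stair_gaps r) \<inter> parcs G = {}"
  shows "floor_Z G \<le> card (pverts G) - length r"
proof -
  have "floor_forcing_set G (pverts G - set (map snd r))"
    using stair_floor_force[OF r, of "{}"] by (auto simp: floor_forcing_set_def)
  then have "floor_Z G \<le> card (pverts G - set (map snd r))"
    by (rule floor_Z_le_card[OF G])
  also have "\<dots> = card (pverts G) - card (set (map snd r))"
    using r(2) by (intro card_Diff_subset) auto
  also have "card (set (map snd r)) = length r"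
    using distinct_card[OF distinct_stair[OF r(1)]] by simp
  finally show ?thesis .
qed

text \<open>Certificates contain stairs on numbers; this carries them to the vertices of a graph
  along a labelling.\<close>

lemma stair_map:
  assumes "inj_on f (set (map fst r) \<union> set (map snd r))" "stair r"
  shows "stair (map (map_prod f f) r)"
  using assms
proof (induction r rule: stair.induct)
  case (2 i j r)
  have inj: "inj_on f (insert i (insert j (set (map fst r) \<union> set (map snd r))))"
    using "2.prems"(1) by (rule inj_on_subset) auto
  then have "stair (map (map_prod f f) r)"
    using "2.prems"(2) by (intro "2.IH") (auto elim: inj_on_subset)
  moreover have "f i \<notin> f ` S" "f j \<notin> f ` S'"
    if "i \<notin> S" "j \<notin> S'" "S \<subseteq> insert j (set (map fst r) \<union> set (map snd r))"
      "S' \<subseteq> set (map snd r)" for S S'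
    using that inj_on_image_mem_iff[OF inj, of i S] inj_on_image_mem_iff[OF inj, of j S'] by blast+
  from this[of "insert j (set (map fst r) \<union> set (map snd r))" "set (map snd r)"]
  have "f i \<noteq> f j" "f i \<notin> f ` set (map fst r)" "f i \<notin> f ` set (map snd r)" "f j \<notin> f ` set (map snd r)"
    using "2.prems"(2) by auto
  ultimately show ?case
    by (simp add: image_image)
qed simp

lemma stair_gaps_map: "stair_gaps (map (map_prod f f) r) = map (map_prod f f) (stair_gaps r)"
  by (induction r rule: stair_gaps.induct) auto

section \<open>Lower bounds from Gram matrices\<close>

text \<open>If \<phi> is nonzero at some \<open>t\<close> in \<open>W\<close>, then \<open>t\<close>
  completes a basis of its kernel in \<open>W\<close> to a spanning set of \<open>W\<close>;
  otherwise that basis already spans \<open>W\<close>.\<close>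

lemma dim_le_Suc_dim_kernel:
  fixes \<phi> :: "'b::real_vector \<Rightarrow> real"
  assumes "linear \<phi>" "subspace W" "finite T" "W \<subseteq> span T"
  shows "dim W \<le> Suc (dim {x \<in> W. \<phi> x = 0})"
proof -
  let ?K = "{x \<in> W. \<phi> x = 0}"
  obtain C where C: "C \<subseteq> ?K" "independent C" "?K \<subseteq> span C" "card C = dim ?K"
    using basis_exists by blast
  have finC: "finite C"
    using independent_span_bound[OF assms(3) C(2)] C(1) assms(4) by blast
  obtain t where "W \<subseteq> span (insert t C)"
  proof (cases "\<exists>t\<in>W. \<phi> t \<noteq> 0")
    case True
    then obtain t where t: "t \<in> W" "\<phi> t \<noteq> 0" by blast
    have "x \<in> span (insert t C)" if "x \<in> W" for x
    proof -
      have "x - (\<phi> x / \<phi> t) *\<^sub>R t \<in> ?K"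
        using that t assms(1,2) by (auto simp: linear_diff linear_cmul subspace_diff subspace_scale)
      then have "x - (\<phi> x / \<phi> t) *\<^sub>R t \<in> span C" using C(3) by blast
      then show ?thesis using span_breakdown_eq by blast
    qed
    then show thesis using that by blast
  next
    case False
    then have "W \<subseteq> span C" using C(3) by blast
    then show thesis using that[of 0] span_mono[of C "insert 0 C"] by blast
  qed
  then have "dim W \<le> card (insert t C)" using finC by (intro dim_le_card) auto
  also have "\<dots> \<le> Suc (card C)" by (simp add: card_insert_if finC)
  finally show ?thesis by (simp add: C(4))
qed

lemma dim_le_dim_common_kernel:
  fixes \<phi> :: "'i \<Rightarrow> 'b::real_vector \<Rightarrow> real"
  assumes "finite I" "\<And>s. s \<in> I \<Longrightarrow> linear (\<phi> s)" "subspace W" "finite T" "W \<subseteq> span T"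
  shows "dim W \<le> dim {x \<in> W. \<forall>s\<in>I. \<phi> s x = 0} + card I"
  using assms(1,2)
proof (induction I)
  case (insert s I)
  let ?W = "{x \<in> W. \<forall>s\<in>I. \<phi> s x = 0}"
  have lin: "linear (\<phi> t)" if "t \<in> insert s I" for t using insert.prems that by blast
  have "subspace ?W"
  proof (rule subspaceI)
    show "0 \<in> ?W" using assms(3) lin by (auto simp: subspace_0 linear_0)
    show "x + y \<in> ?W" if "x \<in> ?W" "y \<in> ?W" for x y
      using assms(3) lin that by (auto simp: subspace_add linear_add)
    show "c *\<^sub>R x \<in> ?W" if "x \<in> ?W" for c x
      using assms(3) lin that by (auto simp: subspace_scale linear_cmul)
  qed
  then have "dim ?W \<le> Suc (dim {x \<in> ?W. \<phi> s x = 0})"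
    using lin assms(4,5) by (intro dim_le_Suc_dim_kernel) auto
  moreover have "{x \<in> ?W. \<phi> s x = 0} = {x \<in> W. \<forall>t\<in>insert s I. \<phi> t x = 0}" by auto
  ultimately show ?case using insert by simp
qed simp

lemma card_le_dim_supported:
  assumes "finite P"
  shows "card P \<le> dim {x :: 'a \<Rightarrow>\<^sub>0 real. Poly_Mapping.keys x \<subseteq> P}"
proof -
  let ?e = "\<lambda>i. Poly_Mapping.single i (1::real)"
  have inj: "inj_on ?e P"
    by (rule inj_onI) (metis keys_single singleton_insert_inj_eq' zero_neq_one)
  have "independent (?e ` P)"
  proof (rule independent_if_scalars_zero)
    show "finite (?e ` P)" using assms by simp
    fix f x assume sum: "(\<Sum>x\<in>?e ` P. f x *\<^sub>R x) = 0" and "x \<in> ?e ` P"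
    then obtain i where i: "i \<in> P" "x = ?e i" by auto
    have "(\<Sum>i\<in>P. f (?e i) *\<^sub>R ?e i) = 0" using sum by (simp add: sum.reindex[OF inj])
    then show "f x = 0"
      using lookup_sum_single[OF assms, of "\<lambda>i. f (?e i)" i] i by simp
  qed
  then have "card (?e ` P) \<le> dim {x :: 'a \<Rightarrow>\<^sub>0 real. Poly_Mapping.keys x \<subseteq> P}"
    using assms by (intro independent_card_le_dim_span[of "?e ` P"]) (auto intro: supported_in_span)
  then show ?thesis using card_image[OF inj] by simp
qed

text \<open>Vectors supported in \<open>P\<close> form a space of dimension at least
  \<open>card P\<close>, and each of the \<open>r\<close> functionals cuts its dimension by at most
  one. What remains lies in the kernel.\<close>

lemma card_diff_le_nullity_on:
  assumes "finite V" "P \<subseteq> V"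
    and "\<And>i x. \<lbrakk>i \<in> V; \<forall>j. j \<notin> P \<longrightarrow> x j = 0; \<forall>s<r. (\<Sum>j\<in>P. u s j * x j) = 0\<rbrakk> \<Longrightarrow> (\<Sum>j\<in>V. A i j * x j) = 0"
  shows "card P - r \<le> nullity_on V A"
proof -
  let ?W = "{x :: 'a \<Rightarrow>\<^sub>0 real. Poly_Mapping.keys x \<subseteq> P}"
  let ?\<phi> = "\<lambda>s x. \<Sum>j\<in>P. u s j * Poly_Mapping.lookup x j"
  have P: "finite P" using assms finite_subset by blast
  have W: "?W \<subseteq> span ((\<lambda>i. Poly_Mapping.single i 1) ` P)" using P supported_in_span by blast
  have sW: "subspace ?W"
  proof (rule subspaceI)
    show "x + y \<in> ?W" if "x \<in> ?W" "y \<in> ?W" for x y using keys_add[of x y] that by auto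
    show "c *\<^sub>R x \<in> ?W" if "x \<in> ?W" for c x using that by (auto simp: in_keys_iff)
  qed simp
  have lin: "linear (?\<phi> s)" for s
    by (intro linearI) (auto simp: lookup_add algebra_simps sum.distrib sum_distrib_left)
  let ?K = "{x \<in> ?W. \<forall>s\<in>{..<r}. ?\<phi> s x = 0}"
  have "card P \<le> dim ?K + card {..<r}"
    using card_le_dim_supported[OF P] dim_le_dim_common_kernel[of "{..<r}" ?\<phi>, OF _ lin sW _ W] P
    by (meson finite_imageI finite_lessThan le_trans)
  moreover have "?K \<subseteq> kernel_on V A"
  proof
    fix x assume x: "x \<in> ?K"
    then have "\<forall>j. j \<notin> P \<longrightarrow> Poly_Mapping.lookup x j = 0" "\<forall>s<r. ?\<phi> s x = 0"
      by (auto simp: in_keys_iff)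
    then show "x \<in> kernel_on V A"
      using assms(2,3) x by (auto simp: kernel_on_def)
  qed
  then have "dim ?K \<le> nullity_on V A"
    unfolding nullity_on_def using assms(1) sW
    by (intro dim_le_linear_injective[of "\<lambda>x. x" _ _ "(\<lambda>i. Poly_Mapping.single i 1) ` V"] kernel_on_subset_span)
      (auto simp: subspace_def linear_iff lookup_add algebra_simps sum.distrib sum_distrib_left[symmetric] )
  ultimately show ?thesis by simp
qed

text \<open>The form of \<open>a\<close> shows that its kernel contains the common kernel of the
  \<open>r\<close> functionals \<open>u s\<close>. The vertices outside the image of \<sigma>
  receive an identity block, which preserves the Strong Arnold Property.\<close>

lemma xi_ge_gram:
  fixes \<sigma> :: "nat \<Rightarrow> 'a" and a :: "nat \<Rightarrow> nat \<Rightarrow> real"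
  assumes G: "pair_graph G" and n: "card (pverts G) \<le> CARD('n::finite)"
    and \<sigma>: "inj_on \<sigma> {..<q}" "\<sigma> ` {..<q} \<subseteq> pverts G"
    and a: "\<And>i j. a i j = (\<Sum>s<r. d s * u s i * u s j)"
    and edges: "\<And>i j. \<lbrakk>i < q; j < q; i \<noteq> j; a i j \<noteq> 0\<rbrakk> \<Longrightarrow> (\<sigma> i, \<sigma> j) \<in> parcs G"
    and sap: "strong_arnold {..<q} a"
  shows "q - r \<le> xi G"
proof -
  interpret pair_graph G by fact
  let ?V = "pverts G"
  have symG: "(x, y) \<in> parcs G \<Longrightarrow> (y, x) \<in> parcs G" for x y
    using pair_sym_arcs by (auto simp: symmetric_def sym_def)
  define P where "P = \<sigma> ` {..<q}"
  define g where "g = inv_into {..<q} \<sigma>"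
  have g\<sigma>: "g (\<sigma> i) = i" if "i < q" for i using \<sigma> that by (simp add: g_def)
  have PV: "P \<subseteq> ?V" using \<sigma> by (simp add: P_def)
  have cardP: "card P = q" using \<sigma> by (simp add: P_def card_image)
  have sum_P: "(\<Sum>y\<in>P. h y) = (\<Sum>k<q. h (\<sigma> k))" for h :: "'a \<Rightarrow> real"
    using \<sigma> by (simp add: P_def sum.reindex)
  have sum_V: "(\<Sum>y\<in>?V. h y) = (\<Sum>k<q. h (\<sigma> k))" if "\<And>y. y \<notin> P \<Longrightarrow> h y = 0" for h :: "'a \<Rightarrow> real"
  proof -
    have "(\<Sum>y\<in>?V. h y) = (\<Sum>y\<in>P. h y)"
      using that PV by (intro sum.mono_neutral_right) auto
    then show ?thesis by (simp add: sum_P)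
  qed
  define A where "A x y = (if x \<in> P \<and> y \<in> P then a (g x) (g y) else if x = y then 1 else 0)" for x y
  have A\<sigma>: "A (\<sigma> i) (\<sigma> j) = a i j" if "i < q" "j < q" for i j
    using that by (simp add: A_def P_def g\<sigma>)
  have asym: "a i j = a j i" for i j by (simp add: a mult_ac)
  have symA: "symmetric_on ?V A"
    using asym by (auto simp: symmetric_on_def A_def)
  have sapA: "strong_arnold ?V A"
    unfolding strong_arnold_def
  proof (intro allI impI)
    fix X assume X: "symmetric_on ?V X" "\<forall>i\<in>?V. \<forall>j\<in>?V. A i j * X i j = 0" "\<forall>i\<in>?V. X i i = 0"
      "\<forall>i\<in>?V. \<forall>j\<in>?V. (\<Sum>k\<in>?V. A i k * X k j) = 0"
    have out: "X i j = 0" if "i \<in> ?V" "j \<in> ?V" "i \<notin> P" for i j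
    proof -
      have "(\<Sum>k\<in>?V. A i k * X k j) = (\<Sum>k\<in>?V. if k = i then X k j else 0)"
        using that by (intro sum.cong) (auto simp: A_def)
      then show ?thesis using X(4) that pair_finite_verts by simp
    qed
    have "\<forall>i\<in>{..<q}. \<forall>j\<in>{..<q}. X (\<sigma> i) (\<sigma> j) = 0"
    proof (rule sap[unfolded strong_arnold_def, rule_format, of "\<lambda>i j. X (\<sigma> i) (\<sigma> j)", THEN ballI, THEN ballI])
      show "symmetric_on {..<q} (\<lambda>i j. X (\<sigma> i) (\<sigma> j))"
        using X(1) \<sigma> by (auto simp: symmetric_on_def)
      show "a i j * X (\<sigma> i) (\<sigma> j) = 0" if "i \<in> {..<q}" "j \<in> {..<q}" for i j
        using X(2)[rule_format, of "\<sigma> i" "\<sigma> j"] A\<sigma> \<sigma> that by auto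
      show "X (\<sigma> i) (\<sigma> i) = 0" if "i \<in> {..<q}" for i using X(3) \<sigma> that by auto
      show "(\<Sum>k<q. a i k * X (\<sigma> k) (\<sigma> j)) = 0" if "i \<in> {..<q}" "j \<in> {..<q}" for i j
      proof -
        have "(\<Sum>k<q. a i k * X (\<sigma> k) (\<sigma> j)) = (\<Sum>k<q. A (\<sigma> i) (\<sigma> k) * X (\<sigma> k) (\<sigma> j))"
          using that A\<sigma> by (intro sum.cong) auto
        also have "\<dots> = (\<Sum>y\<in>?V. A (\<sigma> i) y * X y (\<sigma> j))"
        proof (rule sum_V[symmetric])
          fix y assume "y \<notin> P"
          then show "A (\<sigma> i) y * X y (\<sigma> j) = 0" using that by (auto simp: A_def P_def)
        qed
        finally show ?thesis using X(4) \<sigma> that by auto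
      qed
    qed
    then have PP: "X x y = 0" if "x \<in> P" "y \<in> P" for x y using that by (auto simp: P_def)
    show "\<forall>i\<in>?V. \<forall>j\<in>?V. X i j = 0"
      using out PP X(1) unfolding symmetric_on_def by metis
  qed
  have "card P - r \<le> nullity_on ?V A"
  proof (rule card_diff_le_nullity_on[OF pair_finite_verts PV, where u = "\<lambda>s y. u s (g y)"])
    fix x y assume xV: "x \<in> ?V" and y: "\<forall>j. j \<notin> P \<longrightarrow> y j = (0::real)" "\<forall>s<r. (\<Sum>j\<in>P. u s (g j) * y j) = 0"
    have "(\<Sum>j\<in>?V. A x j * y j) = (\<Sum>j\<in>P. A x j * y j)"
      using y(1) PV by (intro sum.mono_neutral_right) auto
    also have "\<dots> = 0"
    proof (cases "x \<in> P")
      case True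
      then have "(\<Sum>j\<in>P. A x j * y j) = (\<Sum>j\<in>P. \<Sum>s<r. d s * u s (g x) * (u s (g j) * y j))"
        by (intro sum.cong) (auto simp: A_def a sum_distrib_left sum_distrib_right mult_ac)
      also have "\<dots> = (\<Sum>s<r. \<Sum>j\<in>P. d s * u s (g x) * (u s (g j) * y j))" by (rule sum.swap)
      also have "\<dots> = (\<Sum>s<r. d s * u s (g x) * (\<Sum>j\<in>P. u s (g j) * y j))"
        by (simp add: sum_distrib_left)
      also have "\<dots> = 0" using y(2) by (intro sum.neutral) auto
      finally show ?thesis .
    next
      case False
      then show ?thesis by (intro sum.neutral) (auto simp: A_def)
    qed
    finally show "(\<Sum>j\<in>?V. A x j * y j) = 0" .
  qed
  \<comment> \<open>Switching on all arcs of \<open>G\<close> enlarges the pattern, which so far is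
    that of a subgraph, to that of \<open>G\<close> itself.\<close>
  moreover obtain A' where A': "symmetric_on ?V A'" "strong_arnold ?V A'" "nullity_on ?V A \<le> nullity_on ?V A'"
    "\<And>i j. \<lbrakk>i \<in> ?V; j \<in> ?V; i \<noteq> j\<rbrakk> \<Longrightarrow> A' i j \<noteq> 0 \<longleftrightarrow> A i j \<noteq> 0 \<or> (i, j) \<in> parcs G"
    by (rule nullity_on_perturbation[OF pair_finite_verts n symA sapA, of "parcs G"]) (auto dest: symG)
  moreover have "A' \<in> graph_matrices G"
  proof -
    have "(x, y) \<in> parcs G" if "A x y \<noteq> 0" "x \<noteq> y" for x y
      using that edges[of "g x" "g y"] by (cases "g x = g y") (auto simp: A_def P_def g\<sigma> split: if_splits)
    then show ?thesis using A' by (auto simp: graph_matrices_def)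
  qed
  ultimately show ?thesis using nullity_on_le_xi[OF G, of A'] cardP by linarith
qed

section \<open>Integer witnesses and an exact test of the Strong Arnold Property\<close>

definition gram :: "int list \<Rightarrow> int list \<Rightarrow> int list \<Rightarrow> int" where
  "gram d u v = sum_list (map2 (*) d (map2 (*) u v))"

definition gram_edges :: "int list \<Rightarrow> int list list \<Rightarrow> (nat \<times> nat) list" where
  "gram_edges d us =
     filter (\<lambda>(i, j). i < j \<and> gram d (us ! i) (us ! j) \<noteq> 0) (List.product [0..<length us] [0..<length us])"

text \<open>Gaussian elimination of the first column without divisions: rows with a nonzero head are
  cross-multiplied with the pivot row \<open>p\<close>, so all entries stay integers. A column
  without a pivot is a free unknown and makes the test fail.\<close>

fun full_column_rank :: "nat \<Rightarrow> int list list \<Rightarrow> bool" where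
  "full_column_rank 0 rs \<longleftrightarrow> True"
| "full_column_rank (Suc n) rs =
     (case filter (\<lambda>r. hd r \<noteq> 0) rs of
        [] \<Rightarrow> False
      | p # ps \<Rightarrow> full_column_rank n (map tl (filter (\<lambda>r. hd r = 0) rs) @
          map (\<lambda>r. map2 (\<lambda>x y. hd p * y - hd r * x) (tl p) (tl r)) ps))"

text \<open>
  The unknowns are the entries \<open>X p q\<close> for the non-edges \<open>p < q\<close>; the rows are the entries of \<open>A X\<close>.
\<close>

definition arnold_rows :: "int list \<Rightarrow> int list list \<Rightarrow> int list list" where
  "arnold_rows d us =
     (let A = map (\<lambda>u. map (gram d u) us) us;
          N = filter (\<lambda>(p, q). p < q \<and> A ! p ! q = 0) (List.product [0..<length us] [0..<length us])
      in [map (\<lambda>(p, q). (if q = j then A ! i ! p else 0) + (if p = j then A ! i ! q else 0)) N.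
          i \<leftarrow> [0..<length us], j \<leftarrow> [0..<length us]])"

text \<open>The surplus of \<open>k\<close> vectors over their length gives nullity at least
  \<open>k\<close>. The rank test runs over as many unknowns as there are non-edges, which is the
  length of any row.\<close>

definition witness_ok :: "nat \<Rightarrow> int list \<times> int list list \<Rightarrow> bool" where
  "witness_ok k w = (case w of (d, us) \<Rightarrow>
     list_all (\<lambda>u. length u = length d) us \<and> length us = k + length d \<and>
     (let rs = arnold_rows d us in full_column_rank (length (hd rs)) rs))"

definition dot :: "int list \<Rightarrow> real list \<Rightarrow> real" where
  "dot r x = (\<Sum>(c, y)\<leftarrow>zip r x. of_int c * y)"

lemma dot_map: "dot (map f xs) (map g xs) = (\<Sum>x\<leftarrow>xs. of_int (f x) * g x)"
  by (induction xs) (auto simp: dot_def)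

lemma dot_eliminate:
  "length r = length p \<Longrightarrow> length x = length p \<Longrightarrow>
   dot (map2 (\<lambda>y z. a * z - b * y) p r) x = of_int a * dot r x - of_int b * dot p x"
proof (induction p arbitrary: r x)
  case (Cons y p)
  then show ?case by (cases r; cases x) (auto simp: dot_def algebra_simps)
qed (simp add: dot_def)

text \<open>A solution of the rows, without its first entry, solves the eliminated rows and so
  vanishes by induction; the pivot equation then kills the first entry.\<close>

lemma full_column_rank_sound:
  assumes "full_column_rank n rs" "length x = n" "\<And>r. r \<in> set rs \<Longrightarrow> length r = n \<and> dot r x = 0"
  shows "\<forall>y\<in>set x. y = 0"
  using assms
proof (induction n rs arbitrary: x rule: full_column_rank.induct)
  case (2 n rs)
  obtain y ys where x: "x = y # ys" "length ys = n"
    using "2.prems"(2) by (cases x) auto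
  have row: "\<exists>c cs. r = c # cs \<and> length cs = n \<and> of_int c * y + dot cs ys = 0" if "r \<in> set rs" for r
    using "2.prems"(3)[OF that] x by (cases r) (auto simp: dot_def)
  obtain p ps where ps: "filter (\<lambda>r. hd r \<noteq> 0) rs = p # ps"
    using "2.prems"(1) by (auto split: list.splits)
  then have mem: "p \<in> set rs" "hd p \<noteq> 0" "\<And>r. r \<in> set ps \<Longrightarrow> r \<in> set rs"
    using ps[symmetric] Cons_eq_filterD[OF ps[symmetric]] by (auto dest!: arg_cong[where f = set])
  have p: "length (tl p) = n" "of_int (hd p) * y + dot (tl p) ys = 0"
    using row[OF mem(1)] by auto
  let ?rs = "map tl (filter (\<lambda>r. hd r = 0) rs) @
          map (\<lambda>r. map2 (\<lambda>x y. hd p * y - hd r * x) (tl p) (tl r)) ps"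
  have "\<forall>y\<in>set ys. y = 0"
  proof (rule "2.IH"[OF ps])
    show "full_column_rank n ?rs" using "2.prems"(1) ps by simp
    show "length ys = n" by fact
    fix r assume "r \<in> set ?rs"
    then consider r' where "r' \<in> set rs" "hd r' = 0" "r = tl r'"
      | r' where "r' \<in> set ps" "r = map2 (\<lambda>x y. hd p * y - hd r' * x) (tl p) (tl r')"
      by auto
    then show "length r = n \<and> dot r ys = 0"
    proof cases
      case 1
      then show ?thesis using row[of r'] by auto
    next
      case (2 r')
      then have r': "length (tl r') = n" "of_int (hd r') * y + dot (tl r') ys = 0"
        using row[OF mem(3)] by force+
      have "dot r ys = of_int (hd p) * dot (tl r') ys - of_int (hd r') * dot (tl p) ys"
        using 2 p r' x by (simp add: dot_eliminate)
      also have "\<dots> = 0"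
        using p(2) r'(2) by (simp add: eq_neg_iff_add_eq_0[symmetric] add.commute algebra_simps)
      finally show ?thesis using 2 p r' by simp
    qed
  qed
  moreover have "dot cs ys = 0" if "\<forall>y\<in>set ys. y = 0" for cs
  proof -
    have "map (\<lambda>(c, y). of_int c * y) (zip cs ys) = map (\<lambda>_. 0) (zip cs ys)"
      using that by (auto dest: set_zip_rightD)
    then show ?thesis by (simp add: dot_def del: map_eq_conv)
  qed
  ultimately show ?case using p(2) mem(2) x by auto
qed simp

text \<open>Equal lengths keep the zipped lists from being truncated.\<close>

lemma gram_eq_sum:
  assumes "length u = length d" "length v = length d"
  shows "gram d u v = (\<Sum>s<length d. d ! s * u ! s * v ! s)"
  using assms by (simp add: gram_def sum_list_sum_nth atLeast0LessThan mult.assoc)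

text \<open>An admissible \<open>X\<close> vanishes on the diagonal and at the edges, and by
  symmetry it is determined by its entries \<open>?x\<close> at the non-edges \<open>p < q\<close>.
  In these unknowns \<open>A X = O\<close> is the linear system with rows \<open>row i j\<close>,
  and full column rank leaves only the zero solution.\<close>

lemma witness_strong_arnold:
  assumes "witness_ok k (d, us)"
  shows "strong_arnold {..<length us} (\<lambda>i j. of_int (gram d (us ! i) (us ! j)))"
  unfolding strong_arnold_def
proof (intro allI impI ballI)
  let ?q = "length us"
  let ?a = "\<lambda>i j. gram d (us ! i) (us ! j)"
  fix X i j
  assume X: "symmetric_on {..<?q} X" "\<forall>i\<in>{..<?q}. \<forall>j\<in>{..<?q}. of_int (?a i j) * X i j = 0"
    "\<forall>i\<in>{..<?q}. X i i = 0" "\<forall>i\<in>{..<?q}. \<forall>j\<in>{..<?q}. (\<Sum>k<?q. of_int (?a i k) * X k j) = (0::real)"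
    and ij: "i \<in> {..<?q}" "j \<in> {..<?q}"
  have a_sym: "?a i j = ?a j i" if "i < ?q" "j < ?q" for i j
    using assms that by (simp add: gram_eq_sum witness_ok_def list_all_length mult_ac)
  define N where "N = filter (\<lambda>(p, q). p < q \<and> ?a p q = 0) (List.product [0..<?q] [0..<?q])"
  have setN: "set N = {(p, q). p < q \<and> q < ?q \<and> ?a p q = 0}"
    by (auto simp: N_def)
  have distN: "distinct N"
    by (simp add: N_def distinct_product)
  define row where "row i j = map (\<lambda>(p, q). (if q = j then ?a i p else 0) + (if p = j then ?a i q else 0)) N" for i j
  have rows: "arnold_rows d us = [row i j. i \<leftarrow> [0..<?q], j \<leftarrow> [0..<?q]]"
  proof -
    let ?A = "map (\<lambda>u. map (gram d u) us) us"
    have "filter (\<lambda>(p, q). p < q \<and> ?A ! p ! q = 0) (List.product [0..<?q] [0..<?q]) = N"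
      unfolding N_def by (rule filter_cong) auto
    moreover have "map (\<lambda>(p, q). (if q = j then ?A ! i ! p else 0) + (if p = j then ?A ! i ! q else 0)) N = row i j"
      if "i < ?q" for i j
      unfolding row_def using that setN by (intro map_cong refl) (clarsimp simp: setN)
    ultimately show ?thesis
      unfolding arnold_rows_def Let_def
      by (intro arg_cong[of _ _ concat] map_cong[OF refl]) (simp only: set_upt atLeastLessThan_iff)
  qed
  let ?x = "map (\<lambda>(p, q). X p q) N"
  have dot_row: "dot (row i j) ?x = (\<Sum>k<?q. of_int (?a i k) * X k j)" if ij: "i < ?q" "j < ?q" for i j
  proof -
    let ?I = "\<lambda>p q. p < q \<and> ?a p q = 0"
    have "dot (row i j) ?x = (\<Sum>(p, q)\<in>set N. of_int ((if q = j then ?a i p else 0) + (if p = j then ?a i q else 0)) * X p q)"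
      unfolding row_def dot_map sum_list_distinct_conv_sum_set[OF distN] by (rule sum.cong) auto
    also have "\<dots> = (\<Sum>(p, q)\<in>{..<?q} \<times> {..<?q}. if ?I p q then
        of_int ((if q = j then ?a i p else 0) + (if p = j then ?a i q else 0)) * X p q else 0)"
      by (rule sum.mono_neutral_cong_left) (auto simp: setN split: if_splits)
    \<comment> \<open>An unknown \<open>X p q\<close> stands for two entries of the matrix: it
      enters column \<open>q\<close> at row \<open>p\<close> and column \<open>p\<close> at row
      \<open>q\<close>.\<close>
    also have "\<dots> = (\<Sum>(p, q)\<in>{..<?q} \<times> {..<?q}. (if q = j then if ?I p j then of_int (?a i p) * X p j else 0 else 0)
       + (if p = j then if ?I j q then of_int (?a i q) * X j q else 0 else 0))"
      by (rule sum.cong[OF refl]) (clarsimp simp: distrib_right)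
    also have "\<dots> = (\<Sum>p<?q. if ?I p j then of_int (?a i p) * X p j else 0) +
        (\<Sum>q<?q. if ?I j q then of_int (?a i q) * X j q else 0)"
    proof -
      have "(\<Sum>(p, q)\<in>{..<?q} \<times> {..<?q}. (if q = j then if ?I p j then of_int (?a i p) * X p j else 0 else 0))
        = (\<Sum>p<?q. if ?I p j then of_int (?a i p) * X p j else 0)"
        using ij by (simp add: sum.cartesian_product[symmetric])
      moreover have "(\<Sum>(p, q)\<in>{..<?q} \<times> {..<?q}. (if p = j then if ?I j q then of_int (?a i q) * X j q else 0 else 0))
        = (\<Sum>q<?q. if ?I j q then of_int (?a i q) * X j q else 0)"
      proof -
        have "(\<Sum>q<?q. if p = j then if ?I j q then of_int (?a i q) * X j q else 0 else 0) =
          (if p = j then \<Sum>q<?q. if ?I j q then of_int (?a i q) * X j q else 0 else 0)" for p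
          by simp
        then show ?thesis
          using ij by (simp only: sum.cartesian_product[symmetric]) simp
      qed
      ultimately show ?thesis by (simp add: case_prod_beta sum.distrib)
    qed
    also have "\<dots> = (\<Sum>k<?q. of_int (?a i k) * X k j)"
      unfolding sum.distrib[symmetric]
    \<comment> \<open>For a non-edge, exactly one of the two terms survives, according to the order
      of \<open>k\<close> and \<open>j\<close>. If \<open>k = j\<close> or the pair is an edge, both
      disappear, as does \<open>X k j\<close>.\<close>
    proof (rule sum.cong[OF refl])
      fix k assume k: "k \<in> {..<?q}"
      have "X k j = X j k" using X(1) ij k by (simp add: symmetric_on_def)
      moreover have "k = j \<Longrightarrow> X k j = 0" using X(3) ij by auto
      moreover have "?a k j \<noteq> 0 \<Longrightarrow> X k j = 0" using X(2) ij k by auto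
      moreover have "?a j k = ?a k j" using a_sym[of j k] ij k by simp
      ultimately show "(if ?I k j then of_int (?a i k) * X k j else 0) +
          (if ?I j k then of_int (?a i k) * X j k else 0) = of_int (?a i k) * X k j"
        by (cases k j rule: linorder_cases) auto
    qed
    finally show ?thesis .
  qed
  have "\<forall>y\<in>set ?x. y = 0"
  proof (rule full_column_rank_sound)
    show "length ?x = length N" by simp
    have "arnold_rows d us \<noteq> []" using ij by (auto simp: rows)
    then have "hd (arnold_rows d us) \<in> set (arnold_rows d us)" by simp
    then have "length (hd (arnold_rows d us)) = length N" by (auto simp: rows row_def)
    then show "full_column_rank (length N) (arnold_rows d us)"
      using assms by (simp add: witness_ok_def Let_def)
    fix r assume "r \<in> set (arnold_rows d us)"
    then obtain i j where "i < ?q" "j < ?q" "r = row i j" by (auto simp: rows)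
    then show "length r = length N \<and> dot r ?x = 0"
      using dot_row X(4) by (simp add: row_def)
  qed
  then have N0: "X p q = 0" if "(p, q) \<in> set N" for p q using that by auto
  show "X i j = 0"
  proof (cases "i = j \<or> ?a i j \<noteq> 0")
    case True
    then show ?thesis using X(2,3) ij by auto
  next
    case False
    then have "(i, j) \<in> set N \<or> (j, i) \<in> set N"
      using a_sym[of i j] ij unfolding setN by (cases i j rule: linorder_cases) simp_all
    moreover have "X i j = X j i" using X(1) ij unfolding symmetric_on_def by blast
    ultimately show ?thesis using N0 by auto
  qed
qed

lemma strong_arnold_cong:
  assumes "\<And>i j. \<lbrakk>i \<in> V; j \<in> V\<rbrakk> \<Longrightarrow> A i j = B i j" "strong_arnold V A"
  shows "strong_arnold V B"
proof -
  have *: "(\<forall>i\<in>V. \<forall>j\<in>V. A i j * X i j = 0) \<longleftrightarrow> (\<forall>i\<in>V. \<forall>j\<in>V. B i j * X i j = 0)"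
    "(\<forall>i\<in>V. \<forall>j\<in>V. (\<Sum>k\<in>V. A i k * X k j) = 0) \<longleftrightarrow> (\<forall>i\<in>V. \<forall>j\<in>V. (\<Sum>k\<in>V. B i k * X k j) = 0)" for X
    by (intro ball_cong refl arg_cong2[of _ _ _ _ "(=)"] sum.cong, simp add: assms(1))+
  show ?thesis
    using assms(2) unfolding strong_arnold_def * .
qed

lemma xi_ge_witness:
  assumes G: "pair_graph G" and n: "card (pverts G) \<le> CARD('n::finite)"
    and w: "witness_ok k (d, us)"
    and \<sigma>: "inj_on \<sigma> {..<length us}" "\<sigma> ` {..<length us} \<subseteq> pverts G"
    and edges: "\<And>i j. (i, j) \<in> set (gram_edges d us) \<Longrightarrow> (\<sigma> i, \<sigma> j) \<in> parcs G"
  shows "k \<le> xi G"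
proof -
  interpret pair_graph G by fact
  let ?q = "length us"
  let ?a = "\<lambda>i j. gram d (us ! i) (us ! j)"
  have symG: "(x, y) \<in> parcs G \<Longrightarrow> (y, x) \<in> parcs G" for x y
    using pair_sym_arcs by (auto simp: symmetric_def sym_def)
  have len: "length (us ! i) = length d" if "i < ?q" for i
    using w that by (simp add: witness_ok_def list_all_length)
  let ?u = "\<lambda>s i. real_of_int (us ! i ! s)"
  \<comment> \<open>This sum has the form required for all indices, whereas it is known to agree
    with \<open>?a\<close> only below \<open>?q\<close>. The Strong Arnold Property is therefore
    transported by \<open>strong_arnold_cong\<close>.\<close>
  let ?b = "\<lambda>i j. \<Sum>s<length d. of_int (d ! s) * ?u s i * ?u s j"
  have b: "?b i j = of_int (?a i j)" if "i < ?q" "j < ?q" for i j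
    using that by (simp add: gram_eq_sum len)
  have a_sym: "?a i j = ?a j i" if "i < ?q" "j < ?q" for i j
    using that by (simp add: gram_eq_sum len mult_ac)
  have "?q - length d \<le> xi G"
  proof (rule xi_ge_gram[OF G n \<sigma>, where a = ?b and r = "length d" and u = ?u])
    show "(\<sigma> i, \<sigma> j) \<in> parcs G" if ij: "i < ?q" "j < ?q" "i \<noteq> j" "?b i j \<noteq> 0" for i j
    proof -
      have "?a i j \<noteq> 0" "?a j i \<noteq> 0" using ij(4) b[OF ij(1,2)] a_sym[OF ij(1,2)] by linarith+
      then have "(i, j) \<in> set (gram_edges d us) \<or> (j, i) \<in> set (gram_edges d us)"
        using ij by (cases i j rule: linorder_cases) (auto simp: gram_edges_def)
      then show ?thesis using edges symG by blast
    qed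
    show "strong_arnold {..<?q} ?b"
      by (rule strong_arnold_cong[OF _ witness_strong_arnold[OF w]]) (rule b[symmetric], simp_all)
  qed (rule refl)
  moreover have "?q = k + length d" using w by (simp add: witness_ok_def)
  ultimately show ?thesis by simp
qed

section \<open>Resolution up to renaming of vertices\<close>

type_synonym clause = "(nat \<times> nat) list \<times> (nat \<times> nat) list"

text \<open>
  A resolution step \<open>(e, k, s, l, t)\<close> branches on the edge \<open>e\<close>: if \<open>e\<close> is present, the clause at
  position \<open>k\<close> applies after renaming by \<open>s\<close>, otherwise the one at position \<open>l\<close> after renaming by \<open>t\<close>.
  The most recently derived clause has position 0.
\<close>

type_synonym resolution = "(nat \<times> nat) \<times> nat \<times> nat list \<times> nat \<times> nat list"

text \<open>A normal form of edges, so that resolution can compare them as plain pairs.\<close>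

definition unordered_pair :: "nat \<Rightarrow> nat \<Rightarrow> nat \<times> nat" where
  "unordered_pair a b = (if a \<le> b then (a, b) else (b, a))"

definition rename_pairs :: "nat list \<Rightarrow> (nat \<times> nat) list \<Rightarrow> (nat \<times> nat) list" where
  "rename_pairs s = map (\<lambda>(a, b). unordered_pair (s ! a) (s ! b))"

definition renaming :: "nat \<Rightarrow> nat list \<Rightarrow> bool" where
  "renaming n s \<longleftrightarrow> length s = n \<and> distinct s \<and> list_all (\<lambda>x. x < n) s"

fun rename_clause :: "nat list \<Rightarrow> clause \<Rightarrow> clause" where
  "rename_clause s (P, N) = (rename_pairs s P, rename_pairs s N)"

fun resolvent :: "nat \<times> nat \<Rightarrow> clause \<Rightarrow> clause \<Rightarrow> clause" where
  "resolvent e (P, N) (P', N') = (List.union (removeAll e P) P', List.union N (removeAll e N'))"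

text \<open>The default is contradictory, hence trivially valid, which makes range checks unnecessary.\<close>

fun clause_at :: "clause list \<Rightarrow> nat \<Rightarrow> clause" where
  "clause_at [] k = ([(0, 0)], [(0, 0)])"
| "clause_at (c # cs) 0 = c"
| "clause_at (c # cs) (Suc k) = clause_at cs k"

fun refutes :: "nat \<Rightarrow> clause list \<Rightarrow> resolution list \<Rightarrow> bool" where
  "refutes n cs [] \<longleftrightarrow> clause_at cs 0 = ([], [])"
| "refutes n cs ((e, k, s, l, t) # rs) \<longleftrightarrow> renaming n s \<and> renaming n t \<and>
     refutes n (resolvent e (rename_clause s (clause_at cs k)) (rename_clause t (clause_at cs l)) # cs) rs"

text \<open>A clause is read as an implication: if the pairs in its first list are edges and those
  in its second are not, then the fixed goal \<open>Q\<close> holds. The quantification over all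
  labellings \<sigma> is what makes renamed clauses available for free.\<close>

definition clause_valid :: "('a \<times> 'a) set \<Rightarrow> 'a set \<Rightarrow> nat \<Rightarrow> bool \<Rightarrow> clause \<Rightarrow> bool" where
  "clause_valid E V n Q c \<longleftrightarrow> (\<forall>\<sigma>. inj_on \<sigma> {..<n} \<longrightarrow> \<sigma> ` {..<n} \<subseteq> V \<longrightarrow>
     (\<forall>p\<in>set (fst c). map_prod \<sigma> \<sigma> p \<in> E) \<longrightarrow> (\<forall>p\<in>set (snd c). map_prod \<sigma> \<sigma> p \<notin> E) \<longrightarrow> Q)"

lemma unordered_pair_in_iff:
  assumes "sym E"
  shows "map_prod \<sigma> \<sigma> (unordered_pair a b) \<in> E \<longleftrightarrow> (\<sigma> a, \<sigma> b) \<in> E"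
  using assms by (auto simp: unordered_pair_def dest: symD)

text \<open>A labelling composed with a permutation of the numbers below \<open>n\<close> is again
  an admissible labelling; symmetry of \<open>E\<close> absorbs the reordering of pairs.\<close>

lemma clause_valid_rename:
  assumes "sym E" "clause_valid E V n Q c" "renaming n s"
  shows "clause_valid E V n Q (rename_clause s c)"
proof -
  obtain P N where c: "c = (P, N)" by fastforce
  show ?thesis
    unfolding clause_valid_def c rename_clause.simps
  proof (intro allI impI)
    fix \<sigma> :: "nat \<Rightarrow> 'a"
    assume \<sigma>: "inj_on \<sigma> {..<n}" "\<sigma> ` {..<n} \<subseteq> V"
      and P: "\<forall>p\<in>set (fst (rename_pairs s P, rename_pairs s N)). map_prod \<sigma> \<sigma> p \<in> E"
      and N: "\<forall>p\<in>set (snd (rename_pairs s P, rename_pairs s N)). map_prod \<sigma> \<sigma> p \<notin> E"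
    have s: "s ! i \<in> {..<n}" if "i < n" for i
      using assms(3) that by (simp add: renaming_def list_all_length)
    have inj: "inj_on (\<lambda>i. s ! i) {..<n}"
      using assms(3) by (auto simp: renaming_def inj_on_def nth_eq_iff_index_eq)
    have "inj_on (\<lambda>i. \<sigma> (s ! i)) {..<n}"
      using inj s inj_onD[OF \<sigma>(1)] by (auto simp: inj_on_def)
    moreover have "(\<lambda>i. \<sigma> (s ! i)) ` {..<n} \<subseteq> V"
      using s \<sigma>(2) by blast
    moreover have "map_prod (\<lambda>i. \<sigma> (s ! i)) (\<lambda>i. \<sigma> (s ! i)) p \<in> E" if "p \<in> set P" for p
      using P that unordered_pair_in_iff[OF assms(1), where \<sigma> = \<sigma>] by (cases p) (auto simp: rename_pairs_def)
    moreover have "map_prod (\<lambda>i. \<sigma> (s ! i)) (\<lambda>i. \<sigma> (s ! i)) p \<notin> E" if "p \<in> set N" for p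
      using N that unordered_pair_in_iff[OF assms(1), where \<sigma> = \<sigma>] by (cases p) (auto simp: rename_pairs_def)
    ultimately show Q
      using assms(2)[unfolded clause_valid_def c, THEN spec, of "\<lambda>i. \<sigma> (s ! i)"] by simp
  qed
qed

lemma clause_valid_resolvent:
  assumes "clause_valid E V n Q c" "clause_valid E V n Q c'"
  shows "clause_valid E V n Q (resolvent e c c')"
proof -
  obtain P N P' N' where c: "c = (P, N)" "c' = (P', N')" by fastforce
  show ?thesis
    unfolding clause_valid_def c resolvent.simps
  proof (intro allI impI)
    fix \<sigma> :: "nat \<Rightarrow> 'a"
    assume \<sigma>: "inj_on \<sigma> {..<n}" "\<sigma> ` {..<n} \<subseteq> V"
      and "\<forall>p\<in>set (fst (List.union (removeAll e P) P', List.union N (removeAll e N'))). map_prod \<sigma> \<sigma> p \<in> E"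
      and "\<forall>p\<in>set (snd (List.union (removeAll e P) P', List.union N (removeAll e N'))). map_prod \<sigma> \<sigma> p \<notin> E"
    then have P: "\<forall>p\<in>set P - {e} \<union> set P'. map_prod \<sigma> \<sigma> p \<in> E"
      and N: "\<forall>p\<in>set N \<union> (set N' - {e}). map_prod \<sigma> \<sigma> p \<notin> E"
      by simp_all
    show Q
    proof (cases "map_prod \<sigma> \<sigma> e \<in> E")
      case True
      then have "\<forall>p\<in>set P. map_prod \<sigma> \<sigma> p \<in> E" "\<forall>p\<in>set N. map_prod \<sigma> \<sigma> p \<notin> E"
        using P N by blast+
      then show Q using assms(1) \<sigma> c by (simp add: clause_valid_def)
    next
      case False
      then have "\<forall>p\<in>set P'. map_prod \<sigma> \<sigma> p \<in> E" "\<forall>p\<in>set N'. map_prod \<sigma> \<sigma> p \<notin> E"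
        using P N by blast+
      then show Q using assms(2) \<sigma> c by (simp add: clause_valid_def)
    qed
  qed
qed

lemma clause_valid_clause_at:
  assumes "\<forall>c\<in>set cs. clause_valid E V n Q c"
  shows "clause_valid E V n Q (clause_at cs k)"
  using assms by (induction cs k rule: clause_at.induct) (simp_all add: clause_valid_def)

lemma refutes_sound:
  assumes "refutes n cs rs" "sym E" "\<forall>c\<in>set cs. clause_valid E V n Q c"
  shows "clause_valid E V n Q ([], [])"
  using assms(1,3)
proof (induction n cs rs rule: refutes.induct)
  case (2 n cs e k s l t rs)
  have "clause_valid E V n Q (resolvent e (rename_clause s (clause_at cs k)) (rename_clause t (clause_at cs l)))"
    using "2.prems" assms(2) by (intro clause_valid_resolvent clause_valid_rename clause_valid_clause_at) auto
  then show ?case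
    using "2.IH" "2.prems" by simp
next
  case (1 n cs)
  then show ?case
    using clause_valid_clause_at[of cs E V n Q 0] by simp
qed

text \<open>A witness contributes its edges, since containing it makes \<open>xi G\<close> large; a
  stair contributes its gaps as non-edges, since it makes \<open>floor_Z G\<close> small. Witnesses
  too large for \<open>n\<close> vertices are dropped. The order matters because resolution steps
  address clauses by position.\<close>

definition initial_clauses ::
  "nat \<Rightarrow> (int list \<times> int list list) list \<Rightarrow> (nat \<times> nat) list list \<Rightarrow> clause list" where
  "initial_clauses n ws ts = map (\<lambda>(d, us). (gram_edges d us, [])) (filter (\<lambda>(d, us). length us \<le> n) ws) @
     map (\<lambda>t. ([], stair_gaps t)) ts"

definition certifies ::
  "nat \<Rightarrow> nat \<Rightarrow> (int list \<times> int list list) list \<Rightarrow> (nat \<times> nat) list list \<times> resolution list \<Rightarrow> bool" where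
  "certifies n m ws c \<longleftrightarrow>
     list_all (\<lambda>t. stair t \<and> length t + m = n \<and> list_all (\<lambda>(i, j). i < n \<and> j < n) t) (fst c) \<and>
     refutes n (initial_clauses n ws (fst c)) (snd c)"

text \<open>The dichotomy itself serves as the goal \<open>?Q\<close> of the clauses, so that
  witnesses and stairs become valid initial clauses by establishing one alternative each.\<close>

lemma certifies_sound:
  assumes G: "pair_graph G" and N: "card (pverts G) \<le> CARD('n::finite)"
    and ws: "list_all (witness_ok (Suc m)) ws" and c: "certifies (card (pverts G)) m ws c"
  shows "floor_Z G \<le> m \<or> m < xi G"
proof -
  interpret pair_graph G by fact
  let ?n = "card (pverts G)"
  let ?Q = "floor_Z G \<le> m \<or> m < xi G"
  have sym: "sym (parcs G)"
    using pair_sym_arcs by (auto simp: symmetric_def)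
  have "\<forall>cl\<in>set (initial_clauses ?n ws (fst c)). clause_valid (parcs G) (pverts G) ?n ?Q cl"
  proof
    fix cl assume "cl \<in> set (initial_clauses ?n ws (fst c))"
    then consider d us where "(d, us) \<in> set ws" "length us \<le> ?n" "cl = (gram_edges d us, [])"
      | t where "t \<in> set (fst c)" "cl = ([], stair_gaps t)"
      by (auto simp: initial_clauses_def)
    then show "clause_valid (parcs G) (pverts G) ?n ?Q cl"
    proof cases
      case (1 d us)
      have w: "witness_ok (Suc m) (d, us)" using 1 ws by (auto simp: list_all_iff)
      show ?thesis
        unfolding clause_valid_def
      proof (intro allI impI)
        fix \<sigma> assume \<sigma>: "inj_on \<sigma> {..<?n}" "\<sigma> ` {..<?n} \<subseteq> pverts G"
          and P: "\<forall>p\<in>set (fst cl). map_prod \<sigma> \<sigma> p \<in> parcs G"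
        have "{..<length us} \<subseteq> {..<?n}" using 1 by auto
        then have "Suc m \<le> xi G"
          using \<sigma> P 1(3) by (intro xi_ge_witness[OF G N w]) (auto intro: inj_on_subset)
        then show ?Q by simp
      qed
    next
      case (2 t)
      have t: "stair t" "length t + m = ?n" "list_all (\<lambda>(i, j). i < ?n \<and> j < ?n) t"
        using c 2 by (auto simp: certifies_def list_all_iff)
      show ?thesis
        unfolding clause_valid_def
      proof (intro allI impI)
        fix \<sigma> assume \<sigma>: "inj_on \<sigma> {..<?n}" "\<sigma> ` {..<?n} \<subseteq> pverts G"
          and N: "\<forall>p\<in>set (snd cl). map_prod \<sigma> \<sigma> p \<notin> parcs G"
        have sub: "set (map fst t) \<union> set (map snd t) \<subseteq> {..<?n}"
          using t(3) by (auto simp: list_all_iff)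
        have "floor_Z G \<le> ?n - length (map (map_prod \<sigma> \<sigma>) t)"
        proof (rule floor_Z_le_stair[OF G])
          show "stair (map (map_prod \<sigma> \<sigma>) t)"
            using inj_on_subset[OF \<sigma>(1) sub] t(1) by (rule stair_map)
          show "set (map fst (map (map_prod \<sigma> \<sigma>) t)) \<union> set (map snd (map (map_prod \<sigma> \<sigma>) t)) \<subseteq> pverts G"
            using sub \<sigma>(2) by (auto simp: image_subset_iff)
          show "set (stair_gaps (map (map_prod \<sigma> \<sigma>) t)) \<inter> parcs G = {}"
            using N 2 by (auto simp: stair_gaps_map)
        qed
        moreover have "?n - length (map (map_prod \<sigma> \<sigma>) t) = m" using t(2) by simp
        ultimately show ?Q by simp
      qed
    qed
  qed
  then have "clause_valid (parcs G) (pverts G) ?n ?Q ([], [])"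
    using c sym by (intro refutes_sound) (auto simp: certifies_def)
  \<comment> \<open>Even the empty clause still asks for a labelling; any enumeration of the
    vertices will do.\<close>
  moreover obtain \<sigma> where "inj_on \<sigma> {..<?n}" "\<sigma> ` {..<?n} \<subseteq> pverts G"
    using ex_bij_betw_nat_finite[OF pair_finite_verts] by (auto simp: bij_betw_def lessThan_atLeast0)
  ultimately show ?thesis by (auto simp: clause_valid_def)
qed

lemma xi_le_floor_Z:
  assumes "pair_graph G" "card (pverts G) \<le> CARD('n::finite)"
  shows "xi G \<le> floor_Z G"
  using xi_le_card_floor_forcing_set[OF assms] floor_Z_attained[OF assms(1)] by metis

section \<open>Certificates\<close>

text \<open>
  The data were found by computer search. The entry at position \<open>m\<close> of \<open>witnesses\<close> runs through the
  subgraph-minimal graphs that have no forcing set of size \<open>m\<close>. A pair \<open>(d, us)\<close> stands for the matrix with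
  entries \<open>\<Sum>s. d\<^sub>s * us\<^sub>i\<^sub>s * us\<^sub>j\<^sub>s\<close>, which has rank at most \<open>length d\<close>. The certificate for \<open>n\<close> vertices and \<open>m\<close>
  lists the stairs with \<open>n - m\<close> forces that occur in the resolution proof, followed by its steps.
\<close>

definition witnesses :: "(int list \<times> int list list) list list" where "witnesses = [
  [([], [[]])],
  [([1], [[1],[1],[1]]),
   ([1,-1], [[1,1],[0,1],[-1,0],[1,1]]),
   ([1,-1], [[1,1],[-1,-1],[1,1],[1,0]]),
   ([1,1,1], [[0,1,1],[1,1,0],[0,0,1],[1,0,0],[1,-1,1]]),
   ([1,1,1,1], [[1,0,1,-1],[0,0,-1,0],[1,0,0,0],[0,1,1,1],[1,-1,0,1],[0,1,0,0]]),
   ([1,1,-1,-1,-1], [[0,0,-1,0,0],[0,0,-1,1,0],[1,0,1,1,1],[0,1,0,-1,1],[1,0,0,0,0],[0,1,0,0,0],[1,1,0,0,1]])],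
  [([1], [[1],[1],[1],[1]]),
   ([1,-1], [[-1,1],[-1,1],[-1,1],[1,0],[0,1]]),
   ([1,1,-1], [[-1,0,0],[1,1,1],[0,1,1],[0,1,1],[1,-1,0],[0,0,1]]),
   ([1,1,1], [[0,1,0],[1,0,0],[0,0,1],[1,1,0],[0,1,1],[-1,0,1]]),
   ([1,1,1,-1], [[0,1,1,1],[1,1,0,1],[0,0,1,0],[-1,0,0,0],[0,-1,0,-1],[0,-1,0,0],[1,0,1,1]]),
   ([1,1,-1,-1], [[1,1,1,1],[0,-1,0,0],[0,0,-1,0],[1,0,0,1],[1,0,0,1],[1,-1,0,0],[0,0,-1,1]]),
   ([1,1,-1,-1], [[0,-1,0,1],[0,0,1,0],[1,0,0,0],[0,0,0,1],[0,1,1,-1],[1,1,0,-1],[1,0,-1,0]]),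
   ([1,1,1,-1], [[0,0,1,1],[0,0,0,1],[-1,0,0,0],[0,-1,0,0],[1,0,1,0],[0,1,1,1],[1,1,0,0]])],
  [([-1], [[1],[1],[1],[1],[1]]),
   ([1,-1], [[-1,1],[-1,1],[1,1],[1,1],[1,1],[1,-1]]),
   ([1,-1], [[-1,1],[1,1],[1,0],[0,1],[1,1],[-1,1]]),
   ([1,1], [[1,0],[1,1],[-1,1],[0,1],[0,1],[0,-1]]),
   ([1,1,-1], [[1,-1,1],[1,0,0],[0,-1,0],[0,1,-1],[1,0,1],[1,0,1],[0,1,-1]]),
   ([-1,-1,-1], [[0,0,1],[0,1,0],[-1,1,0],[1,0,-1],[1,0,1],[1,1,0],[1,0,0]]),
   ([1,1,-1], [[-1,1,1],[0,0,1],[-1,0,0],[0,1,0],[-1,0,1],[0,1,1],[1,1,0]]),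
   ([1,1,-1], [[-1,1,1],[0,0,1],[0,-1,0],[0,1,1],[0,1,1],[-1,0,1],[1,1,0]]),
   ([1,1,-1], [[0,1,0],[1,0,0],[1,1,-1],[0,1,-1],[1,0,-1],[0,0,1],[0,0,1]]),
   ([1,-1,-1], [[1,1,0],[0,-1,0],[1,0,1],[1,1,1],[0,0,-1],[0,0,1],[0,0,1]]),
   ([1,1,1], [[0,0,1],[0,1,0],[-1,0,0],[1,1,0],[-1,1,0],[0,-1,1],[1,0,1]])],
  [([1], [[1],[1],[-1],[1],[1],[1]]),
   ([1,-1], [[1,-1],[-1,1],[1,-1],[1,1],[1,0],[0,1],[1,1]]),
   ([1,-1], [[1,0],[-1,1],[1,-1],[1,-1],[0,1],[0,1],[0,-1]]),
   ([1,-1], [[0,1],[1,1],[1,1],[1,0],[1,0],[1,0],[1,0]]),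
   ([1,-1], [[-1,1],[-1,1],[1,1],[-1,-1],[1,1],[-1,1],[1,0]])],
  [([1], [[1],[1],[1],[1],[1],[-1],[1]])]]"

text \<open>The smallest case shows the mechanism. Clause 0 is the triangle and clause 1 the stair,
  whose single gap is a non-edge. The three steps remove the edges of the triangle one by one
  against renamings of the stair clause, whose position moves up as clauses are added: a graph on
  three vertices has a non-edge or is the triangle.\<close>

definition certificate_3_1 :: "(nat \<times> nat) list list \<times> resolution list" where
  "certificate_3_1 = ([[(2,0),(0,1)]], [
   ((1,2),0,[0,1,2],1,[0,1,2]), ((0,1),0,[0,1,2],2,[2,0,1]), ((0,2),0,[0,1,2],3,[1,0,2])])"

text \<open>For \<open>m = 1\<close> a stair asks for an ordering of the vertices in which only
  consecutive ones may be adjacent, as in a disjoint union of paths. The obstructions are the cycles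
  and the star with three leaves, which are the witnesses at position 1.\<close>

definition certificate_4_1 :: "(nat \<times> nat) list list \<times> resolution list" where
  "certificate_4_1 = ([[(3,0),(0,1),(1,2)]], [
   ((2,3),0,[0,2,3,1],3,[0,3,1,2]), ((1,2),2,[0,2,3,1],0,[0,1,2,3]), ((1,3),0,[0,1,2,3],1,[0,1,3,2]),
   ((0,1),5,[1,2,3,0],0,[0,1,2,3]), ((1,3),0,[3,2,0,1],7,[2,3,0,1]), ((0,1),2,[0,2,1,3],0,[0,1,2,3]),
   ((0,2),2,[0,1,2,3],0,[0,1,2,3]), ((1,2),1,[1,0,3,2],10,[2,0,1,3]), ((1,3),2,[3,2,0,1],0,[0,1,2,3]),
   ((0,3),2,[0,2,1,3],0,[0,2,1,3])])"

definition certificate_4_2 :: "(nat \<times> nat) list list \<times> resolution list" where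
  "certificate_4_2 = ([[(2,0),(3,1)]], [
   ((2,3),0,[0,1,2,3],1,[1,2,3,0]), ((1,2),0,[0,1,2,3],2,[3,1,2,0]), ((0,1),0,[0,1,2,3],3,[3,0,1,2]),
   ((0,3),0,[0,1,2,3],4,[2,0,3,1]), ((1,3),0,[0,1,2,3],5,[2,1,3,0]), ((0,2),0,[0,3,2,1],6,[3,0,2,1])])"

definition certificate_5_1 :: "(nat \<times> nat) list list \<times> resolution list" where
  "certificate_5_1 = ([[(4,0),(0,1),(1,2),(2,3)]], [
   ((0,4),3,[0,1,4,3,2],4,[2,3,1,0,4]), ((2,4),0,[0,1,2,3,4],5,[0,1,3,2,4]),
   ((0,2),3,[0,1,2,3,4],0,[0,1,2,3,4]), ((3,4),5,[1,2,4,3,0],0,[0,1,2,3,4]),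
   ((0,2),2,[2,0,3,1,4],8,[4,3,1,0,2]), ((0,4),1,[3,1,4,0,2],0,[0,1,2,3,4]),
   ((2,3),2,[0,1,2,3,4],0,[0,1,2,3,4]), ((1,2),9,[0,2,3,1,4],0,[0,1,2,3,4]),
   ((0,3),8,[0,1,3,4,2],0,[0,1,2,3,4]), ((1,4),11,[0,3,4,1,2],0,[0,1,2,3,4]),
   ((3,4),1,[2,4,1,3,0],14,[2,4,1,0,3]), ((2,4),0,[0,1,2,3,4],15,[3,4,1,0,2]),
   ((0,2),6,[2,0,3,1,4],0,[0,1,2,3,4]), ((0,3),5,[1,0,2,3,4],0,[0,1,2,3,4]),
   ((1,2),5,[0,1,4,2,3],0,[0,1,2,3,4]), ((0,4),5,[1,0,3,4,2],0,[0,1,2,3,4]),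
   ((1,3),6,[0,1,4,3,2],0,[0,1,4,3,2]), ((0,2),3,[2,0,1,3,4],21,[2,3,4,0,1]),
   ((1,4),4,[4,1,0,3,2],0,[0,1,2,3,4]), ((1,3),3,[3,1,4,0,2],0,[0,1,2,3,4]),
   ((0,3),4,[3,0,4,1,2],0,[0,1,2,3,4]), ((2,4),4,[2,4,3,1,0],0,[0,1,2,3,4]),
   ((0,1),5,[0,1,4,3,2],0,[0,1,4,3,2])])"

definition certificate_5_2 :: "(nat \<times> nat) list list \<times> resolution list" where
  "certificate_5_2 = ([[(4,0),(0,1),(3,2)]], [
   ((0,3),0,[0,1,2,3,4],2,[3,2,0,1,4]), ((1,2),0,[0,1,2,3,4],3,[1,0,2,3,4]),
   ((2,4),3,[0,3,4,1,2],0,[0,1,2,3,4]), ((0,4),4,[1,2,4,0,3],0,[0,1,2,3,4]),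
   ((1,2),1,[3,2,4,1,0],6,[2,0,1,4,3]), ((0,3),1,[1,0,4,3,2],0,[0,1,2,3,4]),
   ((1,3),2,[0,1,2,3,4],0,[0,1,2,3,4]), ((0,3),5,[3,0,4,1,2],9,[4,0,2,1,3]),
   ((2,4),5,[2,4,0,1,3],0,[0,1,2,3,4]), ((2,3),2,[0,1,2,3,4],0,[0,1,2,3,4]),
   ((2,3),1,[0,2,1,4,3],12,[3,1,2,0,4]), ((2,4),1,[0,2,1,3,4],0,[0,1,2,3,4]),
   ((1,4),2,[0,1,2,3,4],0,[0,1,2,3,4]), ((2,3),5,[4,3,1,0,2],15,[0,3,1,4,2]),
   ((1,2),1,[2,0,1,3,4],0,[0,1,2,3,4]), ((0,1),2,[0,1,2,3,4],0,[0,1,2,3,4]),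
   ((2,4),1,[1,0,3,2,4],18,[1,4,0,3,2]), ((1,3),0,[0,1,2,3,4],19,[2,3,0,4,1]),
   ((0,1),3,[0,2,1,3,4],0,[0,1,2,4,3]), ((0,2),3,[0,1,2,3,4],0,[0,1,2,3,4]),
   ((1,4),0,[3,2,0,1,4],2,[4,1,3,2,0]), ((3,4),1,[2,1,0,3,4],0,[2,1,0,3,4])])"

definition certificate_5_3 :: "(nat \<times> nat) list list \<times> resolution list" where
  "certificate_5_3 = ([[(4,0),(3,1)]], [
   ((0,1),0,[0,1,2,3,4],1,[4,0,3,2,1]), ((0,4),0,[0,1,2,3,4],2,[3,0,2,1,4]),
   ((2,4),0,[0,1,2,3,4],3,[3,2,1,0,4]), ((2,3),0,[0,1,2,3,4],4,[4,2,1,0,3]),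
   ((0,3),0,[0,1,2,3,4],5,[4,0,2,1,3]), ((1,3),0,[0,1,2,3,4],6,[4,1,2,0,3]),
   ((3,4),0,[0,1,2,3,4],7,[2,3,1,0,4]), ((1,2),0,[0,1,2,3,4],8,[4,1,3,0,2]),
   ((1,4),0,[0,1,2,3,4],9,[3,1,2,0,4]), ((0,2),0,[0,4,2,3,1],10,[4,0,3,1,2])])"

definition certificate_6_1 :: "(nat \<times> nat) list list \<times> resolution list" where
  "certificate_6_1 = ([[(5,0),(0,1),(1,2),(2,3),(3,4)]], [
   ((2,4),4,[0,1,3,2,5,4],5,[5,3,0,1,2,4]), ((1,2),0,[0,1,2,3,4,5],6,[4,5,3,0,1,2]),
   ((1,4),5,[0,1,3,4,5,2],0,[0,1,2,3,4,5]), ((2,4),5,[1,2,5,4,3,0],8,[1,4,5,3,0,2]),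
   ((1,4),0,[0,1,2,3,4,5],9,[2,4,5,3,0,1]), ((0,1),2,[0,1,2,3,4,5],0,[0,1,2,3,4,5]),
   ((1,5),8,[1,3,4,5,2,0],0,[0,1,2,3,4,5]), ((2,5),9,[2,3,4,5,1,0],0,[0,1,2,3,4,5]),
   ((1,5),9,[0,1,3,5,4,2],2,[5,2,4,3,1,0]), ((2,4),9,[1,2,4,5,3,0],14,[1,4,5,3,0,2]),
   ((1,4),0,[0,1,2,3,4,5],15,[2,4,5,3,0,1]), ((1,2),0,[0,1,2,3,4,5],16,[4,2,5,3,0,1]),
   ((2,5),7,[0,1,4,3,2,5],0,[0,1,2,3,4,5]), ((1,5),6,[0,2,4,3,1,5],0,[0,1,2,3,4,5]),
   ((0,1),5,[0,1,2,3,4,5],0,[0,1,2,3,4,5]), ((4,5),7,[0,1,2,3,4,5],0,[0,1,2,3,4,5]),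
   ((0,1),18,[1,2,3,0,5,4],0,[3,5,1,0,4,2]), ((0,2),0,[0,1,2,3,4,5],1,[0,1,2,3,4,5]),
   ((0,5),18,[0,3,5,4,2,1],0,[0,1,2,3,4,5]), ((1,3),21,[0,1,5,3,4,2],0,[0,1,2,3,4,5]),
   ((2,3),22,[0,2,5,3,4,1],0,[0,1,2,3,4,5]), ((3,4),23,[0,4,5,3,2,1],0,[0,2,1,3,4,5]),
   ((0,2),2,[0,1,5,2,3,4],11,[3,2,4,5,1,0]), ((2,4),0,[0,1,2,3,4,5],10,[3,0,1,5,2,4]),
   ((4,5),10,[3,1,2,5,0,4],0,[0,1,2,3,4,5]), ((3,4),6,[4,1,2,3,0,5],0,[0,1,2,3,4,5]),
   ((2,3),6,[5,4,1,3,0,2],0,[0,1,2,3,4,5]), ((2,5),7,[3,4,1,5,0,2],0,[0,1,2,3,4,5]),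
   ((0,5),7,[3,4,2,5,1,0],0,[0,1,2,3,4,5]), ((1,5),7,[3,4,2,5,0,1],0,[0,1,2,3,4,5]),
   ((2,3),32,[1,2,5,3,4,0],0,[0,2,5,3,4,1]), ((1,3),0,[0,1,2,3,4,5],1,[0,1,2,3,4,5]),
   ((0,3),10,[0,2,1,3,4,5],0,[0,2,1,3,4,5]), ((1,3),4,[0,5,4,1,2,3],20,[3,1,2,0,4,5]),
   ((4,5),5,[0,3,2,4,1,5],0,[0,1,2,3,4,5]), ((1,5),3,[0,4,3,1,2,5],0,[0,1,2,3,4,5]),
   ((3,4),6,[2,5,1,3,0,4],0,[0,1,2,3,4,5]), ((0,1),7,[2,4,5,0,3,1],0,[0,1,2,3,4,5]),
   ((0,2),6,[3,4,1,2,5,0],0,[0,1,2,3,4,5]), ((2,3),6,[0,5,1,2,4,3],0,[0,1,2,3,4,5]),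
   ((3,5),7,[0,2,1,3,4,5],0,[0,2,1,3,4,5]), ((2,4),43,[0,2,5,4,3,1],0,[2,5,3,1,4,0]),
   ((4,5),0,[0,3,2,1,4,5],1,[4,3,2,1,5,0]), ((0,4),0,[0,5,3,2,4,1],2,[0,5,3,2,4,1])])"

text \<open>A stair with \<open>n - m\<close> forces splits the vertices into \<open>m\<close>
  forcing chains. Here the two stairs have chains of 4 and 2 and of 3 and 3 vertices.\<close>

definition certificate_6_2 :: "(nat \<times> nat) list list \<times> resolution list" where
  "certificate_6_2 = ([[(4,0),(0,1),(1,2),(5,3)], [(5,0),(0,1),(4,2),(2,3)]], [
   ((1,5),1,[1,2,4,0,5,3],5,[4,0,2,1,5,3]), ((0,1),0,[0,1,2,3,4,5],5,[4,0,2,1,3,5]),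
   ((4,5),3,[0,3,4,1,5,2],0,[5,2,0,4,3,1]), ((1,4),0,[0,1,2,3,4,5],1,[1,2,0,4,3,5]),
   ((1,4),6,[4,1,2,5,0,3],0,[0,2,4,3,1,5]), ((0,2),6,[1,2,5,0,3,4],0,[0,2,1,3,4,5]),
   ((1,5),6,[0,1,2,5,4,3],11,[4,2,0,1,5,3]), ((1,2),9,[1,3,0,4,2,5],0,[0,2,4,1,3,5]),
   ((4,5),0,[0,1,2,3,4,5],13,[0,5,1,3,2,4]), ((1,2),11,[5,3,2,4,0,1],0,[0,1,4,3,2,5]),
   ((1,4),0,[0,1,2,3,4,5],1,[0,1,2,3,4,5]), ((1,2),13,[2,0,3,4,1,5],15,[1,4,2,0,3,5]),
   ((1,4),13,[1,2,5,0,4,3],0,[3,2,1,4,0,5]), ((1,2),16,[4,3,0,1,2,5],17,[1,4,2,0,3,5]),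
   ((2,5),0,[0,1,2,3,4,5],18,[2,0,5,3,4,1]), ((1,5),0,[0,1,2,3,4,5],19,[1,3,5,0,4,2]),
   ((4,5),4,[0,1,2,3,4,5],0,[0,1,2,3,4,5]), ((1,2),19,[1,3,0,4,2,5],21,[3,4,2,0,1,5]),
   ((4,5),0,[0,1,2,3,4,5],23,[0,5,1,3,2,4]), ((1,4),2,[0,1,2,3,4,5],0,[0,1,2,3,4,5]),
   ((1,4),1,[3,2,1,0,4,5],24,[3,1,2,0,4,5]), ((2,4),1,[0,1,2,3,4,5],0,[0,1,2,3,4,5]),
   ((1,2),23,[0,1,5,2,4,3],26,[1,5,2,0,3,4]), ((1,4),0,[0,1,2,3,4,5],27,[1,5,4,0,3,2]),
   ((0,4),0,[2,5,0,3,1,4],29,[4,1,0,2,5,3]), ((1,4),0,[0,1,2,3,4,5],30,[4,0,1,2,5,3]),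
   ((0,5),4,[0,1,2,3,4,5],0,[1,5,3,0,4,2]), ((4,5),14,[0,1,2,3,4,5],0,[4,5,2,3,0,1]),
   ((2,4),0,[0,1,2,3,4,5],24,[0,1,2,3,4,5]), ((0,5),0,[0,1,2,3,4,5],7,[0,5,2,3,4,1]),
   ((0,1),0,[0,1,2,3,4,5],3,[0,1,2,3,4,5]), ((2,4),20,[0,1,2,3,4,5],0,[2,1,0,3,4,5]),
   ((0,2),27,[0,1,2,3,4,5],0,[3,4,1,0,2,5]), ((0,5),27,[0,1,2,3,4,5],0,[0,5,2,3,4,1]),
   ((1,4),35,[1,2,5,0,4,3],24,[4,1,2,3,0,5]), ((4,5),35,[1,2,4,5,3,0],40,[5,2,4,0,1,3]),
   ((1,5),0,[0,1,2,3,4,5],23,[1,4,3,0,5,2]), ((1,4),0,[0,1,2,3,4,5],42,[1,2,4,0,5,3]),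
   ((1,2),0,[0,1,2,3,4,5],43,[1,4,2,0,5,3]), ((2,4),0,[0,1,2,3,4,5],9,[2,5,0,3,4,1]),
   ((2,5),0,[0,1,2,3,4,5],45,[5,4,2,0,1,3]), ((0,5),9,[0,1,2,3,4,5],0,[0,1,2,3,4,5]),
   ((4,5),7,[0,1,2,3,4,5],0,[4,5,0,3,2,1]), ((2,4),0,[0,1,2,3,4,5],12,[2,1,0,3,4,5]),
   ((0,5),0,[0,1,2,3,4,5],12,[0,5,2,3,4,1]), ((0,1),0,[0,1,2,3,4,5],3,[0,1,2,3,4,5]),
   ((0,4),0,[0,1,2,3,4,5],15,[0,1,2,3,4,5]), ((2,4),16,[2,1,4,0,3,5],43,[0,1,2,3,4,5]),
   ((1,5),49,[2,4,5,0,1,3],24,[1,5,2,3,4,0]), ((4,5),49,[0,2,4,5,3,1],53,[5,0,4,1,3,2]),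
   ((2,4),0,[0,1,2,3,4,5],54,[2,0,4,1,3,5]), ((2,5),0,[0,1,2,3,4,5],55,[0,5,3,1,2,4]),
   ((4,5),50,[0,1,2,3,4,5],0,[2,3,1,4,5,0]), ((1,4),4,[2,4,0,3,1,5],0,[0,1,2,3,4,5]),
   ((0,5),47,[0,1,2,3,4,5],59,[4,2,1,0,5,3]), ((0,1),0,[0,1,2,3,4,5],59,[4,1,2,0,3,5]),
   ((1,4),3,[1,0,2,3,4,5],0,[0,1,2,3,4,5]), ((0,4),3,[0,1,2,3,4,5],0,[0,1,2,3,4,5]),
   ((2,5),0,[0,1,2,3,4,5],32,[0,1,2,3,4,5]), ((1,5),0,[4,5,1,2,3,0],63,[3,5,4,1,2,0]),
   ((4,5),58,[0,1,2,3,4,5],65,[1,5,2,3,0,4]), ((0,4),0,[0,1,2,3,4,5],65,[4,2,0,1,3,5]),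
   ((1,4),2,[5,1,3,2,4,0],0,[0,1,2,3,4,5]), ((0,5),15,[0,1,2,3,4,5],0,[5,2,3,0,4,1]),
   ((0,1),0,[0,1,2,3,4,5],1,[1,2,3,0,4,5]), ((0,4),34,[0,1,4,3,2,5],0,[0,1,2,3,4,5]),
   ((0,2),19,[0,1,2,3,4,5],0,[0,1,2,3,4,5]), ((1,4),67,[0,1,2,4,5,3],8,[0,2,1,3,4,5]),
   ((0,4),0,[0,1,2,3,4,5],9,[1,2,0,3,4,5]), ((1,4),9,[0,1,2,3,4,5],74,[1,0,4,2,5,3]),
   ((2,5),7,[0,1,2,3,4,5],0,[0,1,2,3,4,5]), ((1,2),12,[0,1,2,3,4,5],0,[0,1,2,3,4,5]),
   ((0,1),3,[0,1,2,3,4,5],0,[2,4,0,3,1,5]), ((0,2),0,[0,1,2,3,4,5],14,[1,4,2,3,0,5]),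
   ((1,2),0,[0,1,2,3,4,5],2,[4,0,2,3,1,5]), ((0,4),15,[5,0,2,3,4,1],79,[3,4,1,0,2,5]),
   ((1,2),5,[1,0,2,3,4,5],0,[0,1,2,3,4,5]), ((0,2),5,[0,1,2,3,4,5],0,[0,1,2,3,4,5]),
   ((2,4),3,[0,1,2,3,4,5],0,[0,1,2,3,4,5]), ((3,5),12,[0,1,2,3,4,5],0,[0,2,4,3,5,1]),
   ((0,5),47,[0,1,2,3,4,5],0,[1,4,3,0,5,2]), ((0,1),47,[0,1,2,3,4,5],0,[0,1,2,3,4,5]),
   ((1,4),83,[1,2,5,3,4,0],53,[3,2,1,4,0,5]), ((4,5),0,[0,1,2,3,4,5],3,[0,2,3,4,5,1]),
   ((1,3),4,[0,1,2,3,4,5],5,[0,1,2,3,4,5]), ((2,4),1,[0,1,2,3,4,5],0,[0,5,2,4,3,1]),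
   ((0,4),4,[0,1,2,3,4,5],0,[0,1,2,3,4,5]), ((3,5),0,[0,1,2,3,4,5],20,[0,1,4,3,5,2]),
   ((4,5),89,[0,2,5,3,4,1],0,[3,0,2,4,5,1]), ((1,3),1,[0,1,2,3,4,5],9,[0,2,1,3,4,5]),
   ((0,4),1,[0,1,2,3,4,5],0,[0,5,2,4,3,1]), ((1,3),92,[0,1,5,3,4,2],0,[0,2,4,3,1,5]),
   ((2,3),2,[0,5,2,3,4,1],7,[0,5,2,3,4,1]), ((2,4),2,[0,1,2,3,4,5],0,[2,5,1,4,3,0]),
   ((2,3),0,[0,5,1,3,4,2],7,[2,0,1,3,4,5]), ((3,5),0,[0,1,2,3,4,5],7,[4,0,1,3,5,2]),
   ((3,5),4,[0,1,2,3,4,5],0,[0,4,2,3,5,1]), ((1,3),1,[0,1,5,3,4,2],7,[1,5,0,3,4,2]),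
   ((0,3),1,[0,1,2,3,4,5],0,[4,5,2,0,3,1]), ((1,4),0,[0,1,5,2,4,3],5,[0,5,2,4,1,3]),
   ((2,4),0,[0,1,2,3,4,5],6,[0,1,3,4,2,5]), ((4,5),0,[0,2,1,3,4,5],5,[0,3,2,4,5,1]),
   ((0,4),0,[0,5,2,3,4,1],4,[3,5,2,4,0,1]), ((0,3),5,[0,5,2,3,4,1],10,[0,5,2,3,4,1]),
   ((3,4),1,[5,2,1,3,4,0],0,[5,2,1,3,4,0])])"

definition certificate_6_3 :: "(nat \<times> nat) list list \<times> resolution list" where
  "certificate_6_3 = ([[(3,0),(0,1),(5,2)]], [
   ((1,2),3,[2,0,1,3,4,5],4,[0,3,1,2,5,4]), ((0,2),2,[0,1,2,3,5,4],5,[1,3,0,2,5,4]),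
   ((1,2),0,[0,1,2,3,4,5],6,[4,2,0,1,5,3]), ((1,4),2,[0,1,2,3,4,5],0,[1,4,2,3,0,5]),
   ((1,5),0,[0,1,2,3,4,5],8,[0,2,1,5,4,3]), ((2,5),1,[3,2,1,0,4,5],0,[0,1,2,3,4,5]),
   ((2,5),8,[0,2,4,5,3,1],10,[3,4,2,5,1,0]), ((1,5),0,[0,1,2,3,4,5],11,[0,4,1,5,3,2]),
   ((1,2),0,[0,1,2,3,4,5],12,[0,3,1,2,5,4]), ((2,4),0,[0,1,2,3,4,5],13,[3,5,2,4,1,0]),
   ((1,4),0,[0,1,2,3,4,5],14,[0,5,1,4,3,2]), ((4,5),5,[0,1,2,3,4,5],0,[0,1,2,3,4,5]),
   ((0,2),0,[0,1,2,3,4,5],16,[1,3,0,2,5,4]), ((4,5),13,[0,1,3,4,5,2],0,[4,5,2,0,1,3]),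
   ((4,5),15,[0,1,2,3,5,4],0,[5,2,4,3,0,1]), ((1,5),1,[0,1,2,3,4,5],2,[1,5,2,0,3,4]),
   ((2,4),13,[0,1,2,3,4,5],20,[1,2,0,4,5,3]), ((4,5),0,[0,1,2,3,4,5],21,[1,5,0,4,3,2]),
   ((1,5),0,[0,1,2,3,4,5],22,[4,5,0,1,3,2]), ((0,4),6,[0,1,2,3,4,5],0,[0,1,2,3,4,5]),
   ((1,4),4,[0,1,2,3,4,5],0,[1,4,2,0,5,3]), ((0,5),0,[3,1,2,0,4,5],8,[0,5,2,3,1,4]),
   ((0,4),0,[0,1,2,3,4,5],2,[0,4,2,3,5,1]), ((1,4),3,[1,0,2,3,5,4],27,[5,4,0,1,3,2]),
   ((0,5),4,[0,1,2,3,4,5],0,[0,1,2,3,4,5]), ((0,1),2,[0,1,2,3,4,5],0,[0,1,2,3,4,5]),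
   ((0,2),27,[0,1,2,3,5,4],30,[2,4,0,1,5,3]), ((0,1),0,[2,3,0,4,1,5],31,[0,2,1,3,5,4]),
   ((2,4),0,[0,1,2,3,4,5],32,[4,1,2,3,5,0]), ((1,4),0,[0,1,2,3,4,5],33,[4,2,1,3,5,0]),
   ((1,5),0,[0,1,2,3,4,5],34,[5,2,1,3,4,0]), ((2,5),0,[0,1,2,3,4,5],35,[5,1,2,3,4,0]),
   ((1,3),6,[0,1,2,3,4,5],0,[0,1,2,3,4,5]), ((0,5),18,[0,1,2,3,4,5],0,[1,4,0,5,2,3]),
   ((1,4),1,[0,2,3,1,4,5],38,[4,2,1,3,5,0]), ((0,1),0,[0,1,2,3,4,5],39,[0,2,1,3,5,4]),
   ((1,5),0,[4,1,2,3,0,5],40,[5,2,1,3,4,0]), ((1,3),5,[0,2,4,3,1,5],0,[5,1,2,3,4,0]),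
   ((3,4),5,[0,1,2,3,4,5],0,[0,1,2,3,4,5]), ((1,5),5,[0,1,2,3,4,5],0,[2,4,5,1,0,3]),
   ((1,2),0,[0,1,2,3,4,5],19,[2,0,1,3,4,5]), ((2,4),0,[0,1,2,3,4,5],8,[0,1,4,2,3,5]),
   ((2,5),0,[0,1,2,3,4,5],3,[0,4,5,2,1,3]), ((0,3),4,[0,4,2,3,1,5],6,[5,0,2,3,4,1]),
   ((0,2),1,[0,1,2,3,4,5],0,[5,4,2,0,1,3]), ((3,4),0,[0,1,2,3,4,5],19,[0,1,4,3,2,5]),
   ((1,3),0,[0,1,2,3,4,5],13,[0,4,1,3,2,5]), ((0,3),0,[0,4,2,3,1,5],8,[2,4,0,3,1,5]),
   ((3,5),0,[4,1,2,3,0,5],4,[4,1,5,3,0,2]), ((3,5),5,[4,1,2,3,0,5],12,[4,2,5,3,1,0]),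
   ((2,3),1,[5,4,2,3,1,0],0,[5,4,2,3,1,0])])"

definition certificate_6_4 :: "(nat \<times> nat) list list \<times> resolution list" where
  "certificate_6_4 = ([[(4,0),(5,1)]], [
   ((4,5),0,[0,1,2,3,4,5],1,[3,4,2,1,5,0]), ((3,5),0,[0,1,2,3,4,5],2,[4,3,2,1,5,0]),
   ((2,5),0,[0,1,2,3,4,5],3,[4,2,3,1,5,0]), ((1,3),0,[0,1,2,3,4,5],4,[5,1,4,2,3,0]),
   ((0,5),0,[0,1,2,3,4,5],5,[4,0,3,2,5,1]), ((0,4),0,[0,1,2,3,4,5],6,[5,0,3,2,4,1]),
   ((2,3),0,[0,1,2,3,4,5],7,[5,2,4,1,3,0]), ((1,4),0,[0,1,2,3,4,5],8,[5,1,3,2,4,0]),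
   ((3,4),0,[0,1,2,3,4,5],9,[5,3,2,1,4,0]), ((2,4),0,[0,1,2,3,4,5],10,[5,2,3,1,4,0]),
   ((0,1),0,[0,1,2,3,4,5],11,[5,0,4,3,1,2]), ((0,3),0,[0,1,2,3,4,5],12,[5,0,4,2,3,1]),
   ((1,5),0,[0,1,2,4,3,5],13,[4,1,3,2,5,0]), ((1,2),0,[0,1,2,5,4,3],14,[5,1,4,3,2,0]),
   ((0,2),0,[0,5,2,4,3,1],15,[5,0,4,3,2,1])])"

definition certificate_7_1 :: "(nat \<times> nat) list list \<times> resolution list" where
  "certificate_7_1 = ([[(6,0),(0,1),(1,2),(2,3),(3,4),(4,5)]], [
   ((0,5),5,[0,4,5,6,1,2,3],6,[1,3,2,6,4,0,5]), ((1,5),0,[0,1,2,3,4,5,6],7,[0,4,6,2,3,1,5]),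
   ((0,1),6,[0,1,4,3,6,2,5],0,[0,1,2,3,4,5,6]), ((0,4),5,[0,5,6,4,3,2,1],0,[5,1,2,3,4,0,6]),
   ((0,1),6,[0,3,5,1,6,4,2],10,[6,2,3,1,5,0,4]), ((1,5),0,[0,1,2,3,4,5,6],11,[0,1,3,2,6,4,5]),
   ((0,4),3,[0,1,2,3,4,5,6],0,[0,1,2,3,4,5,6]), ((4,5),3,[0,1,2,3,4,5,6],0,[0,1,2,3,4,5,6]),
   ((1,4),11,[1,3,4,2,6,5,0],0,[0,1,2,3,4,5,6]), ((1,3),11,[0,1,2,3,6,5,4],0,[1,0,2,3,4,5,6]),
   ((1,3),12,[1,2,5,3,6,4,0],0,[5,0,2,3,4,1,6]), ((1,4),13,[1,5,6,4,3,2,0],5,[0,5,6,4,3,1,2]),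
   ((0,4),14,[0,5,6,4,3,2,1],0,[0,1,2,3,4,5,6]), ((0,5),13,[0,1,5,6,4,3,2],19,[2,6,4,5,1,0,3]),
   ((1,5),0,[0,1,2,3,4,5,6],20,[2,6,4,5,0,1,3]), ((0,1),0,[0,1,2,3,4,5,6],21,[2,6,4,1,5,0,3]),
   ((1,4),10,[0,1,6,4,3,5,2],0,[0,1,2,3,4,5,6]), ((0,4),5,[5,1,2,3,4,0,6],0,[0,1,2,3,4,5,6]),
   ((4,5),5,[0,1,2,3,4,5,6],0,[0,1,2,3,4,5,6]), ((1,3),10,[0,1,2,3,4,5,6],0,[0,1,2,3,4,5,6]),
   ((0,3),10,[0,1,2,3,4,5,6],0,[0,1,2,3,4,5,6]), ((3,5),10,[0,1,2,3,4,5,6],0,[0,1,2,3,4,5,6]),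
   ((3,4),23,[2,3,6,4,5,1,0],0,[0,1,2,3,4,5,6]), ((1,2),25,[1,3,6,2,5,4,0],0,[0,1,2,3,4,5,6]),
   ((0,2),26,[0,3,6,2,5,4,1],0,[0,1,2,3,4,5,6]), ((2,5),27,[3,5,6,2,4,1,0],0,[0,1,2,3,4,5,6]),
   ((0,3),3,[2,4,1,5,0,6,3],32,[6,4,3,1,5,0,2]), ((3,5),27,[1,3,5,6,4,2,0],0,[0,1,2,3,4,5,6]),
   ((0,3),30,[1,3,5,0,6,4,2],0,[3,0,2,1,4,5,6]), ((1,3),1,[0,1,2,3,4,5,6],23,[0,5,4,1,2,3,6]),
   ((0,5),1,[0,1,2,3,4,5,6],0,[5,0,2,3,4,1,6]), ((1,5),1,[0,1,2,3,4,5,6],14,[0,3,6,2,1,5,4]),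
   ((0,1),1,[0,1,2,3,4,5,6],0,[0,1,2,3,4,5,6]), ((4,5),14,[0,1,6,2,5,3,4],0,[0,1,2,3,4,5,6]),
   ((3,4),10,[0,5,4,3,2,1,6],0,[0,1,2,3,4,5,6]), ((1,4),10,[3,5,4,1,2,0,6],0,[0,1,2,3,4,5,6]),
   ((0,4),10,[1,3,4,0,2,5,6],0,[0,1,2,3,4,5,6]), ((0,2),14,[1,3,2,0,4,5,6],0,[0,1,2,3,4,5,6]),
   ((2,5),14,[1,0,2,5,4,3,6],0,[0,1,2,3,4,5,6]), ((1,2),14,[0,5,2,1,4,3,6],0,[0,1,2,3,4,5,6]),
   ((2,3),14,[0,1,2,3,4,5,6],0,[0,1,2,3,4,5,6]), ((2,4),41,[2,4,6,5,3,1,0],0,[0,1,2,3,4,5,6]),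
   ((1,6),44,[1,2,4,6,5,3,0],0,[0,1,2,3,4,5,6]), ((5,6),45,[2,4,5,6,3,1,0],0,[0,1,2,3,4,5,6]),
   ((3,6),46,[2,3,4,6,5,1,0],0,[0,5,2,3,4,1,6]), ((0,2),47,[0,4,6,2,5,3,1],0,[0,5,4,3,6,1,2]),
   ((0,3),4,[2,4,1,5,3,6,0],27,[3,4,6,2,1,5,0]), ((0,4),4,[2,3,1,5,4,6,0],0,[0,1,2,3,4,5,6]),
   ((0,4),4,[2,3,4,6,5,1,0],0,[0,5,2,1,3,4,6]), ((0,4),2,[0,4,2,3,1,5,6],15,[1,4,2,5,0,3,6]),
   ((0,1),2,[0,1,2,3,4,5,6],0,[0,1,2,3,4,5,6]), ((0,5),2,[0,1,2,3,4,5,6],0,[0,1,2,3,4,5,6]),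
   ((0,2),15,[1,3,6,4,0,5,2],0,[0,1,2,3,4,5,6]), ((1,2),10,[3,0,1,4,6,5,2],0,[0,1,2,3,4,5,6]),
   ((2,3),10,[4,1,3,5,6,0,2],0,[0,1,2,3,4,5,6]), ((2,5),10,[4,3,5,1,6,0,2],0,[0,1,2,3,4,5,6]),
   ((2,4),10,[5,3,2,1,4,0,6],0,[0,1,2,3,4,5,6]), ((3,6),15,[0,1,2,4,3,5,6],0,[0,1,2,3,4,5,6]),
   ((1,6),15,[0,3,1,4,2,5,6],0,[0,1,2,3,4,5,6]), ((5,6),15,[0,3,2,4,5,1,6],0,[0,3,2,1,4,5,6]),
   ((4,6),15,[0,5,2,3,4,1,6],0,[0,5,2,3,4,1,6]), ((1,6),15,[5,4,6,3,0,2,1],0,[1,5,0,4,3,2,6]),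
   ((2,3),6,[0,1,3,4,6,5,2],10,[0,1,2,3,4,5,6]), ((2,4),5,[0,1,4,3,5,6,2],0,[0,1,2,3,4,5,6]),
   ((1,2),5,[0,4,1,3,5,6,2],0,[0,1,2,3,4,5,6]), ((0,2),5,[5,4,0,3,6,1,2],0,[0,1,2,3,4,5,6]),
   ((2,5),5,[6,4,5,3,1,0,2],0,[0,1,2,3,4,5,6]), ((4,6),10,[0,1,4,2,3,5,6],0,[0,1,2,3,4,5,6]),
   ((5,6),10,[0,1,5,4,2,3,6],0,[0,1,2,3,4,5,6]), ((3,6),10,[0,5,3,4,1,2,6],0,[0,1,2,3,5,4,6]),
   ((1,6),10,[0,5,1,4,2,3,6],0,[0,1,2,5,4,3,6]), ((2,6),10,[0,5,2,4,3,1,6],0,[0,5,2,4,3,1,6]),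
   ((0,6),10,[0,5,4,3,2,1,6],0,[0,5,4,3,2,1,6])])"

definition certificate_7_2 :: "(nat \<times> nat) list list \<times> resolution list" where
  "certificate_7_2 = ([[(6,0),(5,1),(0,2),(1,3),(3,4)], [(5,0),(0,1),(1,2),(6,3),(3,4)], [(6,0),(5,1),(1,2),(2,3),(3,4)]], [
   ((0,6),4,[3,6,2,5,4,0,1],10,[4,1,2,3,0,5,6]), ((0,3),0,[0,1,2,3,4,5,6],11,[4,1,5,6,0,2,3]),
   ((3,6),4,[2,3,4,5,1,6,0],0,[0,1,2,3,4,5,6]), ((0,2),4,[0,1,3,2,4,6,5],0,[0,1,2,3,4,5,6]),
   ((0,2),2,[3,1,2,0,4,5,6],14,[4,5,6,3,0,1,2]), ((0,6),1,[3,5,6,0,4,1,2],0,[0,1,2,3,4,5,6]),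
   ((2,3),2,[0,1,2,3,4,5,6],0,[0,1,2,3,4,5,6]), ((2,6),8,[2,4,5,1,6,3,0],0,[0,1,2,3,4,5,6]),
   ((1,3),9,[2,3,5,1,4,6,0],0,[0,1,2,3,4,5,6]), ((0,1),10,[0,2,5,1,4,6,3],0,[0,1,2,3,4,5,6]),
   ((0,2),10,[0,2,3,4,6,5,1],20,[4,6,2,3,0,5,1]), ((0,3),0,[0,1,2,3,4,5,6],21,[4,6,3,2,0,5,1]),
   ((2,3),0,[0,1,2,3,4,5,6],22,[4,3,6,5,1,0,2]), ((0,1),7,[3,5,6,2,4,1,0],0,[0,1,2,3,4,5,6]),
   ((1,3),5,[2,1,3,0,4,5,6],0,[0,1,2,3,4,5,6]), ((2,6),8,[0,5,1,3,4,6,2],0,[0,1,2,3,4,5,6]),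
   ((0,6),7,[3,6,0,2,4,5,1],0,[0,1,2,3,4,5,6]), ((3,6),7,[0,6,3,2,4,5,1],0,[0,1,2,3,4,5,6]),
   ((1,2),8,[0,1,2,3,4,5,6],0,[0,1,2,3,4,5,6]), ((1,6),19,[1,4,5,6,3,2,0],0,[0,1,2,3,4,5,6]),
   ((2,5),21,[1,2,6,4,5,3,0],0,[0,1,2,3,4,5,6]), ((0,5),22,[0,1,6,4,5,3,2],0,[0,1,2,3,4,5,6]),
   ((3,5),23,[1,3,6,4,5,2,0],0,[0,1,2,3,4,5,6]), ((3,6),2,[1,0,2,5,4,6,3],33,[4,3,2,6,0,5,1]),
   ((0,3),4,[1,3,2,5,4,0,6],0,[0,1,2,3,4,5,6]), ((0,2),4,[1,2,3,5,4,0,6],0,[0,1,2,3,4,5,6]),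
   ((2,3),1,[3,1,0,6,4,5,2],36,[4,3,6,2,0,5,1]), ((0,3),2,[0,1,6,2,4,5,3],0,[0,1,2,3,4,5,6]),
   ((0,6),2,[0,1,2,3,4,5,6],0,[0,1,2,3,4,5,6]), ((1,6),11,[2,5,0,3,4,1,6],0,[0,1,2,3,4,5,6]),
   ((1,3),9,[0,3,6,2,4,1,5],0,[0,1,2,3,4,5,6]), ((2,5),13,[3,1,0,6,4,5,2],0,[0,1,2,3,4,5,6]),
   ((0,1),10,[3,0,6,2,4,1,5],0,[0,1,2,3,4,5,6]), ((0,5),12,[3,0,2,6,4,5,1],0,[0,1,2,3,4,5,6]),
   ((3,5),12,[0,1,2,6,4,5,3],0,[0,1,2,3,4,5,6]), ((1,2),12,[0,2,3,6,4,1,5],0,[0,1,2,3,4,5,6]),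
   ((5,6),13,[0,1,2,3,4,5,6],0,[0,1,2,3,4,5,6]), ((1,2),5,[5,1,0,3,4,2,6],24,[1,0,3,6,4,2,5]),
   ((2,3),4,[1,3,0,5,4,2,6],0,[0,1,2,3,4,5,6]), ((0,3),5,[2,3,5,1,4,0,6],0,[0,1,2,3,4,5,6]),
   ((2,6),5,[1,2,5,3,4,6,0],0,[0,1,2,3,4,5,6]), ((0,6),6,[2,0,1,3,4,6,5],0,[0,1,2,3,4,5,6]),
   ((0,1),6,[2,1,3,6,4,0,5],0,[0,1,2,3,4,5,6]), ((2,5),7,[1,2,3,6,4,5,0],0,[0,1,2,3,4,5,6]),
   ((5,6),8,[1,6,2,3,4,5,0],0,[0,1,2,3,4,5,6]), ((0,5),9,[2,0,3,6,4,5,1],0,[0,1,2,3,4,5,6]),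
   ((3,5),10,[0,3,2,6,4,5,1],0,[0,1,2,3,4,5,6]), ((1,5),10,[0,1,2,3,4,5,6],0,[0,1,2,3,4,5,6]),
   ((3,5),50,[3,5,1,2,4,6,0],57,[0,2,6,1,5,3,4]), ((1,3),55,[5,3,0,6,1,2,4],0,[0,1,2,3,4,5,6]),
   ((0,5),51,[2,4,5,0,6,3,1],0,[0,1,2,3,4,5,6]), ((0,1),52,[1,2,4,0,6,5,3],0,[0,1,2,3,4,5,6]),
   ((2,5),55,[0,5,1,2,4,6,3],0,[0,1,2,3,4,5,6]), ((2,3),54,[0,3,6,2,4,5,1],0,[0,1,2,3,4,5,6]),
   ((3,5),55,[1,3,6,4,5,2,0],63,[0,2,6,1,5,3,4]), ((3,5),56,[2,3,6,4,5,1,0],0,[3,2,1,0,4,5,6]),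
   ((0,1),5,[0,2,1,3,4,5,6],0,[0,1,2,3,4,5,6]), ((2,3),60,[3,5,1,2,4,6,0],0,[0,1,2,3,4,5,6]),
   ((1,5),59,[4,5,6,1,2,3,0],0,[0,1,2,3,4,5,6]), ((0,5),61,[0,5,1,2,4,6,3],10,[0,1,2,3,4,5,6]),
   ((0,1),7,[0,2,1,3,4,5,6],0,[0,1,2,3,4,5,6]), ((2,3),10,[3,1,2,0,4,5,6],0,[0,1,2,3,4,5,6]),
   ((2,5),3,[0,1,2,3,4,5,6],0,[0,1,2,3,4,5,6]), ((1,3),9,[3,2,1,0,4,5,6],0,[0,1,2,3,4,5,6]),
   ((0,2),10,[0,1,2,3,4,5,6],0,[0,1,2,3,4,5,6]), ((3,5),67,[3,5,2,4,0,6,1],74,[0,2,6,1,5,3,4]),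
   ((1,5),0,[2,0,6,3,4,5,1],61,[5,1,0,3,4,6,2]), ((0,3),69,[1,6,3,4,0,2,5],0,[0,1,2,3,4,5,6]),
   ((3,5),65,[0,2,3,5,4,6,1],77,[2,6,1,0,5,3,4]), ((0,3),2,[0,3,6,1,4,5,2],0,[0,1,2,3,4,5,6]),
   ((0,1),2,[0,1,2,3,4,5,6],0,[0,1,2,3,4,5,6]), ((2,5),20,[1,3,6,0,4,5,2],0,[0,1,2,3,4,5,6]),
   ((1,3),73,[3,4,6,1,2,5,0],0,[0,1,2,3,4,5,6]), ((0,2),74,[0,3,6,2,4,5,1],0,[0,1,2,3,4,5,6]),
   ((1,5),75,[4,5,6,1,2,3,0],68,[3,6,1,0,4,2,5]), ((1,5),69,[3,6,2,0,4,1,5],84,[6,2,3,0,5,1,4]),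
   ((2,5),1,[0,1,2,3,4,5,6],0,[0,1,2,3,4,5,6]), ((0,1),5,[3,2,1,0,4,5,6],0,[0,1,2,3,4,5,6]),
   ((1,3),4,[0,2,1,3,4,5,6],0,[0,1,2,3,4,5,6]), ((0,2),6,[3,1,2,0,4,5,6],0,[0,1,2,3,4,5,6]),
   ((2,3),6,[0,1,2,3,4,5,6],0,[0,1,2,3,4,5,6]), ((5,6),16,[0,1,2,3,4,5,6],0,[0,1,2,3,4,5,6]),
   ((1,2),82,[1,2,4,6,5,3,0],0,[0,1,2,3,4,5,6]), ((3,6),84,[1,2,3,4,6,5,0],0,[0,1,2,3,4,5,6]),
   ((0,6),85,[0,1,2,4,6,5,3],0,[0,1,2,3,4,5,6]), ((0,2),2,[1,0,3,6,4,5,2],94,[3,2,6,1,5,0,4]),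
   ((2,3),0,[0,1,2,3,4,5,6],95,[0,3,6,1,5,2,4]), ((0,5),88,[0,1,6,4,5,3,2],0,[0,1,2,3,4,5,6]),
   ((3,5),89,[1,3,6,4,5,2,0],0,[0,1,2,3,4,5,6]), ((2,5),90,[1,2,6,4,5,3,0],0,[0,1,2,3,4,5,6]),
   ((3,5),91,[2,3,6,4,5,1,0],100,[4,6,5,2,0,1,3]), ((0,5),92,[0,2,6,4,5,3,1],0,[0,1,2,3,4,5,6]),
   ((2,3),94,[5,6,0,3,2,4,1],0,[0,1,2,3,4,5,6]), ((0,5),2,[2,1,0,3,4,5,6],102,[2,1,6,3,5,0,4]),
   ((2,3),17,[1,0,3,6,4,5,2],0,[0,1,2,3,4,5,6]), ((2,5),2,[0,1,2,3,4,5,6],0,[0,1,2,3,4,5,6]),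
   ((0,3),13,[1,2,3,6,4,5,0],0,[0,1,2,3,4,5,6]), ((0,3),1,[0,1,3,2,4,5,6],41,[2,1,0,3,4,5,6]),
   ((2,3),5,[2,1,3,0,4,5,6],108,[4,6,5,3,0,1,2]), ((2,5),100,[2,3,6,4,5,1,0],0,[0,1,2,3,4,5,6]),
   ((3,5),0,[0,1,2,3,4,5,6],110,[4,5,2,3,0,6,1]), ((0,5),3,[0,1,2,3,4,5,6],0,[0,1,2,3,4,5,6]),
   ((0,2),5,[0,1,2,3,4,5,6],0,[0,1,2,3,4,5,6]), ((1,5),13,[0,1,2,3,4,5,6],0,[0,1,2,3,4,5,6]),
   ((2,5),0,[1,0,3,6,4,5,2],113,[6,2,0,3,5,1,4]), ((2,3),23,[1,0,3,6,4,5,2],0,[0,1,2,3,4,5,6]),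
   ((0,3),23,[1,2,3,6,4,5,0],0,[0,1,2,3,4,5,6]), ((2,3),1,[2,1,3,0,4,5,6],2,[0,1,3,2,4,5,6]),
   ((0,2),1,[0,1,2,3,4,5,6],0,[0,1,2,3,4,5,6]), ((1,5),6,[0,6,2,3,4,5,1],0,[0,1,2,3,4,5,6]),
   ((5,6),6,[0,1,2,3,4,5,6],0,[0,1,2,3,4,5,6]), ((0,6),29,[2,0,1,3,4,5,6],0,[0,1,2,3,4,5,6]),
   ((3,6),28,[2,1,3,0,4,5,6],0,[0,1,2,3,4,5,6]), ((1,2),31,[0,2,6,3,4,5,1],0,[0,1,2,3,4,5,6]),
   ((0,1),30,[3,0,6,2,4,5,1],0,[0,1,2,3,4,5,6]), ((1,3),30,[0,3,6,2,4,5,1],0,[0,1,2,3,4,5,6]),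
   ((2,6),31,[0,1,2,3,4,5,6],0,[0,1,2,3,4,5,6]), ((0,2),3,[1,0,6,3,4,5,2],6,[0,1,3,6,4,5,2]),
   ((0,3),3,[6,0,2,1,4,5,3],0,[0,1,2,3,4,5,6]), ((1,3),5,[0,1,2,6,4,5,3],0,[0,1,2,3,4,5,6]),
   ((2,3),4,[0,3,6,1,4,5,2],0,[0,1,2,3,4,5,6]), ((0,1),5,[2,0,6,3,4,5,1],0,[0,1,2,3,4,5,6]),
   ((2,6),6,[0,2,1,3,4,5,6],0,[0,1,2,3,4,5,6]), ((1,6),6,[0,1,2,3,4,5,6],0,[0,1,2,3,4,5,6]),
   ((4,5),76,[0,1,2,3,4,5,6],0,[0,1,2,3,4,5,6]), ((3,5),132,[3,5,2,0,4,6,1],133,[6,1,4,2,3,0,5]),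
   ((0,3),127,[1,3,6,0,4,5,2],0,[0,1,2,3,4,5,6]), ((2,5),128,[1,4,5,2,6,3,0],0,[0,1,2,3,4,5,6]),
   ((1,3),130,[2,6,3,4,0,1,5],62,[0,1,2,3,4,5,6]), ((0,5),0,[0,2,6,5,1,3,4],137,[2,4,1,6,0,3,5]),
   ((0,3),131,[1,3,6,0,4,5,2],0,[0,1,2,3,4,5,6]), ((5,6),3,[0,1,2,3,4,5,6],0,[0,1,2,3,4,5,6]),
   ((0,2),133,[1,2,6,0,4,5,3],0,[0,1,2,3,4,5,6]), ((3,6),136,[2,0,3,1,4,6,5],0,[0,1,2,3,4,5,6]),
   ((3,5),4,[5,2,1,6,4,0,3],142,[2,1,4,6,3,0,5]), ((0,3),137,[0,3,2,6,1,4,5],0,[3,4,2,0,1,5,6]),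
   ((5,6),137,[1,4,5,2,6,3,0],0,[0,1,2,3,4,5,6]), ((3,5),142,[5,0,3,2,6,1,4],145,[6,1,4,2,3,0,5]),
   ((0,5),0,[0,1,2,3,4,5,6],146,[6,4,1,2,0,3,5]), ((0,3),141,[0,3,2,6,1,4,5],0,[0,1,2,3,4,5,6]),
   ((2,5),3,[0,1,2,3,4,5,6],0,[0,1,2,3,4,5,6]), ((2,3),9,[3,4,6,0,1,5,2],0,[0,1,2,3,4,5,6]),
   ((0,2),8,[0,1,6,3,4,5,2],0,[0,1,2,3,4,5,6]), ((3,6),10,[3,4,2,0,1,5,6],0,[0,1,2,3,4,5,6]),
   ((0,6),10,[0,1,2,3,4,5,6],0,[0,1,2,3,4,5,6]), ((1,5),80,[0,2,6,5,1,3,4],0,[0,1,2,3,4,5,6]),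
   ((2,5),148,[2,5,4,6,1,3,0],80,[1,5,6,2,4,0,3]), ((0,2),149,[2,0,4,6,1,3,5],142,[5,3,0,2,4,6,1]),
   ((3,5),1,[0,1,2,3,4,5,6],0,[0,1,2,3,4,5,6]), ((0,2),144,[5,2,0,3,4,1,6],157,[4,6,3,5,0,1,2]),
   ((2,5),84,[6,0,1,3,4,5,2],0,[0,1,2,3,4,5,6]), ((0,3),2,[0,1,2,3,4,5,6],0,[0,1,2,3,4,5,6]),
   ((5,6),21,[2,4,3,5,6,0,1],0,[0,1,2,3,4,5,6]), ((0,6),7,[0,6,1,2,4,5,3],0,[0,1,2,3,4,5,6]),
   ((2,3),155,[2,4,6,1,3,5,0],0,[0,1,2,3,4,5,6]), ((3,5),156,[0,4,5,2,3,6,1],164,[0,3,4,1,6,5,2]),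
   ((0,3),0,[0,1,2,3,4,5,6],165,[5,3,4,1,6,0,2]), ((0,6),158,[0,1,4,2,6,5,3],0,[0,1,2,3,4,5,6]),
   ((5,6),159,[1,4,5,2,6,3,0],0,[0,1,2,3,4,5,6]), ((0,5),161,[5,6,2,3,0,4,1],158,[3,1,2,0,4,6,5]),
   ((0,3),0,[0,1,2,3,4,5,6],94,[2,3,1,0,4,5,6]), ((5,6),0,[0,1,2,3,4,5,6],169,[4,2,3,0,5,1,6]),
   ((0,6),163,[0,1,4,2,6,5,3],0,[0,1,2,3,4,5,6]), ((2,5),4,[0,1,2,3,4,5,6],0,[0,1,2,3,4,5,6]),
   ((0,6),2,[0,1,6,3,4,5,2],172,[4,2,3,5,0,1,6]), ((5,6),1,[5,1,6,3,4,0,2],0,[0,1,2,3,4,5,6]),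
   ((0,2),2,[0,1,2,3,4,5,6],0,[0,1,2,3,4,5,6]), ((2,3),13,[0,1,6,3,4,5,2],0,[0,1,2,3,4,5,6]),
   ((3,6),13,[0,1,2,3,4,5,6],0,[0,1,2,3,4,5,6]), ((1,5),24,[5,1,2,3,4,0,6],0,[0,1,2,3,4,5,6]),
   ((0,1),24,[0,1,2,3,4,5,6],0,[0,1,2,3,4,5,6]), ((2,6),171,[1,2,4,6,5,3,0],0,[0,1,2,3,4,5,6]),
   ((1,3),173,[2,3,6,1,4,5,0],0,[0,1,2,3,4,5,6]), ((3,6),179,[6,2,0,3,4,5,1],107,[5,2,3,0,1,6,4]),
   ((0,3),175,[0,4,5,1,3,6,2],0,[0,1,2,3,4,5,6]), ((0,6),179,[0,5,6,3,2,1,4],184,[3,5,1,2,0,6,4]),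
   ((0,3),177,[0,4,5,1,3,6,2],0,[0,1,2,3,4,5,6]), ((0,5),2,[0,1,2,3,4,5,6],0,[0,1,2,3,4,5,6]),
   ((5,6),179,[1,3,6,4,5,2,0],0,[0,1,2,3,4,5,6]), ((5,6),5,[3,4,2,5,1,6,0],187,[4,2,1,5,0,6,3]),
   ((0,3),6,[6,4,2,0,1,3,5],0,[0,1,2,3,4,5,6]), ((0,6),2,[5,1,2,6,4,0,3],0,[0,1,2,3,4,5,6]),
   ((0,3),5,[6,4,2,0,1,3,5],25,[0,2,1,6,4,5,3]), ((3,6),1,[0,1,2,3,4,5,6],0,[0,1,2,3,4,5,6]),
   ((3,5),5,[0,1,2,3,4,5,6],0,[0,1,2,3,4,5,6]), ((0,2),17,[3,2,0,5,1,6,4],0,[0,1,2,3,4,5,6]),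
   ((2,5),13,[3,2,4,0,1,6,5],0,[0,1,2,3,4,5,6]), ((0,5),40,[3,0,5,4,2,6,1],195,[6,4,2,1,0,3,5]),
   ((0,3),189,[1,2,3,0,4,6,5],0,[0,1,2,3,4,5,6]), ((0,6),190,[1,2,6,0,4,5,3],0,[0,1,2,3,4,5,6]),
   ((2,5),22,[3,1,0,5,2,6,4],0,[0,1,2,3,4,5,6]), ((0,6),192,[1,3,6,0,4,5,2],188,[6,1,2,5,4,0,3]),
   ((0,5),194,[3,4,1,5,0,2,6],0,[0,1,2,3,4,5,6]), ((3,5),0,[5,2,1,3,4,0,6],201,[4,2,1,5,0,6,3]),
   ((0,6),1,[0,1,2,6,4,5,3],0,[0,1,2,3,4,5,6]), ((5,6),2,[5,2,1,6,4,0,3],0,[0,1,2,3,4,5,6]),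
   ((0,3),3,[0,1,2,3,4,5,6],0,[0,1,2,3,4,5,6]), ((0,5),203,[5,2,6,0,1,3,4],206,[1,0,3,6,5,2,4]),
   ((0,6),199,[1,3,6,0,4,5,2],0,[0,1,2,3,4,5,6]), ((3,5),133,[3,6,2,5,4,0,1],207,[6,1,4,2,3,0,5]),
   ((3,5),0,[1,4,3,5,6,0,2],210,[4,5,0,1,2,6,3]), ((5,6),0,[0,1,2,3,4,5,6],211,[4,5,0,1,2,3,6]),
   ((0,6),4,[0,1,2,6,4,5,3],0,[0,1,2,3,4,5,6]), ((0,3),4,[0,1,2,3,4,5,6],0,[0,1,2,3,4,5,6]),
   ((0,5),155,[2,6,1,3,4,5,0],213,[1,0,6,3,5,2,4]), ((0,3),206,[1,3,6,0,4,5,2],0,[0,1,2,3,4,5,6]),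
   ((0,3),1,[0,1,2,6,4,5,3],4,[0,1,2,3,4,5,6]), ((0,6),1,[0,1,2,3,4,5,6],0,[0,1,2,3,4,5,6]),
   ((3,6),4,[0,1,2,3,4,5,6],0,[0,1,2,3,4,5,6]), ((2,5),12,[0,1,2,3,4,5,6],0,[0,1,2,3,4,5,6]),
   ((0,2),19,[0,1,2,3,4,5,6],0,[0,1,2,3,4,5,6]), ((1,5),24,[0,1,2,3,4,5,6],0,[0,1,2,3,4,5,6]),
   ((3,5),55,[0,2,3,6,4,5,1],220,[6,3,4,2,1,0,5]), ((0,3),0,[0,1,2,3,4,5,6],221,[4,3,6,5,0,2,1]),
   ((1,5),5,[5,1,2,3,4,0,6],0,[0,1,2,6,4,5,3]), ((0,2),5,[0,2,1,3,4,5,6],0,[0,1,2,3,4,5,6]),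
   ((2,5),4,[5,2,1,3,4,0,6],0,[0,1,2,3,4,5,6]), ((0,1),5,[0,1,2,3,4,5,6],0,[0,1,2,3,4,5,6]),
   ((2,6),47,[0,2,1,3,4,5,6],0,[0,1,2,3,4,5,6]), ((2,3),46,[0,2,1,6,4,5,3],0,[0,1,2,3,4,5,6]),
   ((1,3),48,[0,1,2,6,4,5,3],0,[0,1,2,3,4,5,6]), ((1,6),48,[0,1,2,3,4,5,6],0,[0,1,2,3,4,5,6]),
   ((1,5),223,[1,2,3,4,5,6,0],162,[6,2,3,1,4,0,5]), ((5,6),224,[2,3,6,4,5,1,0],0,[0,1,2,3,4,5,6]),
   ((0,3),225,[0,4,5,2,3,6,1],0,[0,1,2,3,4,5,6]), ((0,3),226,[0,4,5,2,3,6,1],66,[1,3,4,0,2,6,5]),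
   ((0,5),1,[0,1,2,3,4,5,6],0,[0,1,2,3,4,5,6]), ((1,5),21,[5,1,3,6,4,0,2],70,[0,3,2,6,4,5,1]),
   ((0,3),1,[5,1,2,3,4,0,6],0,[0,1,2,3,4,5,6]), ((0,1),2,[5,3,2,1,4,0,6],0,[0,1,2,3,4,5,6]),
   ((3,5),3,[0,1,2,3,4,5,6],0,[0,1,2,3,4,5,6]), ((0,1),74,[3,2,4,0,1,6,5],239,[2,4,6,3,0,1,5]),
   ((0,5),172,[6,1,2,3,4,0,5],0,[0,1,2,3,4,5,6]), ((3,5),234,[1,2,3,4,5,6,0],0,[0,1,2,3,4,5,6]),
   ((5,6),235,[1,2,6,4,5,3,0],0,[0,1,2,3,4,5,6]), ((0,3),237,[5,2,1,3,0,4,6],34,[5,2,3,6,4,0,1]),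
   ((0,5),0,[0,1,2,3,4,5,6],79,[3,2,4,0,1,6,5]), ((0,1),0,[0,1,2,3,4,5,6],35,[5,2,1,3,4,0,6]),
   ((5,6),5,[0,6,2,1,4,5,3],0,[0,1,2,3,4,5,6]), ((3,5),5,[0,3,2,6,4,5,1],0,[0,1,2,3,4,5,6]),
   ((1,5),5,[0,1,2,3,4,5,6],0,[0,1,2,3,4,5,6]), ((0,2),10,[0,1,2,3,4,5,6],0,[0,1,2,3,4,5,6]),
   ((5,6),35,[5,6,3,1,4,0,2],250,[1,2,4,6,3,0,5]), ((0,3),3,[5,6,3,1,4,0,2],0,[0,1,2,3,4,5,6]),
   ((3,5),2,[0,1,3,2,4,5,6],0,[0,1,2,3,4,5,6]), ((0,6),3,[5,1,6,2,4,0,3],0,[0,1,2,3,4,5,6]),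
   ((2,5),4,[0,1,2,3,4,5,6],0,[0,1,2,3,4,5,6]), ((1,6),29,[0,1,6,2,4,5,3],0,[0,1,2,3,4,5,6]),
   ((3,6),29,[0,3,6,2,4,5,1],0,[0,1,2,3,4,5,6]), ((1,3),28,[0,1,3,6,4,5,2],0,[0,1,2,3,4,5,6]),
   ((2,3),30,[0,2,3,1,4,5,6],0,[0,1,2,3,4,5,6]), ((2,6),30,[0,2,6,3,4,5,1],0,[0,1,2,3,4,5,6]),
   ((1,2),30,[0,1,2,3,4,5,6],0,[0,1,2,3,4,5,6]), ((4,5),129,[1,2,3,5,4,0,6],0,[0,1,2,3,4,5,6]),
   ((0,4),129,[0,1,2,3,4,5,6],0,[0,1,2,3,4,5,6]), ((0,1),260,[1,5,0,4,6,2,3],263,[2,4,6,3,0,5,1]),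
   ((1,5),0,[0,1,2,3,4,5,6],264,[6,4,3,1,0,2,5]), ((0,5),259,[5,0,4,6,2,3,1],0,[0,1,2,3,4,5,6]),
   ((1,2),111,[1,3,0,2,6,5,4],0,[0,1,2,3,4,5,6]), ((1,2),1,[0,5,2,3,4,1,6],267,[6,3,5,0,1,4,2]),
   ((2,5),1,[0,1,2,3,4,5,6],0,[0,1,2,3,4,5,6]), ((0,2),262,[0,4,6,2,3,5,1],0,[0,1,2,3,4,5,6]),
   ((3,5),72,[2,4,6,0,3,1,5],0,[0,1,2,3,4,5,6]), ((1,3),9,[2,0,1,4,3,5,6],0,[0,1,2,3,4,5,6]),
   ((0,2),4,[0,1,3,2,4,5,6],272,[6,3,5,1,0,4,2]), ((3,5),2,[5,0,2,3,4,1,6],0,[0,1,2,3,4,5,6]),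
   ((1,2),3,[1,5,3,2,4,0,6],0,[0,1,2,3,4,5,6]), ((2,5),3,[5,0,3,2,4,1,6],0,[0,1,2,3,4,5,6]),
   ((0,3),4,[0,1,2,3,4,5,6],0,[0,1,2,3,4,5,6]), ((5,6),100,[0,4,2,5,6,1,3],0,[0,1,2,3,4,5,6]),
   ((0,6),16,[1,0,2,3,6,5,4],0,[0,1,2,3,4,5,6]), ((1,6),16,[5,1,2,3,6,0,4],0,[0,1,2,3,4,5,6]),
   ((2,3),272,[2,3,4,6,5,1,0],0,[0,1,2,3,4,5,6]), ((1,5),135,[4,2,0,1,5,3,6],268,[1,4,3,0,2,6,5]),
   ((0,3),276,[3,4,2,5,0,6,1],0,[0,1,2,3,4,5,6]), ((3,5),277,[4,3,0,6,2,5,1],0,[0,1,2,3,4,5,6]),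
   ((1,5),280,[0,3,2,4,5,1,6],284,[4,2,3,0,1,6,5]), ((1,3),0,[0,1,2,3,4,5,6],285,[6,2,5,0,1,4,3]),
   ((0,1),0,[0,1,2,3,4,5,6],286,[5,4,6,2,0,3,1]), ((0,3),5,[3,1,4,5,6,0,2],0,[3,1,4,5,6,0,2]),
   ((3,5),5,[3,1,4,0,2,5,6],0,[0,1,2,3,4,5,6]), ((0,5),5,[5,1,6,3,4,0,2],0,[0,1,2,3,4,5,6]),
   ((1,2),85,[3,4,6,0,2,5,1],0,[0,1,2,3,4,5,6]), ((1,5),285,[4,6,0,1,3,5,2],291,[4,5,3,0,1,6,2]),
   ((0,5),0,[0,1,2,3,4,5,6],292,[4,5,3,1,0,6,2]), ((0,3),0,[0,1,2,3,4,5,6],293,[6,3,5,1,0,4,2]),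
   ((1,3),0,[0,1,2,3,4,5,6],294,[6,3,5,0,1,4,2]), ((1,2),5,[1,0,2,3,4,5,6],0,[0,1,2,3,4,5,6]),
   ((0,2),5,[0,1,2,3,4,5,6],0,[0,1,2,3,4,5,6]), ((2,5),18,[0,3,4,5,6,1,2],0,[0,1,2,3,4,5,6]),
   ((1,6),70,[0,4,2,1,6,3,5],0,[0,1,2,3,4,5,6]), ((0,6),37,[3,0,2,4,6,1,5],0,[0,1,2,3,4,5,6]),
   ((1,3),42,[2,0,4,1,3,6,5],300,[6,3,5,0,1,4,2]), ((0,3),0,[0,1,2,3,4,5,6],301,[6,3,5,1,0,4,2]),
   ((3,5),0,[0,1,2,3,4,5,6],302,[1,3,6,4,2,0,5]), ((2,5),8,[0,1,6,5,2,3,4],0,[0,1,2,3,4,5,6]),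
   ((0,2),5,[1,5,6,3,4,0,2],0,[0,1,2,3,4,5,6]), ((1,6),8,[0,5,2,3,4,1,6],0,[0,1,2,3,4,5,6]),
   ((0,6),7,[5,1,2,3,4,0,6],0,[0,1,2,3,4,5,6]), ((1,2),7,[0,5,6,3,4,1,2],0,[0,1,2,3,4,5,6]),
   ((5,6),8,[0,1,2,3,4,5,6],0,[0,1,2,3,4,5,6]), ((2,3),29,[0,1,3,6,4,5,2],0,[0,1,2,3,4,5,6]),
   ((3,6),29,[0,1,2,3,4,5,6],0,[0,1,2,3,4,5,6]), ((1,5),14,[0,6,5,3,1,4,2],163,[5,2,1,0,3,6,4]),
   ((1,5),164,[5,1,2,6,4,0,3],312,[0,4,3,2,1,6,5]), ((2,5),1,[0,1,2,3,4,5,6],0,[0,1,2,3,4,5,6]),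
   ((1,6),307,[2,3,6,1,4,5,0],0,[0,1,2,3,4,5,6]), ((0,1),15,[5,6,0,4,3,2,1],0,[0,1,2,3,4,5,6]),
   ((0,2),309,[0,1,4,2,3,6,5],0,[0,1,2,3,4,5,6]), ((1,5),311,[4,6,0,1,3,5,2],108,[0,3,1,2,4,5,6]),
   ((5,6),0,[0,1,2,3,4,5,6],109,[2,4,6,1,3,5,0]), ((0,5),0,[0,1,2,3,4,5,6],109,[1,3,0,2,4,5,6]),
   ((0,1),13,[5,2,0,4,3,6,1],0,[0,1,2,3,4,5,6]), ((1,6),5,[0,1,6,3,4,5,2],0,[0,1,2,3,4,5,6]),
   ((0,2),6,[1,0,2,3,4,5,6],0,[0,1,2,3,4,5,6]), ((0,6),6,[1,0,6,3,4,5,2],0,[0,1,2,3,4,5,6]),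
   ((1,2),7,[0,1,2,3,4,5,6],0,[0,1,2,3,4,5,6]), ((3,5),67,[2,0,4,1,3,6,5],0,[0,1,2,3,4,5,6]),
   ((5,6),10,[5,0,3,6,4,1,2],57,[2,1,0,4,3,5,6]), ((1,6),1,[0,1,2,6,4,5,3],0,[0,1,2,3,4,5,6]),
   ((0,2),321,[2,3,6,0,4,5,1],0,[0,1,2,3,4,5,6]), ((1,5),145,[6,4,2,0,1,3,5],316,[5,4,6,0,3,2,1]),
   ((0,1),0,[0,1,2,3,4,5,6],43,[0,5,3,1,2,6,4]), ((1,6),4,[1,0,3,2,4,5,6],0,[0,1,2,3,4,5,6]),
   ((2,5),8,[5,1,3,2,4,0,6],0,[0,1,2,3,4,5,6]), ((2,5),1,[0,5,2,3,4,1,6],38,[1,5,2,0,3,6,4]),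
   ((1,2),1,[0,1,2,3,4,5,6],0,[0,1,2,3,4,5,6]), ((0,2),7,[0,1,6,3,4,5,2],0,[0,1,2,3,4,5,6]),
   ((0,6),7,[0,1,2,3,4,5,6],0,[0,1,2,3,4,5,6]), ((3,5),12,[0,5,2,3,4,1,6],0,[0,1,2,3,4,5,6]),
   ((1,3),12,[0,1,2,3,4,5,6],0,[0,1,2,3,4,5,6]), ((1,6),1,[1,5,2,6,4,0,3],35,[1,5,6,2,4,0,3]),
   ((5,6),1,[5,0,2,6,4,1,3],0,[0,1,2,3,4,5,6]), ((3,5),4,[5,0,2,3,4,1,6],0,[0,1,2,3,4,5,6]),
   ((1,3),4,[1,0,2,3,4,5,6],0,[0,1,2,3,4,5,6]), ((0,3),4,[0,1,2,3,4,5,6],0,[0,1,2,3,4,5,6]),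
   ((2,3),35,[0,1,2,6,4,5,3],0,[0,1,2,3,4,5,6]), ((3,6),35,[0,1,3,2,4,5,6],0,[0,1,2,3,4,5,6]),
   ((2,6),35,[0,1,2,3,4,5,6],0,[0,1,2,3,4,5,6]), ((4,5),86,[0,2,3,5,4,1,6],0,[0,1,2,3,4,5,6]),
   ((0,4),86,[1,0,2,3,4,5,6],0,[0,1,2,3,4,5,6]), ((1,4),86,[5,1,2,3,4,0,6],0,[5,1,2,3,4,0,6]),
   ((1,2),3,[3,4,0,1,2,6,5],350,[6,2,5,0,1,4,3]), ((0,2),0,[0,1,2,3,4,5,6],351,[6,2,5,1,0,4,3]),
   ((2,5),0,[0,1,2,3,4,5,6],352,[6,5,1,0,2,4,3]), ((1,6),50,[0,2,3,1,6,5,4],0,[0,1,2,3,4,5,6]),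
   ((0,3),50,[2,5,6,0,3,1,4],0,[0,1,2,3,4,5,6]), ((2,6),7,[0,5,2,3,6,1,4],0,[0,1,2,3,4,5,6]),
   ((3,5),8,[1,2,4,5,3,0,6],0,[0,1,2,3,4,5,6]), ((1,3),8,[5,2,1,4,3,0,6],0,[0,1,2,3,4,5,6]),
   ((0,6),9,[2,5,0,3,6,1,4],0,[0,1,2,3,4,5,6]), ((2,3),9,[5,1,2,4,3,0,6],0,[0,1,2,3,4,5,6]),
   ((5,6),10,[2,1,3,4,6,0,5],0,[0,1,2,3,4,5,6]), ((2,3),139,[0,4,6,1,3,5,2],361,[6,1,5,0,2,3,4]),
   ((3,5),14,[0,6,1,4,3,2,5],0,[0,1,2,3,4,5,6]), ((0,3),14,[5,6,0,1,3,2,4],0,[0,1,2,3,4,5,6]),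
   ((1,2),15,[5,4,2,3,1,0,6],0,[0,1,2,3,4,5,6]), ((2,3),20,[1,5,0,2,3,6,4],365,[3,1,0,5,2,6,4]),
   ((0,3),0,[0,1,2,3,4,5,6],366,[3,1,2,5,0,6,4]), ((3,5),65,[0,2,6,3,4,5,1],0,[0,1,2,3,4,5,6]),
   ((0,1),23,[2,3,0,5,1,4,6],0,[0,4,2,5,1,3,6]), ((1,2),21,[3,4,2,5,1,0,6],0,[0,1,2,3,4,5,6]),
   ((0,1),1,[2,1,5,3,4,0,6],2,[0,1,5,3,4,2,6]), ((1,5),1,[0,1,2,3,4,5,6],0,[0,1,2,3,4,5,6]),
   ((1,3),7,[0,1,2,3,4,5,6],0,[0,1,2,3,4,5,6]), ((5,6),28,[0,2,1,5,6,3,4],0,[0,1,2,3,4,5,6]),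
   ((0,6),26,[2,3,0,1,6,5,4],0,[0,1,2,3,4,5,6]), ((2,6),26,[5,3,1,2,6,0,4],0,[0,1,2,3,4,5,6]),
   ((2,3),2,[0,2,5,6,4,1,3],23,[0,2,5,4,6,1,3]), ((0,3),2,[1,0,5,6,4,2,3],0,[0,1,2,3,4,5,6]),
   ((5,6),6,[0,5,1,3,4,2,6],0,[0,1,2,3,4,5,6]), ((0,6),5,[1,0,2,3,4,5,6],0,[0,1,2,3,4,5,6]),
   ((2,6),5,[0,2,1,3,4,5,6],0,[0,1,2,3,4,5,6]), ((3,5),5,[0,5,1,6,4,2,3],0,[0,1,2,3,4,5,6]),
   ((1,6),6,[0,1,2,3,4,5,6],0,[0,1,2,3,4,5,6]), ((3,6),22,[0,1,2,3,4,5,6],0,[0,1,2,3,4,5,6]),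
   ((0,4),37,[1,2,0,3,4,5,6],0,[0,1,2,3,4,5,6]), ((4,5),37,[1,2,3,5,4,0,6],0,[0,1,2,3,4,5,6]),
   ((1,4),37,[5,2,1,3,4,0,6],0,[5,1,2,3,4,0,6]), ((2,4),37,[5,1,2,3,4,0,6],0,[5,1,2,3,4,0,6]),
   ((1,5),3,[2,0,4,3,1,6,5],26,[0,3,2,1,4,5,6]), ((0,1),3,[5,4,6,0,1,2,3],0,[0,1,2,3,4,5,6]),
   ((2,3),4,[5,4,6,1,3,0,2],0,[0,1,2,3,4,5,6]), ((3,5),1,[1,5,0,3,4,2,6],38,[0,1,5,4,6,2,3]),
   ((0,3),2,[2,0,1,3,4,5,6],0,[0,1,2,3,4,5,6]), ((1,3),2,[0,1,2,3,4,5,6],0,[0,1,2,3,4,5,6]),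
   ((0,4),12,[2,1,3,0,4,5,6],0,[0,1,2,3,4,5,6]), ((1,6),13,[0,2,3,1,6,5,4],0,[0,1,2,3,4,5,6]),
   ((4,5),11,[0,1,2,5,4,3,6],0,[0,1,2,3,4,5,6]), ((2,4),11,[5,1,3,2,4,0,6],0,[0,1,2,3,4,5,6]),
   ((3,6),13,[1,0,2,3,6,5,4],0,[0,1,2,3,4,5,6]), ((2,6),13,[3,0,5,2,6,1,4],0,[0,1,2,3,4,5,6]),
   ((1,4),13,[5,2,3,1,4,0,6],0,[0,1,2,3,4,5,6]), ((5,6),14,[3,2,0,4,6,1,5],0,[0,2,1,3,4,5,6]),
   ((0,6),14,[5,3,2,0,6,1,4],0,[0,5,2,3,4,1,6]), ((3,4),15,[5,2,1,3,4,0,6],0,[5,2,1,3,4,0,6]),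
   ((0,3),5,[2,1,4,6,0,5,3],404,[5,2,1,6,3,0,4]), ((5,6),5,[0,2,1,3,5,4,6],0,[0,1,3,2,4,5,6]),
   ((2,5),4,[3,6,1,4,2,0,5],0,[0,1,2,3,4,5,6]), ((2,3),5,[5,6,1,4,2,0,3],0,[0,1,2,3,4,5,6]),
   ((0,6),6,[4,5,3,1,0,2,6],0,[0,1,2,3,4,5,6]), ((1,4),8,[2,6,5,0,1,3,4],0,[0,1,2,3,4,5,6]),
   ((2,4),7,[6,5,1,3,4,0,2],0,[0,1,2,3,4,5,6]), ((3,5),8,[6,2,1,4,3,0,5],0,[0,1,2,3,4,5,6]),
   ((0,1),8,[6,5,4,3,0,2,1],0,[0,1,5,3,4,2,6]), ((3,4),10,[5,2,1,6,4,0,3],0,[5,2,1,3,4,0,6]),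
   ((4,6),10,[5,3,2,1,4,0,6],0,[5,3,2,1,4,0,6])])"

definition certificate_7_3 :: "(nat \<times> nat) list list \<times> resolution list" where
  "certificate_7_3 = ([[(6,0),(0,1),(4,2),(5,3)], [(4,0),(0,1),(1,2),(6,3)]], [
   ((1,3),4,[5,0,6,2,1,4,3],11,[2,1,5,0,6,4,3]), ((3,4),7,[0,4,1,5,2,3,6],0,[0,1,6,3,5,4,2]),
   ((1,6),6,[5,0,3,2,1,4,6],0,[0,4,2,3,1,5,6]), ((1,3),7,[4,0,2,3,1,5,6],14,[3,5,1,0,6,4,2]),
   ((3,5),0,[0,1,2,3,4,5,6],15,[3,1,5,0,6,4,2]), ((1,6),3,[0,1,2,3,4,5,6],0,[0,1,6,3,5,4,2]),
   ((4,6),3,[0,1,2,3,4,5,6],0,[0,1,2,3,4,5,6]), ((3,4),6,[0,1,2,3,4,5,6],18,[2,4,5,0,6,1,3]),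
   ((5,6),1,[0,1,2,3,4,5,6],0,[0,1,2,6,4,5,3]), ((5,6),10,[0,2,1,4,5,6,3],0,[0,1,6,2,4,5,3]),
   ((3,4),13,[0,4,5,2,3,6,1],21,[2,4,1,0,6,5,3]), ((3,5),0,[0,1,2,3,4,5,6],22,[2,5,1,0,6,4,3]),
   ((2,4),0,[0,1,2,3,4,5,6],23,[3,4,1,0,6,5,2]), ((2,5),0,[0,1,2,3,4,5,6],24,[3,5,1,0,6,4,2]),
   ((5,6),6,[0,1,2,3,4,5,6],0,[0,5,3,6,1,4,2]), ((3,5),6,[0,1,2,3,4,5,6],0,[0,1,2,3,4,5,6]),
   ((1,6),11,[0,1,2,3,4,5,6],27,[6,5,1,0,3,4,2]), ((5,6),0,[0,1,2,3,4,5,6],28,[6,1,5,0,3,4,2]),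
   ((2,4),2,[0,1,2,3,4,5,6],0,[0,4,2,3,1,5,6]), ((1,6),9,[0,1,2,3,4,5,6],0,[0,4,6,2,5,1,3]),
   ((3,4),21,[1,2,3,5,6,4,0],31,[3,2,4,0,5,6,1]), ((4,6),0,[0,1,2,3,4,5,6],32,[6,2,4,0,3,5,1]),
   ((4,5),0,[0,1,2,3,4,5,6],33,[5,2,4,0,3,6,1]), ((2,6),0,[0,1,2,3,4,5,6],34,[6,4,2,0,3,5,1]),
   ((2,3),0,[0,1,2,3,4,5,6],35,[3,4,2,0,5,6,1]), ((2,5),0,[0,1,2,3,4,5,6],36,[5,4,2,0,3,6,1]),
   ((2,4),8,[0,1,2,3,4,5,6],0,[2,0,3,1,6,4,5]), ((1,2),8,[0,1,2,3,4,5,6],0,[0,1,2,3,4,5,6]),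
   ((4,6),8,[0,1,2,3,4,5,6],0,[0,1,6,2,5,4,3]), ((1,2),0,[0,1,2,3,4,5,6],13,[0,4,2,3,5,1,6]),
   ((2,4),0,[0,1,2,3,4,5,6],11,[0,5,2,3,1,4,6]), ((2,5),0,[0,1,2,3,4,5,6],3,[0,1,2,3,4,5,6]),
   ((4,6),36,[6,2,4,0,1,5,3],44,[6,3,4,0,2,5,1]), ((1,2),34,[0,2,1,4,5,3,6],0,[0,4,2,3,1,5,6]),
   ((5,6),38,[0,4,5,2,1,3,6],45,[6,3,5,0,2,4,1]), ((2,5),0,[0,1,2,3,4,5,6],46,[2,3,5,0,6,4,1]),
   ((1,2),3,[0,1,2,3,4,5,6],0,[2,0,1,3,5,6,4]), ((2,5),3,[0,1,2,3,4,5,6],0,[0,1,2,3,5,4,6]),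
   ((2,5),41,[4,1,3,2,5,6,0],49,[6,5,4,0,1,3,2]), ((2,4),46,[0,4,5,1,3,2,6],0,[0,1,2,3,4,5,6]),
   ((5,6),41,[1,3,2,4,5,6,0],0,[0,1,2,3,5,4,6]), ((5,6),1,[0,1,2,3,4,5,6],17,[0,6,4,1,5,3,2]),
   ((4,6),1,[0,1,2,3,4,5,6],0,[0,1,2,3,4,5,6]), ((3,4),47,[0,4,5,2,1,3,6],54,[1,4,5,0,2,6,3]),
   ((5,6),53,[4,0,1,5,2,3,6],0,[0,1,2,6,4,5,3]), ((3,4),54,[0,5,4,6,1,2,3],56,[1,4,5,0,2,6,3]),
   ((2,4),0,[0,1,2,3,4,5,6],57,[1,4,5,0,3,6,2]), ((5,6),3,[0,1,2,3,4,5,6],0,[0,1,3,6,4,5,2]),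
   ((2,5),3,[0,1,2,3,4,5,6],0,[0,1,3,2,4,5,6]), ((5,6),6,[0,1,2,6,4,5,3],0,[0,6,2,1,4,5,3]),
   ((2,4),50,[1,2,3,4,6,5,0],61,[1,4,5,0,3,6,2]), ((4,6),0,[0,1,2,3,4,5,6],62,[1,6,5,0,2,3,4]),
   ((2,6),0,[0,1,2,3,4,5,6],63,[1,6,5,0,3,4,2]), ((2,3),0,[0,1,2,3,4,5,6],64,[1,3,5,0,4,6,2]),
   ((3,4),0,[0,1,2,3,4,5,6],65,[1,4,5,0,2,6,3]), ((3,6),0,[0,1,2,3,4,5,6],66,[1,6,5,0,2,4,3]),
   ((5,6),9,[0,1,2,3,4,5,6],0,[0,1,2,3,6,5,4]), ((2,5),9,[0,1,2,3,4,5,6],0,[0,1,2,3,4,5,6]),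
   ((3,5),9,[0,1,2,3,4,5,6],0,[0,1,2,3,4,5,6]), ((1,4),0,[0,1,2,3,4,5,6],33,[0,1,4,2,5,3,6]),
   ((4,6),10,[0,1,2,3,4,5,6],0,[0,6,1,2,5,4,3]), ((1,4),0,[0,1,2,3,4,5,6],2,[0,1,2,3,5,4,6]),
   ((1,5),0,[0,1,2,3,4,5,6],2,[0,1,2,3,4,5,6]), ((2,4),73,[0,1,3,2,6,4,5],74,[2,1,4,0,6,5,3]),
   ((2,5),0,[0,1,2,3,4,5,6],75,[2,3,5,0,6,4,1]), ((4,5),0,[0,1,2,3,4,5,6],77,[5,0,4,1,3,6,2]),
   ((5,6),0,[0,1,2,3,4,5,6],77,[6,3,5,0,2,4,1]), ((4,6),0,[0,1,2,3,4,5,6],78,[6,1,4,0,2,5,3]),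
   ((3,4),32,[0,1,2,3,4,5,6],0,[0,1,2,3,4,5,6]), ((3,4),33,[0,1,2,3,4,5,6],80,[1,4,5,0,2,6,3]),
   ((3,5),1,[0,1,2,3,4,5,6],0,[0,1,2,3,4,5,6]), ((5,6),76,[0,2,1,4,5,3,6],0,[0,6,1,2,4,5,3]),
   ((5,6),77,[0,1,2,4,5,6,3],83,[6,3,5,0,2,4,1]), ((2,5),0,[0,1,2,3,4,5,6],84,[2,3,5,0,6,4,1]),
   ((4,6),0,[0,1,2,3,4,5,6],85,[6,3,4,0,2,5,1]), ((2,4),0,[0,1,2,3,4,5,6],86,[2,3,4,0,6,5,1]),
   ((3,4),0,[1,0,4,3,2,6,5],87,[3,5,4,0,2,6,1]), ((3,5),0,[0,1,2,3,4,5,6],88,[3,4,5,0,2,6,1]),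
   ((1,4),7,[0,1,2,3,4,5,6],0,[0,1,2,3,4,5,6]), ((4,6),7,[0,1,2,3,4,5,6],0,[0,6,1,2,5,4,3]),
   ((2,6),37,[0,1,2,3,4,5,6],0,[0,1,2,3,4,5,6]), ((3,4),0,[0,1,2,3,4,5,6],45,[0,3,2,1,5,4,6]),
   ((3,5),0,[0,1,2,3,4,5,6],3,[0,3,2,1,4,5,6]), ((1,4),0,[0,1,2,3,4,5,6],12,[0,1,2,3,5,4,6]),
   ((1,5),0,[0,1,2,3,4,5,6],5,[0,1,2,3,4,5,6]), ((1,6),22,[0,1,2,3,4,5,6],0,[0,1,2,6,4,5,3]),
   ((2,3),87,[1,2,3,5,6,4,0],97,[5,2,6,0,1,4,3]), ((5,6),0,[0,2,4,6,5,1,3],98,[1,5,3,0,2,4,6]),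
   ((3,4),0,[0,3,2,1,4,5,6],99,[6,4,1,0,2,5,3]), ((3,5),0,[0,1,2,3,4,5,6],100,[6,5,1,0,2,4,3]),
   ((2,3),0,[0,1,2,3,4,5,6],102,[2,6,3,0,1,5,4]), ((2,6),0,[0,1,2,3,4,5,6],103,[2,3,6,0,1,5,4]),
   ((2,4),100,[1,0,5,2,4,3,6],103,[2,3,4,0,6,5,1]), ((5,6),0,[0,1,2,3,4,5,6],104,[3,5,1,0,2,4,6]),
   ((3,5),0,[0,1,2,3,4,5,6],105,[6,5,1,0,2,4,3]), ((4,6),0,[0,1,2,3,4,5,6],106,[6,3,4,0,2,5,1]),
   ((2,6),0,[0,1,2,3,4,5,6],107,[2,4,6,0,3,5,1]), ((3,4),0,[0,1,2,3,4,5,6],108,[3,6,4,0,2,5,1]),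
   ((2,3),0,[0,1,2,3,4,5,6],109,[2,4,3,0,6,5,1]), ((3,6),0,[0,1,2,3,4,5,6],110,[3,4,6,0,2,5,1]),
   ((1,5),8,[0,1,2,3,4,5,6],0,[0,1,2,3,5,4,6]), ((2,6),104,[5,1,2,3,4,6,0],112,[2,3,6,0,1,4,5]),
   ((1,6),0,[0,1,2,3,4,5,6],113,[1,3,6,0,2,4,5]), ((1,3),0,[0,1,2,3,4,5,6],114,[4,1,5,0,2,6,3]),
   ((2,3),0,[0,1,2,3,4,5,6],115,[4,2,5,0,1,6,3]), ((2,4),0,[0,3,5,2,6,1,4],116,[2,6,4,0,3,5,1]),
   ((5,6),0,[0,1,2,3,4,5,6],117,[5,2,6,0,3,4,1]), ((3,6),0,[0,1,2,3,4,5,6],118,[3,2,6,0,5,4,1]),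
   ((4,6),0,[0,1,2,3,4,5,6],119,[6,2,4,0,3,5,1]), ((2,6),0,[0,1,2,3,4,5,6],120,[2,4,6,0,3,5,1]),
   ((1,5),10,[0,1,2,3,4,5,6],0,[1,0,3,4,2,5,6]), ((1,4),10,[0,1,2,3,4,5,6],0,[0,1,2,3,4,5,6]),
   ((2,3),27,[0,1,2,3,4,5,6],0,[0,3,6,1,4,5,2]), ((1,2),27,[0,1,2,3,4,5,6],0,[0,2,6,1,4,5,3]),
   ((4,6),100,[0,1,2,3,4,5,6],125,[2,4,1,0,3,5,6]), ((5,6),0,[0,1,2,3,4,5,6],126,[2,5,1,0,3,4,6]),
   ((2,6),0,[0,1,2,3,4,5,6],128,[2,3,6,0,1,5,4]), ((3,6),0,[0,1,2,3,4,5,6],129,[3,2,6,0,1,5,4]),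
   ((2,3),0,[0,1,2,3,4,5,6],130,[2,6,3,0,1,5,4]), ((1,2),7,[0,1,2,3,4,5,6],0,[0,1,2,3,4,5,6]),
   ((3,6),7,[0,1,2,3,4,5,6],0,[0,3,2,1,4,5,6]), ((1,2),0,[0,1,2,3,4,5,6],9,[0,1,6,2,4,5,3]),
   ((2,6),8,[0,1,2,3,4,5,6],0,[0,2,1,6,4,5,3]), ((3,6),0,[0,1,2,3,4,5,6],2,[0,3,1,6,4,5,2]),
   ((2,3),0,[0,1,2,3,4,5,6],2,[0,3,6,2,4,5,1]), ((1,6),3,[0,1,2,3,4,5,6],5,[0,1,2,3,4,5,6]),
   ((1,3),1,[0,1,2,3,4,5,6],0,[0,1,2,3,4,5,6]), ((3,4),129,[1,3,4,5,6,2,0],106,[0,3,6,5,4,1,2]),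
   ((4,6),0,[0,1,2,3,4,5,6],107,[0,6,3,5,4,1,2]), ((5,6),132,[4,1,2,3,5,6,0],0,[0,1,2,5,4,3,6]),
   ((1,3),43,[0,1,2,3,4,5,6],141,[5,1,6,0,2,4,3]), ((3,4),0,[0,1,2,3,4,5,6],142,[5,4,6,0,1,2,3]),
   ((3,4),0,[0,1,2,6,4,3,5],143,[6,4,5,0,1,2,3]), ((1,3),0,[0,1,2,3,4,5,6],144,[6,1,5,0,2,4,3]),
   ((2,3),0,[0,1,2,3,4,5,6],145,[6,2,5,0,1,4,3]), ((1,4),0,[0,3,5,2,4,1,6],25,[0,1,2,3,4,5,6]),
   ((5,6),7,[0,1,2,3,4,5,6],0,[0,6,3,1,4,2,5]), ((3,5),7,[0,1,2,3,4,5,6],0,[0,1,2,3,4,6,5]),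
   ((3,5),1,[0,1,2,3,4,5,6],2,[0,3,5,1,4,2,6]), ((3,6),1,[0,1,2,3,4,5,6],0,[0,1,2,3,4,5,6]),
   ((2,4),0,[0,1,2,3,4,5,6],117,[0,2,1,3,4,5,6]), ((2,6),0,[0,1,2,3,4,5,6],5,[0,2,1,3,4,5,6]),
   ((4,6),145,[1,3,4,2,5,6,0],153,[2,4,1,0,3,5,6]), ((4,5),0,[0,1,2,3,4,5,6],154,[2,4,1,0,3,6,5]),
   ((2,4),0,[0,1,2,3,4,5,6],155,[5,4,1,0,3,6,2]), ((3,6),0,[0,1,2,3,4,5,6],156,[3,2,6,0,5,4,1]),
   ((2,3),0,[0,1,2,3,4,5,6],157,[3,5,2,0,6,4,1]), ((3,5),0,[0,1,2,3,4,5,6],158,[3,2,5,0,6,4,1]),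
   ((2,6),0,[0,1,2,3,4,5,6],159,[2,5,6,0,3,4,1]), ((2,5),0,[0,1,2,3,4,5,6],160,[2,6,5,0,3,4,1]),
   ((5,6),0,[0,1,2,3,4,5,6],161,[5,2,6,0,3,4,1]), ((3,4),151,[2,3,4,5,6,1,0],162,[3,2,4,0,5,6,1]),
   ((2,3),0,[0,1,2,3,4,5,6],163,[3,4,2,0,5,6,1]), ((2,4),0,[0,1,2,3,4,5,6],164,[2,5,4,0,3,6,1]),
   ((4,6),0,[0,1,2,3,4,5,6],165,[6,2,4,0,3,5,1]), ((3,6),0,[0,1,2,3,4,5,6],166,[3,2,6,0,5,4,1]),
   ((4,5),0,[0,1,2,3,4,5,6],167,[5,2,4,0,3,6,1]), ((3,5),0,[0,1,2,3,4,5,6],168,[3,2,5,0,6,4,1]),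
   ((2,6),0,[0,1,2,3,4,5,6],169,[2,4,6,0,3,5,1]), ((5,6),0,[0,1,2,3,4,5,6],170,[5,2,6,0,3,4,1]),
   ((2,5),0,[0,1,2,3,4,5,6],171,[2,4,5,0,3,6,1]), ((1,4),10,[0,1,2,3,4,5,6],0,[0,1,2,3,4,5,6]),
   ((1,3),26,[0,1,2,3,4,5,6],0,[0,1,2,5,4,3,6]), ((2,3),21,[0,1,2,3,4,5,6],0,[0,2,1,6,4,5,3]),
   ((1,6),108,[0,1,2,3,4,5,6],175,[2,6,5,0,3,4,1]), ((1,3),0,[0,1,2,3,4,5,6],176,[2,3,5,0,4,6,1]),
   ((1,2),0,[0,1,2,3,4,5,6],177,[3,2,5,0,4,6,1]), ((1,4),0,[0,1,2,3,4,5,6],178,[2,4,5,0,3,6,1]),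
   ((1,3),6,[0,1,2,3,4,5,6],0,[0,2,3,5,6,1,4]), ((1,5),6,[0,1,2,3,4,5,6],0,[0,1,2,3,4,5,6]),
   ((2,5),6,[0,1,2,3,4,5,6],0,[0,2,1,3,4,6,5]), ((1,4),0,[0,1,2,3,4,5,6],145,[0,1,2,3,4,5,6]),
   ((3,5),172,[1,2,3,5,6,4,0],0,[0,3,5,1,4,2,6]), ((5,6),0,[0,1,2,3,4,5,6],1,[0,6,5,1,4,2,3]),
   ((1,3),2,[0,1,2,3,4,5,6],38,[0,1,2,5,4,6,3]), ((3,6),1,[0,1,2,3,4,5,6],0,[0,3,6,5,4,1,2]),
   ((1,5),0,[0,1,2,3,4,5,6],4,[0,1,5,2,4,3,6]), ((1,6),0,[0,1,2,3,4,5,6],2,[0,1,6,5,4,2,3]),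
   ((1,5),3,[0,1,2,3,4,5,6],15,[0,1,2,3,4,6,5]), ((1,3),1,[0,1,2,3,4,5,6],0,[0,1,3,5,4,6,2]),
   ((2,6),0,[0,1,2,3,4,5,6],8,[0,2,6,1,4,3,5]), ((2,5),0,[0,1,2,3,4,5,6],6,[0,2,5,6,4,1,3]),
   ((2,3),0,[0,1,2,3,4,5,6],3,[0,2,3,5,4,6,1]), ((1,6),4,[0,1,2,3,4,5,6],13,[0,1,2,3,4,5,6]),
   ((1,2),1,[0,1,2,3,4,5,6],0,[0,1,2,3,4,5,6]), ((0,4),58,[0,1,2,3,4,5,6],0,[0,1,2,3,5,4,6]),
   ((2,5),149,[0,1,2,3,4,5,6],0,[2,0,3,4,1,6,5]), ((2,4),149,[0,1,2,3,4,5,6],0,[0,1,2,3,4,5,6]),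
   ((1,6),194,[4,0,2,3,1,5,6],200,[6,2,1,0,3,5,4]), ((5,6),0,[0,1,2,3,4,5,6],201,[6,3,5,0,2,4,1]),
   ((1,5),0,[0,1,2,3,4,5,6],202,[5,0,1,2,3,6,4]), ((3,4),158,[0,1,2,3,5,4,6],0,[0,4,2,3,1,5,6]),
   ((3,4),1,[0,1,2,3,4,5,6],124,[3,0,1,2,5,6,4]), ((1,3),1,[0,1,2,3,4,5,6],0,[0,1,2,3,4,5,6]),
   ((3,5),6,[0,1,2,3,4,5,6],102,[3,0,5,2,1,4,6]), ((1,3),0,[0,1,2,3,4,5,6],103,[3,0,1,2,4,5,6]),
   ((3,5),2,[0,1,2,3,4,5,6],0,[2,1,0,3,6,4,5]), ((2,4),9,[0,1,3,2,4,5,6],0,[0,1,2,3,5,4,6]),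
   ((2,4),1,[0,1,2,3,4,5,6],77,[2,0,4,3,1,6,5]), ((1,2),1,[0,1,2,3,4,5,6],0,[0,5,2,3,4,1,6]),
   ((1,2),1,[0,1,2,3,4,5,6],14,[2,0,1,3,4,6,5]), ((2,5),1,[0,1,2,3,4,5,6],0,[0,1,2,3,4,5,6]),
   ((2,6),170,[0,1,2,3,4,5,6],0,[0,1,2,6,4,5,3]), ((2,5),204,[0,2,3,4,5,6,1],0,[2,3,1,0,4,6,5]),
   ((2,4),205,[0,2,3,4,5,6,1],0,[0,4,2,3,5,1,6]), ((3,4),9,[0,1,2,3,4,5,6],113,[3,0,4,2,1,5,6]),
   ((2,6),4,[0,1,2,3,4,5,6],0,[0,1,3,2,4,5,6]), ((3,6),4,[0,1,2,3,4,5,6],0,[0,1,6,3,4,5,2]),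
   ((3,5),120,[0,1,2,3,4,5,6],219,[1,5,6,0,2,4,3]), ((3,4),0,[0,1,2,3,4,5,6],220,[1,4,6,0,2,5,3]),
   ((2,3),0,[0,1,2,3,4,5,6],222,[2,6,3,0,1,5,4]), ((5,6),212,[0,2,1,4,5,6,3],0,[6,0,5,3,1,4,2]),
   ((4,6),0,[0,1,2,3,4,5,6],1,[6,0,4,3,1,5,2]), ((1,6),0,[0,1,2,3,4,5,6],2,[6,0,1,3,4,5,2]),
   ((2,6),3,[0,1,2,3,4,5,6],226,[2,3,6,0,1,5,4]), ((2,5),1,[0,1,2,3,4,5,6],0,[2,0,5,3,1,4,6]),
   ((2,4),0,[0,1,2,3,4,5,6],1,[2,0,4,3,1,5,6]), ((1,2),0,[0,1,2,3,4,5,6],2,[2,0,1,3,4,5,6]),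
   ((2,6),12,[0,1,2,3,4,5,6],0,[0,1,2,3,4,5,6]), ((3,6),12,[0,1,2,3,4,5,6],0,[0,1,2,3,4,5,6]),
   ((2,3),12,[0,1,2,3,4,5,6],0,[0,1,2,3,4,5,6]), ((0,5),0,[0,1,2,3,4,5,6],94,[0,2,3,5,1,4,6]),
   ((2,3),18,[0,1,2,3,4,5,6],0,[2,4,0,1,6,5,3]), ((2,5),18,[0,1,2,3,4,5,6],0,[0,5,2,1,3,4,6]),
   ((0,4),2,[0,1,2,3,4,5,6],38,[0,2,3,4,5,1,6]), ((2,4),2,[0,1,2,3,4,5,6],0,[2,6,0,1,5,3,4]),
   ((2,3),2,[0,1,2,3,4,5,6],0,[0,3,2,1,4,5,6]), ((3,5),234,[1,0,2,4,5,3,6],24,[3,0,1,2,4,6,5]),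
   ((3,4),0,[0,1,2,3,4,5,6],6,[3,0,1,2,6,5,4]), ((1,3),233,[3,1,6,4,0,2,5],0,[0,1,2,3,4,5,6]),
   ((2,4),0,[0,1,2,3,4,5,6],27,[2,1,3,0,5,6,4]), ((2,5),1,[0,4,6,1,3,5,2],0,[0,1,2,5,4,3,6]),
   ((2,5),1,[0,1,2,3,4,5,6],10,[2,1,0,3,6,4,5]), ((2,3),1,[0,1,2,3,4,5,6],0,[0,1,2,3,4,5,6]),
   ((1,2),0,[0,1,2,3,4,5,6],8,[0,1,2,3,4,5,6]), ((5,6),8,[0,1,2,3,4,5,6],0,[0,5,2,1,3,4,6]),
   ((3,6),1,[0,1,2,3,4,5,6],33,[6,2,1,0,4,5,3]), ((3,6),1,[0,1,2,3,4,5,6],0,[0,3,2,5,1,4,6]),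
   ((5,6),1,[0,1,2,3,4,5,6],16,[6,2,0,1,4,3,5]), ((4,6),1,[0,1,2,3,4,5,6],0,[0,4,2,3,1,5,6]),
   ((4,6),1,[0,1,2,3,4,5,6],15,[6,2,0,1,5,3,4]), ((1,6),1,[0,1,2,3,4,5,6],0,[0,1,2,3,4,5,6]),
   ((1,2),243,[0,2,1,4,5,6,3],20,[2,4,0,1,5,3,6]), ((2,5),0,[0,1,2,3,4,5,6],18,[2,4,0,5,3,1,6]),
   ((0,5),58,[0,1,2,3,4,5,6],59,[0,1,2,3,4,5,6]), ((0,1),20,[0,1,2,3,5,4,6],0,[0,1,2,3,5,4,6]),
   ((2,4),2,[0,1,2,3,4,5,6],0,[2,5,0,4,3,1,6]), ((1,6),0,[0,1,2,3,4,5,6],40,[6,3,2,0,4,5,1]),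
   ((4,6),0,[0,1,2,3,4,5,6],26,[6,3,0,2,5,1,4]), ((5,6),0,[0,1,2,3,4,5,6],24,[6,3,0,2,4,1,5]),
   ((3,6),0,[0,1,2,3,4,5,6],4,[6,5,0,2,4,1,3]), ((2,6),9,[0,1,2,3,4,5,6],0,[0,1,2,5,3,4,6]),
   ((1,5),253,[0,2,1,3,6,5,4],0,[5,0,1,2,3,6,4]), ((4,6),254,[0,2,3,5,6,4,1],0,[0,1,2,3,6,4,5]),
   ((0,5),2,[0,1,2,3,4,5,6],33,[0,1,2,5,3,4,6]), ((5,6),2,[0,1,2,3,4,5,6],0,[5,0,4,2,3,1,6]),
   ((3,4),2,[0,1,2,3,4,5,6],0,[0,1,2,5,3,4,6]), ((0,1),2,[0,1,2,3,4,5,6],35,[0,3,1,2,4,5,6]),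
   ((3,5),2,[0,1,2,3,4,5,6],0,[5,6,3,0,2,1,4]), ((4,5),2,[0,1,2,3,4,5,6],0,[0,1,2,3,5,4,6]),
   ((2,3),0,[0,1,2,3,4,5,6],33,[2,1,3,4,5,6,0]), ((2,5),0,[0,1,2,3,4,5,6],6,[2,1,0,4,6,3,5]),
   ((2,4),0,[0,1,2,3,4,5,6],4,[2,5,0,1,6,3,4]), ((0,4),5,[0,5,2,3,4,1,6],38,[0,3,2,4,5,1,6]),
   ((2,6),1,[0,1,2,3,4,5,6],0,[2,5,0,1,4,3,6]), ((0,3),1,[0,5,2,3,4,1,6],19,[0,5,2,3,4,1,6]),
   ((1,2),1,[0,1,2,3,4,5,6],0,[2,6,0,5,4,3,1]), ((0,3),0,[0,1,2,3,4,5,6],15,[0,1,2,4,5,6,3]),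
   ((4,6),7,[0,1,6,3,2,4,5],0,[6,0,4,3,1,2,5]), ((0,1),1,[0,1,2,3,4,5,6],14,[0,4,1,5,6,3,2]),
   ((2,6),1,[0,1,2,3,4,5,6],0,[6,4,2,3,0,1,5]), ((0,4),1,[0,3,2,1,4,5,6],13,[0,3,2,5,6,1,4]),
   ((1,6),1,[0,1,2,3,4,5,6],0,[6,4,1,3,2,0,5]), ((0,5),1,[0,4,2,3,1,5,6],9,[0,4,2,6,3,1,5]),
   ((5,6),1,[0,1,2,3,4,5,6],0,[5,4,6,3,2,1,0]), ((0,5),0,[0,1,2,3,4,5,6],8,[0,1,5,2,3,4,6]),
   ((0,1),0,[0,1,2,3,4,5,6],8,[0,2,1,5,3,4,6]), ((0,4),0,[0,5,2,3,4,1,6],7,[0,5,4,1,2,3,6]),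
   ((0,6),0,[0,5,2,3,4,1,6],6,[0,5,6,4,1,2,3]), ((0,3),0,[0,6,2,3,5,4,1],5,[0,6,3,5,4,1,2]),
   ((0,6),6,[0,5,2,4,3,1,6],14,[0,5,2,4,3,1,6]), ((0,2),1,[0,6,2,5,4,3,1],0,[0,6,2,5,4,3,1])])"

definition certificate_7_4 :: "(nat \<times> nat) list list \<times> resolution list" where
  "certificate_7_4 = ([[(3,0),(5,1),(6,2)]], [
   ((3,5),2,[4,0,2,6,1,3,5],5,[6,3,4,5,2,1,0]), ((4,5),2,[0,2,6,1,3,5,4],0,[0,1,2,3,4,5,6]),
   ((3,4),0,[0,1,2,3,4,5,6],1,[0,1,2,5,4,3,6]), ((1,4),7,[0,2,3,4,5,6,1],0,[0,1,2,3,4,5,6]),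
   ((4,5),0,[0,5,2,1,3,4,6],9,[6,5,1,4,2,3,0]), ((1,4),2,[0,1,2,4,3,5,6],0,[0,1,2,3,4,5,6]),
   ((1,3),2,[0,1,2,3,4,5,6],0,[0,1,2,3,4,5,6]), ((1,6),9,[2,1,3,5,0,4,6],12,[5,1,2,6,4,0,3]),
   ((5,6),0,[0,1,2,3,4,5,6],13,[4,5,2,6,3,0,1]), ((3,6),0,[0,1,2,3,4,5,6],14,[5,3,2,6,4,0,1]),
   ((0,1),0,[0,1,2,3,4,5,6],15,[6,4,0,2,5,1,3]), ((0,5),0,[0,1,2,3,4,5,6],16,[6,4,0,2,3,5,1]),
   ((0,3),0,[0,1,2,3,4,5,6],17,[6,4,0,2,5,3,1]), ((0,6),0,[0,1,2,3,4,5,6],18,[5,4,0,2,3,6,1]),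
   ((3,4),0,[0,1,2,3,4,5,6],19,[6,3,2,4,5,0,1]), ((1,4),0,[0,1,2,3,4,5,6],20,[6,1,2,4,5,0,3]),
   ((4,5),0,[0,1,2,3,4,5,6],21,[6,5,2,4,3,0,1]), ((0,4),0,[0,1,2,3,4,5,6],22,[5,6,0,2,3,4,1]),
   ((4,6),0,[0,1,2,3,4,5,6],23,[5,6,2,4,3,0,1]), ((1,4),14,[0,1,2,3,5,4,6],0,[3,0,1,2,4,6,5]),
   ((1,3),14,[0,1,2,5,4,3,6],0,[0,1,2,3,4,5,6]), ((1,5),14,[0,1,2,3,4,5,6],0,[0,1,2,3,4,5,6]),
   ((5,6),0,[0,1,2,3,4,5,6],27,[4,5,0,6,3,2,1]), ((3,6),0,[0,1,2,3,4,5,6],28,[5,3,0,6,4,2,1]),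
   ((1,3),25,[3,5,6,0,1,4,2],0,[1,0,4,5,2,6,3]), ((4,6),1,[0,1,2,3,4,5,6],30,[5,4,0,6,3,2,1]),
   ((1,6),0,[0,1,2,3,4,5,6],31,[5,1,0,6,4,2,3]), ((3,6),0,[2,1,6,3,4,5,0],32,[5,3,2,6,4,0,1]),
   ((4,6),0,[0,1,2,3,4,5,6],33,[5,4,2,6,3,0,1]), ((5,6),0,[0,1,2,3,4,5,6],34,[4,5,2,6,3,0,1]),
   ((1,6),0,[0,1,2,3,4,5,6],35,[5,1,2,6,4,0,3]), ((2,4),0,[0,1,2,3,4,5,6],12,[0,1,2,3,4,5,6]),
   ((1,5),7,[0,1,2,3,4,5,6],0,[4,0,1,2,3,6,5]), ((3,4),36,[0,1,3,2,4,5,6],38,[6,3,0,4,5,2,1]),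
   ((1,4),0,[0,1,2,3,4,5,6],39,[6,1,0,4,5,2,3]), ((1,6),0,[0,1,2,3,4,5,6],40,[5,1,0,6,4,2,3]),
   ((3,6),0,[0,1,2,3,4,5,6],41,[5,3,0,6,4,2,1]), ((4,6),0,[0,1,2,3,4,5,6],42,[5,6,0,4,3,2,1]),
   ((3,5),0,[0,1,2,3,4,5,6],43,[6,3,0,5,4,2,1]), ((1,5),0,[0,1,2,3,4,5,6],44,[6,1,0,5,4,2,3]),
   ((5,6),0,[0,1,2,3,4,5,6],45,[4,6,0,5,3,2,1]), ((4,5),0,[0,1,2,3,4,5,6],46,[6,5,0,4,3,2,1]),
   ((0,4),28,[5,1,0,3,2,4,6],0,[0,1,2,3,4,5,6]), ((0,4),11,[2,3,0,4,1,6,5],0,[0,3,2,6,1,4,5]),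
   ((1,6),11,[0,1,2,3,4,5,6],0,[1,3,4,0,5,6,2]), ((3,4),23,[0,1,2,3,5,6,4],0,[0,3,2,1,4,5,6]),
   ((3,4),1,[0,1,2,3,4,5,6],17,[3,0,4,5,6,2,1]), ((4,6),1,[0,1,2,3,4,5,6],0,[0,6,2,3,4,1,5]),
   ((4,6),1,[0,1,2,3,4,5,6],16,[1,0,4,2,3,5,6]), ((1,4),1,[0,1,2,3,4,5,6],0,[0,1,2,3,4,5,6]),
   ((1,4),1,[0,5,2,3,1,4,6],55,[6,3,1,5,2,4,0]), ((3,5),19,[1,0,5,2,6,3,4],0,[0,1,2,3,4,5,6]),
   ((1,5),3,[0,4,2,3,5,1,6],0,[0,1,2,3,4,5,6]), ((4,5),3,[0,1,2,3,4,5,6],0,[0,1,2,3,4,5,6]),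
   ((0,6),0,[0,1,2,3,4,5,6],27,[0,1,2,3,4,5,6]), ((0,3),0,[0,1,2,3,4,5,6],23,[2,1,0,4,6,5,3]),
   ((0,1),0,[0,1,2,3,4,5,6],12,[0,3,2,4,6,1,5]), ((3,5),57,[1,2,3,4,5,6,0],62,[6,3,0,5,4,1,2]),
   ((3,4),0,[0,1,2,3,4,5,6],63,[6,3,0,4,5,1,2]), ((4,5),0,[0,1,2,3,4,5,6],64,[6,5,0,4,3,1,2]),
   ((3,6),0,[0,1,2,3,4,5,6],65,[5,3,0,6,4,1,2]), ((4,6),0,[0,1,2,3,4,5,6],66,[5,6,0,4,3,1,2]),
   ((5,6),0,[0,1,2,3,4,5,6],67,[4,6,0,5,3,1,2]), ((1,3),0,[0,1,2,3,4,5,6],68,[6,3,0,1,5,2,4]),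
   ((1,5),0,[0,1,2,3,4,5,6],69,[6,5,0,1,4,2,3]), ((1,6),0,[0,1,2,3,4,5,6],70,[5,6,0,1,4,2,3]),
   ((1,4),0,[0,1,2,3,4,5,6],71,[6,4,0,1,5,2,3]), ((0,4),25,[0,3,2,4,1,5,6],0,[0,1,2,3,4,5,6]),
   ((0,1),25,[0,1,2,3,4,5,6],0,[0,1,2,3,4,5,6]), ((0,6),25,[0,1,2,3,4,5,6],0,[0,1,2,3,4,5,6]),
   ((0,4),13,[0,1,2,3,4,5,6],0,[0,1,2,5,3,4,6]), ((4,5),17,[2,0,4,1,3,5,6],0,[5,0,4,1,3,2,6]),
   ((0,4),4,[0,1,2,4,6,3,5],5,[0,1,2,6,3,4,5]), ((0,1),4,[0,4,2,1,6,3,5],0,[0,1,2,3,4,5,6]),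
   ((0,3),4,[0,1,2,3,4,5,6],0,[0,1,2,3,4,5,6]), ((0,5),4,[0,1,2,3,4,5,6],0,[0,1,2,3,4,5,6]),
   ((2,4),0,[0,1,2,3,4,5,6],45,[0,1,2,3,5,6,4]), ((1,4),5,[0,1,2,3,4,5,6],0,[1,0,4,2,5,3,6]),
   ((2,6),1,[0,1,2,3,4,5,6],46,[0,1,2,3,4,5,6]), ((0,4),1,[0,1,2,3,4,5,6],0,[0,2,4,3,5,6,1]),
   ((4,6),1,[2,0,4,3,5,6,1],85,[5,6,2,4,3,0,1]), ((0,4),0,[0,6,2,3,4,5,1],86,[6,3,0,2,5,4,1]),
   ((3,4),0,[0,6,2,3,4,5,1],87,[6,4,2,3,5,0,1]), ((2,4),51,[0,1,2,4,6,5,3],0,[0,6,2,3,4,5,1]),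
   ((2,3),5,[0,1,2,3,6,5,4],0,[0,1,2,3,6,5,4]), ((3,4),5,[0,1,2,3,4,5,6],0,[3,2,4,5,1,6,0]),
   ((3,6),2,[0,2,6,4,5,3,1],3,[0,5,6,3,4,2,1]), ((0,6),2,[4,0,6,5,3,2,1],0,[0,5,2,3,4,1,6]),
   ((4,6),2,[0,1,2,3,4,5,6],0,[5,3,2,1,6,0,4]), ((2,4),0,[0,1,2,3,4,5,6],13,[4,0,2,1,3,5,6]),
   ((2,3),0,[0,1,2,3,4,5,6],13,[3,0,2,1,4,5,6]), ((2,6),0,[0,1,2,4,3,5,6],12,[6,0,2,1,4,5,3]),
   ((0,2),0,[0,1,2,6,4,5,3],7,[0,1,2,6,4,5,3]), ((2,5),0,[6,1,2,4,3,5,0],5,[6,4,1,3,5,0,2]),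
   ((1,4),7,[2,5,4,3,6,0,1],11,[2,5,1,4,6,3,0]), ((1,6),7,[5,4,6,3,2,0,1],0,[5,1,2,4,3,0,6]),
   ((1,2),2,[6,1,2,5,4,3,0],0,[6,1,2,5,4,3,0])])"

definition certificate_7_5 :: "(nat \<times> nat) list list \<times> resolution list" where
  "certificate_7_5 = ([[(3,0),(6,1)]], [
   ((1,5),0,[0,1,2,3,4,5,6],1,[6,1,4,5,3,2,0]), ((2,3),0,[0,1,2,3,4,5,6],2,[6,2,5,3,4,1,0]),
   ((0,5),0,[0,1,2,3,4,5,6],3,[6,0,4,5,3,2,1]), ((1,4),0,[0,1,2,3,4,5,6],4,[6,1,5,4,3,2,0]),
   ((1,3),0,[0,1,2,3,4,5,6],5,[6,1,5,3,4,2,0]), ((0,6),0,[0,1,2,3,4,5,6],6,[5,0,4,6,3,2,1]),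
   ((1,2),0,[0,1,2,3,4,5,6],7,[6,1,5,2,4,3,0]), ((2,4),0,[0,1,2,3,4,5,6],8,[6,2,5,4,3,1,0]),
   ((5,6),0,[0,1,2,3,4,5,6],9,[4,5,3,6,2,1,0]), ((0,1),0,[0,1,2,3,4,5,6],10,[6,0,5,1,4,3,2]),
   ((4,5),0,[0,1,2,3,4,5,6],11,[6,4,3,5,2,1,0]), ((3,5),0,[0,1,2,3,4,5,6],12,[6,3,4,5,2,1,0]),
   ((1,6),0,[0,1,2,3,4,5,6],13,[5,1,4,6,3,2,0]), ((3,6),0,[0,1,2,3,4,5,6],14,[5,3,4,6,2,1,0]),
   ((0,4),0,[0,1,2,3,4,5,6],15,[6,0,5,4,3,2,1]), ((0,2),0,[0,1,2,3,4,5,6],16,[6,0,5,2,4,3,1]),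
   ((3,4),0,[0,1,2,3,4,5,6],17,[6,3,5,4,2,1,0]), ((2,5),0,[0,1,2,3,4,5,6],18,[6,2,4,5,3,1,0]),
   ((0,3),0,[0,5,2,3,4,1,6],19,[6,0,5,3,4,2,1]), ((4,6),0,[5,3,2,1,4,0,6],20,[5,4,3,6,2,1,0]),
   ((2,6),0,[5,4,2,3,1,0,6],21,[5,2,4,6,3,1,0])])"

section \<open>Verification of the data and conclusion\<close>

lemma witnesses_ok: "\<forall>m<6. list_all (witness_ok (Suc m)) (witnesses ! m)"
proof -
  have "list_all (\<lambda>m. list_all (witness_ok (Suc m)) (witnesses ! m)) [0..<6]"
    by code_simp
  then show ?thesis by (simp add: list_all_iff)
qed

lemma certifies_3_1: "certifies 3 1 (witnesses ! 1) certificate_3_1"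
  by code_simp

lemma certifies_4_1: "certifies 4 1 (witnesses ! 1) certificate_4_1"
  by code_simp

lemma certifies_4_2: "certifies 4 2 (witnesses ! 2) certificate_4_2"
  by code_simp

lemma certifies_5_1: "certifies 5 1 (witnesses ! 1) certificate_5_1"
  by code_simp

lemma certifies_5_2: "certifies 5 2 (witnesses ! 2) certificate_5_2"
  by code_simp

lemma certifies_5_3: "certifies 5 3 (witnesses ! 3) certificate_5_3"
  by code_simp

lemma certifies_6_1: "certifies 6 1 (witnesses ! 1) certificate_6_1"
  by code_simp

lemma certifies_6_2: "certifies 6 2 (witnesses ! 2) certificate_6_2"
  by code_simp

lemma certifies_6_3: "certifies 6 3 (witnesses ! 3) certificate_6_3"
  by code_simp

lemma certifies_6_4: "certifies 6 4 (witnesses ! 4) certificate_6_4"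
  by code_simp

lemma certifies_7_1: "certifies 7 1 (witnesses ! 1) certificate_7_1"
  by code_simp

lemma certifies_7_2: "certifies 7 2 (witnesses ! 2) certificate_7_2"
  by code_simp

lemma certifies_7_3: "certifies 7 3 (witnesses ! 3) certificate_7_3"
  by code_simp

lemma certifies_7_4: "certifies 7 4 (witnesses ! 4) certificate_7_4"
  by code_simp

lemma certifies_7_5: "certifies 7 5 (witnesses ! 5) certificate_7_5"
  by code_simp

text \<open>The extreme values of \<open>m\<close> have immediate certificates for every
  \<open>n\<close>, which leaves the fifteen pairs for which data are given.\<close>

lemma certifies_exists:
  assumes "0 < n" "n \<le> 7" "m < n"
  shows "\<exists>ws c. list_all (witness_ok (Suc m)) ws \<and> certifies n m ws c"
proof -
  let ?P = "\<lambda>n m. \<exists>ws c. list_all (witness_ok (Suc m)) ws \<and> certifies n m ws c"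
  \<comment> \<open>The only witness is a single vertex with the zero matrix. It has no edges, so
    its clause is already empty.\<close>
  have "certifies n 0 (witnesses ! 0) ([], [])"
    using assms(1) by (simp add: certifies_def initial_clauses_def witnesses_def gram_edges_def)
  then have first: "?P n 0"
    using witnesses_ok by force
  \<comment> \<open>A stair with one force has no gaps, so its clause is already empty;
    \<open>0 < m\<close> provides the two vertices.\<close>
  have "certifies (Suc m) m [] ([[(0, 1)]], [])" if "0 < m"
    using that by (simp add: certifies_def initial_clauses_def)
  then have last: "?P (Suc m) m" if "0 < m"
    using that by force
  have P: "?P n m" if "certifies n m (witnesses ! m) c" "m < 6" for n m c
    using witnesses_ok that by blast
  have "?P 3 1" "?P 4 1" "?P 4 2" "?P 5 1" "?P 5 2" "?P 5 3" "?P 6 1" "?P 6 2" "?P 6 3" "?P 6 4"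
    "?P 7 1" "?P 7 2" "?P 7 3" "?P 7 4" "?P 7 5"
    by (rule certifies_3_1[THEN P] certifies_4_1[THEN P] certifies_4_2[THEN P] certifies_5_1[THEN P]
        certifies_5_2[THEN P] certifies_5_3[THEN P] certifies_6_1[THEN P] certifies_6_2[THEN P]
        certifies_6_3[THEN P] certifies_6_4[THEN P] certifies_7_1[THEN P] certifies_7_2[THEN P]
        certifies_7_3[THEN P] certifies_7_4[THEN P] certifies_7_5[THEN P], simp)+
  moreover have "m = 0 \<or> n = Suc m \<or> (n, m) \<in> {(3, 1), (4, 1), (4, 2), (5, 1), (5, 2), (5, 3),
      (6, 1), (6, 2), (6, 3), (6, 4), (7, 1), (7, 2), (7, 3), (7, 4), (7, 5)}"
    using assms by (simp, presburger)
  ultimately show ?thesis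
    using first last by (elim disjE) (cases "m = 0"; auto)+
qed

theorem theorem4p3:
  fixes G :: "'a pair_pre_digraph"
  assumes "pair_graph G"
    and "card (pverts G) \<le> 7"
  shows "xi G = floor_Z G"
proof (rule antisym)
  \<comment> \<open>Matrices indexed by the seven-element type have room for every graph
    considered.\<close>
  have card: "card (pverts G) \<le> CARD(7)"
    using assms(2) by simp
  show "xi G \<le> floor_Z G"
    by (rule xi_le_floor_Z[OF assms(1) card])
  show "floor_Z G \<le> xi G"
  proof (rule ccontr)
    assume less: "\<not> floor_Z G \<le> xi G"
    \<comment> \<open>The full vertex set is forcing. Together with the assumed strict inequality
      this puts \<open>xi G\<close> below the number of vertices, in the range of the certificates,
      and excludes the empty graph.\<close>
    have "floor_Z G \<le> card (pverts G)"
      by (rule floor_Z_le_card[OF assms(1)]) (auto simp: floor_forcing_set_def)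
    then obtain ws c where "list_all (witness_ok (Suc (xi G))) ws" "certifies (card (pverts G)) (xi G) ws c"
      using certifies_exists[of "card (pverts G)" "xi G"] assms(2) less by auto
    then have "floor_Z G \<le> xi G \<or> xi G < xi G"
      by (rule certifies_sound[OF assms(1) card])
    then show False using less by simp
  qed
qed

end
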